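(* A ring $R$ is isoartinian if and only if $R$ is isomorphic (as a ring), uniquely, to a direct product of finitely many rings, each of which is of one of the following types (any combination of types, with repetition, being allowed): (i) Artinian local rings; (ii) non-Noetherian isoartinian local rings with nilpotent maximal ideal; (iii) principal ideal domains that are not fields; (iv) Noetherian isoartinian rings $A$ with a unique minimal prime ideal $\mathfrak{p}$ such that $A/\mathfrak{p}$ is a principal ideal domain and $\operatorname{Min} A\subsetneq \operatorname{Ass} A$; (v) non-Noetherian isoartinian rings $A$ with a unique minimal prime ideal $\mathfrak{p}$ such that $A/\mathfrak{p}$ is a principal ideal domain and $\operatorname{Min} A\subsetneq \operatorname{Ass} A$; (vi) non-Noetherian isoartinian rings $A$ with a unique minimal prime ideal $\mathfrak{p}$, where $\mathfrak{p}$ is not maximal, such that $A/\mathfrak{p}$ is a principal ideal domain and $\operatorname{Min} A=\operatorname{Ass} A$. Here uniqueness means: if $R\cong R_1\times\cdots\times R_l\cong S_1\times\cdots\times S_m$ with each $R_i$ and each $S_j$ of one of the types (i)–(vi), then $l=m$ and there is a permutation $\sigma$ of $\{1,\dots,l\}$ with $R_i\cong S_{\sigma(i)}$ for all $i$.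
   Context: All rings are commutative with nonzero identity (in particular nonzero). A ring $R$ is isoartinian if every descending chain $I_1\supseteq I_2\supseteq\cdots$ of ideals of $R$ terminates up to isomorphism, i.e. there is $n$ such that $I_n\cong I_i$ as $R$-modules for all $i\ge n$. A local ring is a ring with a unique maximal ideal (not necessarily Noetherian). $\operatorname{Min} R$ is the set of minimal prime ideals of $R$, and $\operatorname{Ass} R=\{\mathfrak{p}\in\operatorname{Spec} R \mid \mathfrak{p}=(0:_R x)\text{ for some }x\in R\}$, where $(0:_R x)=\{r\in R\mid rx=0\}$. Fields are regarded as principal ideal domains. *)

theory Defs
  imports "HOL-Algebra.Algebra"
begin

definition nonzero_cring :: "('a, 'm) ring_scheme \<Rightarrow> bool" where
  "nonzero_cring R \<longleftrightarrow> cring R \<and> \<one>\<^bsub>R\<^esub> \<noteq> \<zero>\<^bsub>R\<^esub>"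

text \<open>
  An ideal \<open>I\<close> of \<open>R\<close> as an \<open>R\<close>-module. The fields \<open>mult\<close> and \<open>one\<close> are present only because the
  library's module record extends the ring record; they play no role in the module structure.
\<close>

definition ideal_module :: "('a, 'm) ring_scheme \<Rightarrow> 'a set \<Rightarrow> ('a, 'a) module" where
  "ideal_module R I =
     \<lparr>carrier = I, monoid.mult = monoid.mult R, one = \<one>\<^bsub>R\<^esub>, ring.zero = \<zero>\<^bsub>R\<^esub>,
      add = add R, smult = monoid.mult R\<rparr>"

lemma ideal_module_is_module:
  assumes "cring R" and "ideal I R"
  shows "module R (ideal_module R I)"
proof -
  interpret cring R by fact
  interpret ideal I R by fact
  show ?thesis
  proof (rule moduleI)
    show "abelian_group (ideal_module R I)"
    proof (rule abelian_groupI)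
      fix x assume "x \<in> carrier (ideal_module R I)"
      then have "x \<in> I" by (simp add: ideal_module_def)
      then show "\<exists>y\<in>carrier (ideal_module R I).
          y \<oplus>\<^bsub>ideal_module R I\<^esub> x = \<zero>\<^bsub>ideal_module R I\<^esub>"
        using a_inv_closed[of x] Icarr[of x]
        by (auto simp: ideal_module_def intro!: bexI[of _ "\<ominus>\<^bsub>R\<^esub> x"] l_neg)
    qed (auto simp: ideal_module_def a_ac Icarr)
  qed (auto simp: ideal_module_def I_l_closed Icarr l_distr r_distr m_assoc \<open>cring R\<close>)
qed

definition module_iso ::
  "('a, 'm) ring_scheme \<Rightarrow> ('a, 'b, 'n) module_scheme \<Rightarrow> ('a, 'c, 'k) module_scheme \<Rightarrow> ('b \<Rightarrow> 'c) set"
where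
  "module_iso R M N = {h. bij_betw h (carrier M) (carrier N) \<and>
     (\<forall>x\<in>carrier M. \<forall>y\<in>carrier M. h (x \<oplus>\<^bsub>M\<^esub> y) = h x \<oplus>\<^bsub>N\<^esub> h y) \<and>
     (\<forall>r\<in>carrier R. \<forall>x\<in>carrier M. h (r \<odot>\<^bsub>M\<^esub> x) = r \<odot>\<^bsub>N\<^esub> h x)}"

definition ideals_isomorphic :: "('a, 'm) ring_scheme \<Rightarrow> 'a set \<Rightarrow> 'a set \<Rightarrow> bool" where
  "ideals_isomorphic R I J \<longleftrightarrow> module_iso R (ideal_module R I) (ideal_module R J) \<noteq> {}"

definition descending_ideal_chain :: "('a, 'm) ring_scheme \<Rightarrow> (nat \<Rightarrow> 'a set) \<Rightarrow> bool" where
  "descending_ideal_chain R I \<longleftrightarrow> (\<forall>n. ideal (I n) R) \<and> (\<forall>n. I (Suc n) \<subseteq> I n)"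

definition isoartinian :: "('a, 'm) ring_scheme \<Rightarrow> bool" where
  "isoartinian R \<longleftrightarrow> (\<forall>I. descending_ideal_chain R I \<longrightarrow>
     (\<exists>n. \<forall>i\<ge>n. ideals_isomorphic R (I n) (I i)))"

definition artinian :: "('a, 'm) ring_scheme \<Rightarrow> bool" where
  "artinian R \<longleftrightarrow> (\<forall>I. descending_ideal_chain R I \<longrightarrow> (\<exists>n. \<forall>i\<ge>n. I n = I i))"

definition local_ring :: "('a, 'm) ring_scheme \<Rightarrow> bool" where
  "local_ring R \<longleftrightarrow> (\<exists>!M. maximalideal M R)"

text \<open>The power is taken in the library's semiring of ideals, whose product is the ideal product.\<close>

definition nilpotent_ideal :: "('a, 'm) ring_scheme \<Rightarrow> 'a set \<Rightarrow> bool" where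
  "nilpotent_ideal R I \<longleftrightarrow> (\<exists>n::nat. I [^]\<^bsub>ideals_set R\<^esub> n = {\<zero>\<^bsub>R\<^esub>})"

definition min_primes :: "('a, 'm) ring_scheme \<Rightarrow> 'a set set" where
  "min_primes R =
     {P. primeideal P R \<and> (\<forall>Q. primeideal Q R \<and> Q \<subseteq> P \<longrightarrow> Q = P)}"

definition annihilator :: "('a, 'm) ring_scheme \<Rightarrow> 'a \<Rightarrow> 'a set" where
  "annihilator R x = {r \<in> carrier R. r \<otimes>\<^bsub>R\<^esub> x = \<zero>\<^bsub>R\<^esub>}"

definition ass_primes :: "('a, 'm) ring_scheme \<Rightarrow> 'a set set" where
  "ass_primes R = {P. primeideal P R \<and> (\<exists>x\<in>carrier R. P = annihilator R x)}"

definition type_i :: "('a, 'm) ring_scheme \<Rightarrow> bool" where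
  "type_i A \<longleftrightarrow> nonzero_cring A \<and> artinian A \<and> local_ring A"

definition type_ii :: "('a, 'm) ring_scheme \<Rightarrow> bool" where
  "type_ii A \<longleftrightarrow> nonzero_cring A \<and> \<not> noetherian_ring A \<and> isoartinian A \<and> local_ring A \<and>
     (\<forall>M. maximalideal M A \<longrightarrow> nilpotent_ideal A M)"

definition type_iii :: "('a, 'm) ring_scheme \<Rightarrow> bool" where
  "type_iii A \<longleftrightarrow> principal_domain A \<and> \<not> field A"

definition type_iv :: "('a, 'm) ring_scheme \<Rightarrow> bool" where
  "type_iv A \<longleftrightarrow> nonzero_cring A \<and> noetherian_ring A \<and> isoartinian A \<and>
     (\<exists>p. min_primes A = {p} \<and> principal_domain (A Quot p)) \<and>
     min_primes A \<subset> ass_primes A"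

definition type_v :: "('a, 'm) ring_scheme \<Rightarrow> bool" where
  "type_v A \<longleftrightarrow> nonzero_cring A \<and> \<not> noetherian_ring A \<and> isoartinian A \<and>
     (\<exists>p. min_primes A = {p} \<and> principal_domain (A Quot p)) \<and>
     min_primes A \<subset> ass_primes A"

definition type_vi :: "('a, 'm) ring_scheme \<Rightarrow> bool" where
  "type_vi A \<longleftrightarrow> nonzero_cring A \<and> \<not> noetherian_ring A \<and> isoartinian A \<and>
     (\<exists>p. min_primes A = {p} \<and> \<not> maximalideal p A \<and> principal_domain (A Quot p)) \<and>
     min_primes A = ass_primes A"

text \<open>
  \<open>decomposition R As\<close>: the ring \<open>R\<close> is isomorphic to the direct product of the finite list \<open>As\<close> of
  rings, each of one of the six types. The empty product is the zero ring, so \<open>As\<close> is nonempty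
  whenever \<open>R\<close> is nonzero.
\<close>

definition decomposition :: "('a, 'm) ring_scheme \<Rightarrow> ('b, 'n) ring_scheme list \<Rightarrow> bool" where
  "decomposition R As \<longleftrightarrow>
     (\<forall>A\<in>set As. type_i A \<or> type_ii A \<or> type_iii A \<or> type_iv A \<or> type_v A \<or> type_vi A) \<and>
     R \<simeq> RDirProd_list As"

end

(*
  Every nonempty family of ideals of an isoartinian ring R has a member that is minimal up to
  isomorphism. Isomorphic ideals have the same annihilator, and module isomorphisms between ideals
  preserve nilpotency of elements. Hence principal ideals eR with e idempotent satisfy the
  descending chain condition, so R is a finite product of corner rings eR with e primitive, and
  R / nil(R) is again isoartinian.

  If R is reduced, isoartinian and connected, then every ideal with zero annihilator is isomorphic
  to R, hence principal; applied to I + ann(I) this shows that annihilators are generated by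
  idempotents, so R is a domain, and then a principal ideal domain. For R connected but not reduced,
  p = nil(R) is therefore prime with R/p a principal ideal domain. Minimality arguments show that p
  is nilpotent and associated. If p is maximal, R has type (i) or (ii); if p = 0, it has type (iii);
  otherwise the only point is that a Noetherian R has a second associated prime.

  Uniqueness holds because each type is connected, so that the factors are the corner rings at the
  primitive idempotents of the product.
*)
theory Submission
  imports Defs
begin

section \<open>Isomorphisms of ideals\<close>

text \<open>Stabilisation up to isomorphism forgets inclusions, so only invariants of an isomorphism
  class can be exploited. Chain arguments therefore run on annihilators: when t x R lies in x R and
  the two are isomorphic, \<open>t \<otimes> x\<close> and \<open>x\<close> have the same
  annihilator, and this equality is used as a cancellation rule. A second obstacle is that an
  isomorphism between two ideals need not respect a third ideal, so it does not descend to arbitrary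
  quotients; nilpotency being intrinsic, it does descend modulo the nilradical, which is why the
  structure theory starts there. Localisation is never constructed: multiplication by elements
  outside a prime and saturated ideals take its place. For connectedness one criterion covers all
  six types, namely a prime ideal contained in every maximal ideal.\<close>

lemma ideals_isomorphic_iff:
  "ideals_isomorphic R I J \<longleftrightarrow>
    (\<exists>h. bij_betw h I J \<and> (\<forall>x\<in>I. \<forall>y\<in>I. h (x \<oplus>\<^bsub>R\<^esub> y) = h x \<oplus>\<^bsub>R\<^esub> h y) \<and>
      (\<forall>r\<in>carrier R. \<forall>x\<in>I. h (r \<otimes>\<^bsub>R\<^esub> x) = r \<otimes>\<^bsub>R\<^esub> h x))"
  by (auto simp: ideals_isomorphic_def module_iso_def ideal_module_def)

lemma ideals_isomorphicE:
  assumes "ideals_isomorphic R I J"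
  obtains h where "bij_betw h I J"
    and "\<And>x y. x \<in> I \<Longrightarrow> y \<in> I \<Longrightarrow> h (x \<oplus>\<^bsub>R\<^esub> y) = h x \<oplus>\<^bsub>R\<^esub> h y"
    and "\<And>r x. r \<in> carrier R \<Longrightarrow> x \<in> I \<Longrightarrow> h (r \<otimes>\<^bsub>R\<^esub> x) = r \<otimes>\<^bsub>R\<^esub> h x"
  using assms unfolding ideals_isomorphic_iff by blast

lemma ideals_isomorphicI:
  assumes "bij_betw h I J"
    and "\<And>x y. x \<in> I \<Longrightarrow> y \<in> I \<Longrightarrow> h (x \<oplus>\<^bsub>R\<^esub> y) = h x \<oplus>\<^bsub>R\<^esub> h y"
    and "\<And>r x. r \<in> carrier R \<Longrightarrow> x \<in> I \<Longrightarrow> h (r \<otimes>\<^bsub>R\<^esub> x) = r \<otimes>\<^bsub>R\<^esub> h x"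
  shows "ideals_isomorphic R I J"
  using assms unfolding ideals_isomorphic_iff by blast

lemma ideals_isomorphic_refl: "ideals_isomorphic R I I"
  by (rule ideals_isomorphicI[of id]) (auto simp: bij_betw_id)

lemma ideals_isomorphic_trans:
  assumes "ideals_isomorphic R I J" and "ideals_isomorphic R J K"
  shows "ideals_isomorphic R I K"
proof -
  obtain g where g: "bij_betw g I J"
      "\<And>x y. x \<in> I \<Longrightarrow> y \<in> I \<Longrightarrow> g (x \<oplus>\<^bsub>R\<^esub> y) = g x \<oplus>\<^bsub>R\<^esub> g y"
      "\<And>r x. r \<in> carrier R \<Longrightarrow> x \<in> I \<Longrightarrow> g (r \<otimes>\<^bsub>R\<^esub> x) = r \<otimes>\<^bsub>R\<^esub> g x"
    using ideals_isomorphicE[OF assms(1)] by metis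
  obtain h where h: "bij_betw h J K"
      "\<And>x y. x \<in> J \<Longrightarrow> y \<in> J \<Longrightarrow> h (x \<oplus>\<^bsub>R\<^esub> y) = h x \<oplus>\<^bsub>R\<^esub> h y"
      "\<And>r x. r \<in> carrier R \<Longrightarrow> x \<in> J \<Longrightarrow> h (r \<otimes>\<^bsub>R\<^esub> x) = r \<otimes>\<^bsub>R\<^esub> h x"
    using ideals_isomorphicE[OF assms(2)] by metis
  have "g x \<in> J" if "x \<in> I" for x using g(1) that by (auto simp: bij_betw_def)
  then show ?thesis
    by (intro ideals_isomorphicI[of "h \<circ> g"] bij_betw_trans[OF g(1) h(1)]) (simp_all add: g h)
qed

lemma ideals_isomorphic_sym:
  assumes "ideals_isomorphic R I J" and "ideal I R"
  shows "ideals_isomorphic R J I"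
proof -
  obtain h where h: "bij_betw h I J"
      "\<And>x y. x \<in> I \<Longrightarrow> y \<in> I \<Longrightarrow> h (x \<oplus>\<^bsub>R\<^esub> y) = h x \<oplus>\<^bsub>R\<^esub> h y"
      "\<And>r x. r \<in> carrier R \<Longrightarrow> x \<in> I \<Longrightarrow> h (r \<otimes>\<^bsub>R\<^esub> x) = r \<otimes>\<^bsub>R\<^esub> h x"
    using ideals_isomorphicE[OF assms(1)] by metis
  let ?g = "inv_into I h"
  have g: "bij_betw ?g J I" by (rule bij_betw_inv_into[OF h(1)])
  have gI: "?g y \<in> I" and hg: "h (?g y) = y" if "y \<in> J" for y
    using that h(1) g by (auto simp: bij_betw_def bij_betw_inv_into_right[OF h(1)])
  have gh: "?g (h x) = x" if "x \<in> I" for x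
    using that h(1) by (auto simp: bij_betw_def)
  note I = additive_subgroup.a_closed[OF ideal.axioms(1)[OF assms(2)]] ideal.I_l_closed[OF assms(2)]
  show ?thesis
  proof (rule ideals_isomorphicI[OF g])
    fix x y assume xy: "x \<in> J" "y \<in> J"
    then have "x \<oplus>\<^bsub>R\<^esub> y = h (?g x \<oplus>\<^bsub>R\<^esub> ?g y)" by (simp add: h gI hg)
    then show "?g (x \<oplus>\<^bsub>R\<^esub> y) = ?g x \<oplus>\<^bsub>R\<^esub> ?g y" using gh[OF I(1)] xy gI by simp
  next
    fix r x assume rx: "r \<in> carrier R" "x \<in> J"
    then have "r \<otimes>\<^bsub>R\<^esub> x = h (r \<otimes>\<^bsub>R\<^esub> ?g x)" by (simp add: h gI hg)
    then show "?g (r \<otimes>\<^bsub>R\<^esub> x) = r \<otimes>\<^bsub>R\<^esub> ?g x" using gh[OF I(2)] rx gI by simp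
  qed
qed

text \<open>Otherwise dependent choice builds a descending chain in which no two consecutive members
  are isomorphic. Minimality is only up to isomorphism: a smaller \<open>L\<close> may still differ
  from \<open>K\<close>.\<close>

lemma isoartinian_minimal:
  assumes "isoartinian R" and "F \<noteq> {}" and "\<And>I. I \<in> F \<Longrightarrow> ideal I R"
  obtains K where "K \<in> F" and "\<And>L. L \<in> F \<Longrightarrow> L \<subseteq> K \<Longrightarrow> ideals_isomorphic R K L"
proof (rule ccontr)
  assume no: "\<not> thesis"
  have step: "\<forall>K\<in>F. \<exists>L. L \<in> F \<and> L \<subseteq> K \<and> \<not> ideals_isomorphic R K L"
    using no that by blast
  obtain K0 where "K0 \<in> F" using assms(2) by blast
  then obtain I where I: "\<And>n::nat. I n \<in> F" "\<And>n. I (Suc n) \<subseteq> I n \<and> \<not> ideals_isomorphic R (I n) (I (Suc n))"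
    using dependent_nat_choice[of "\<lambda>_ K. K \<in> F" "\<lambda>_ K L. L \<subseteq> K \<and> \<not> ideals_isomorphic R K L"] step
    by metis
  have "descending_ideal_chain R I"
    using I assms(3) by (auto simp: descending_ideal_chain_def)
  then obtain n where "ideals_isomorphic R (I n) (I (Suc n))"
    using assms(1) unfolding isoartinian_def by (meson le_SucI order_refl)
  with I(2) show False by blast
qed

section \<open>Annihilators, the nilradical and what isomorphisms of ideals preserve\<close>

definition ann :: "('a, 'm) ring_scheme \<Rightarrow> 'a set \<Rightarrow> 'a set" where
  "ann R I = {r \<in> carrier R. \<forall>x\<in>I. r \<otimes>\<^bsub>R\<^esub> x = \<zero>\<^bsub>R\<^esub>}"

definition nilrad :: "('a, 'm) ring_scheme \<Rightarrow> 'a set" where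
  "nilrad R = {x \<in> carrier R. \<exists>n::nat. x [^]\<^bsub>R\<^esub> n = \<zero>\<^bsub>R\<^esub>}"

definition idempotent_elem :: "('a, 'm) ring_scheme \<Rightarrow> 'a \<Rightarrow> bool" where
  "idempotent_elem R e \<longleftrightarrow> e \<in> carrier R \<and> e \<otimes>\<^bsub>R\<^esub> e = e"

definition primitive_idempotent :: "('a, 'm) ring_scheme \<Rightarrow> 'a \<Rightarrow> bool" where
  "primitive_idempotent R e \<longleftrightarrow> idempotent_elem R e \<and> e \<noteq> \<zero>\<^bsub>R\<^esub> \<and>
     (\<forall>f. idempotent_elem R f \<and> f \<otimes>\<^bsub>R\<^esub> e = f \<longrightarrow> f = \<zero>\<^bsub>R\<^esub> \<or> f = e)"

context cring
begin

text \<open>Compatibility with scalars forces \<open>h\<close> to fix zero, since zero is 0 times 0;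
  injectivity gives the rest.\<close>

lemma linear_bij_eq_zero_iff:
  assumes I: "ideal I R" and J: "ideal J R" and h: "bij_betw h I J"
    and lin: "\<And>r x. r \<in> carrier R \<Longrightarrow> x \<in> I \<Longrightarrow> h (r \<otimes> x) = r \<otimes> h x"
    and x: "x \<in> I"
  shows "h x = \<zero> \<longleftrightarrow> x = \<zero>"
proof -
  interpret I: ideal I R by fact
  interpret J: ideal J R by fact
  have hc: "h \<zero> \<in> carrier R" using h J.Icarr I.zero_closed by (auto simp: bij_betw_def)
  have "h (\<zero> \<otimes> \<zero>) = \<zero> \<otimes> h \<zero>" using lin I.zero_closed by blast
  then have h0: "h \<zero> = \<zero>" using hc by simp
  have "h x = h \<zero> \<longleftrightarrow> x = \<zero>"
    using h x I.zero_closed by (intro inj_on_eq_iff) (auto simp: bij_betw_def)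
  then show ?thesis using h0 by simp
qed

lemma ann_ideal:
  assumes "I \<subseteq> carrier R"
  shows "ideal (ann R I) R"
proof (rule idealI[OF ring_axioms])
  show "subgroup (ann R I) (add_monoid R)"
    using assms zero_closed
    by (intro add.subgroupI) (auto simp: ann_def l_distr l_minus subsetD a_inv_def[symmetric])
next
  fix a x assume a: "a \<in> ann R I" and x: "x \<in> carrier R"
  then have ax: "x \<otimes> a \<in> ann R I" using assms by (auto simp: ann_def m_assoc subsetD)
  then show "x \<otimes> a \<in> ann R I" .
  show "a \<otimes> x \<in> ann R I" using ax a x m_comm[of a x] by (simp add: ann_def)
qed

lemma annihilator_eq_ann: "annihilator R x = ann R {x}"
  by (simp add: annihilator_def ann_def)

lemma ann_PIdl:
  assumes x: "x \<in> carrier R" shows "ann R (PIdl x) = annihilator R x"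
proof -
  have "r \<otimes> (s \<otimes> x) = \<zero>" if "r \<in> carrier R" "s \<in> carrier R" "r \<otimes> x = \<zero>" for r s
    using that x m_lcomm[of r s x] by simp
  then show ?thesis
    using x cgenideal_self[OF x] by (auto simp: ann_def annihilator_def cgenideal_def)
qed

lemma annihilator_ideal: "x \<in> carrier R \<Longrightarrow> ideal (annihilator R x) R"
  by (simp add: annihilator_eq_ann ann_ideal)

text \<open>\<open>ann R\<close> reverses inclusions and every \<open>K\<close> lies in
  \<open>ann R (ann R K)\<close>, so the Galois connection argument applies. It recovers an
  annihilator ideal from its own annihilator, which is what an isomorphism preserves.\<close>

lemma ann_ann_ann:
  assumes "I \<subseteq> carrier R" shows "ann R (ann R (ann R I)) = ann R I"
proof -
  have "K \<subseteq> ann R (ann R K)" if "K \<subseteq> carrier R" for K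
    using that by (auto simp: ann_def subsetD m_comm)
  from this[OF assms] this[of "ann R I"]
  have "I \<subseteq> ann R (ann R I)" "ann R I \<subseteq> ann R (ann R (ann R I))" by (auto simp: ann_def)
  moreover have "ann R L \<subseteq> ann R K" if "K \<subseteq> L" for K L using that by (auto simp: ann_def)
  ultimately show ?thesis by (simp add: subset_antisym)
qed

text \<open>A linear bijection \<open>h\<close> gives r x = 0 exactly when r (h x) = 0, and h x runs
  through all of \<open>J\<close>.\<close>

lemma ideals_isomorphic_ann:
  assumes iso: "ideals_isomorphic R I J" and I: "ideal I R" and J: "ideal J R"
  shows "ann R I = ann R J"
proof -
  obtain h where h: "bij_betw h I J"
      "\<And>r x. r \<in> carrier R \<Longrightarrow> x \<in> I \<Longrightarrow> h (r \<otimes> x) = r \<otimes> h x"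
    using ideals_isomorphicE[OF iso] by metis
  have "r \<otimes> x = \<zero> \<longleftrightarrow> r \<otimes> h x = \<zero>" if "r \<in> carrier R" "x \<in> I" for r x
    using linear_bij_eq_zero_iff[OF I J h ideal.I_l_closed[OF I that(2,1)]] h(2)[OF that] by simp
  moreover have "J = h ` I" using h(1) by (simp add: bij_betw_def)
  ultimately show ?thesis unfolding ann_def by auto
qed

lemma ideals_isomorphic_PIdl:
  assumes "ideals_isomorphic R (PIdl x) (PIdl y)" "x \<in> carrier R" "y \<in> carrier R"
  shows "annihilator R x = annihilator R y"
  using ideals_isomorphic_ann[OF assms(1)] assms by (simp add: ann_PIdl cgenideal_ideal)

text \<open>Linearity moves factors from \<open>x\<close> to \<open>h x\<close>: \<open>h (x\<^sup>i\<^sup>+\<^sup>1 (h x)\<^sup>j) = x\<^sup>i (h x)\<^sup>j\<^sup>+\<^sup>1\<close>.\<close>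

lemma linear_bij_nilpotent_iff:
  assumes I: "ideal I R" and J: "ideal J R" and h: "bij_betw h I J"
    and lin: "\<And>r x. r \<in> carrier R \<Longrightarrow> x \<in> I \<Longrightarrow> h (r \<otimes> x) = r \<otimes> h x"
    and x: "x \<in> I"
  shows "h x \<in> nilrad R \<longleftrightarrow> x \<in> nilrad R"
proof -
  have hx: "h x \<in> J" using x h by (auto simp: bij_betw_def)
  have c: "x \<in> carrier R" "h x \<in> carrier R"
    using ideal.Icarr[OF I x] ideal.Icarr[OF J hx] .
  have move: "(x [^] Suc i \<otimes> h x [^] j = \<zero>) \<longleftrightarrow> (x [^] i \<otimes> h x [^] Suc j = \<zero>)" for i j :: nat
  proof -
    let ?r = "x [^] i \<otimes> h x [^] j"
    have r: "?r \<in> carrier R" using c by simp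
    have e1: "x [^] Suc i \<otimes> h x [^] j = ?r \<otimes> x" using c by (simp add: m_ac)
    have e2: "x [^] i \<otimes> h x [^] Suc j = ?r \<otimes> h x" using c by (simp add: m_assoc)
    show ?thesis unfolding e1 e2
      using linear_bij_eq_zero_iff[OF I J h lin ideal.I_l_closed[OF I x r]] lin[OF r x] by simp
  qed
  \<comment> \<open>Iterating \<open>move\<close> transfers all \<open>j\<close> factors of
    \<open>x\<close> to \<open>h x\<close>; for \<open>k\<close> = 0 it compares equal powers of the
    two elements.\<close>
  have "(x [^] j \<otimes> h x [^] k = \<zero>) \<longleftrightarrow> (h x [^] (j + k) = \<zero>)" for j k :: nat
  proof (induction j arbitrary: k)
    case 0 then show ?case using c by simp
  next
    case (Suc j) show ?case unfolding move Suc.IH by simp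
  qed
  from this[of _ 0] show ?thesis using c by (simp add: nilrad_def)
qed

section \<open>Homomorphic images\<close>

lemma linear_map_diff:
  assumes I: "ideal I R" and J: "ideal J R" and im: "h ` I \<subseteq> J"
    and add: "\<And>x y. x \<in> I \<Longrightarrow> y \<in> I \<Longrightarrow> h (x \<oplus> y) = h x \<oplus> h y"
    and lin: "\<And>r x. r \<in> carrier R \<Longrightarrow> x \<in> I \<Longrightarrow> h (r \<otimes> x) = r \<otimes> h x"
    and xy: "x \<in> I" "y \<in> I"
  shows "h (x \<ominus> y) = h x \<ominus> h y"
proof -
  interpret I: ideal I R by fact
  interpret J: ideal J R by fact
  have c: "x \<in> carrier R" "y \<in> carrier R" "h x \<in> carrier R" "h y \<in> carrier R"
    using xy im by auto
  have "x \<ominus> y = x \<oplus> (\<ominus> \<one>) \<otimes> y" using c by (simp add: minus_eq l_minus)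
  then have "h (x \<ominus> y) = h x \<oplus> h ((\<ominus> \<one>) \<otimes> y)"
    using add[OF xy(1) I.I_l_closed[OF xy(2), of "\<ominus> \<one>"]] by simp
  also have "\<dots> = h x \<oplus> (\<ominus> \<one>) \<otimes> h y" using lin[of "\<ominus> \<one>" y] xy by simp
  also have "\<dots> = h x \<ominus> h y" using c by (simp add: minus_eq l_minus)
  finally show ?thesis .
qed

text \<open>The factor \<open>z\<close> replaces the binomial theorem: one factor of the power is
  split, and each summand goes to the induction hypothesis with \<open>z\<close> multiplied by
  \<open>x\<close> or \<open>y\<close> and one exponent lowered. With \<open>z\<close> = 1 it shows
  that sums of nilpotent elements are nilpotent.\<close>

lemma pow_add_eq_zero:
  fixes n m :: nat
  assumes "x \<in> carrier R" "y \<in> carrier R" "z \<in> carrier R"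
    and "x [^] n \<otimes> z = \<zero>" "y [^] m \<otimes> z = \<zero>"
  shows "(x \<oplus> y) [^] (n + m) \<otimes> z = \<zero>"
  using assms
proof (induction "n + m" arbitrary: n m z)
  case 0 then show ?case by simp
next
  case (Suc k)
  note c = Suc.prems(1-3)
  show ?case
  proof (cases "n = 0 \<or> m = 0")
    case True
    then have "z = \<zero>" using Suc.prems by auto
    then show ?thesis using c by simp
  next
    case False
    then obtain n' m' where nm: "n = Suc n'" "m = Suc m'" by (meson not0_implies_Suc)
    have "x [^] n' \<otimes> (x \<otimes> z) = x [^] n \<otimes> z" "y [^] m' \<otimes> (y \<otimes> z) = y [^] m \<otimes> z"
      using c by (simp_all add: nm m_assoc)
    moreover have "y [^] m \<otimes> (x \<otimes> z) = x \<otimes> (y [^] m \<otimes> z)" "x [^] n \<otimes> (y \<otimes> z) = y \<otimes> (x [^] n \<otimes> z)"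
      using c by (simp_all add: m_lcomm)
    ultimately have "(x \<oplus> y) [^] k \<otimes> (x \<otimes> z) = \<zero>" "(x \<oplus> y) [^] k \<otimes> (y \<otimes> z) = \<zero>"
      using Suc.hyps(1)[of n' m "x \<otimes> z"] Suc.hyps(1)[of n m' "y \<otimes> z"] Suc.hyps(2) Suc.prems nm
      by simp_all
    then have "(x \<oplus> y) [^] k \<otimes> (x \<otimes> z) \<oplus> (x \<oplus> y) [^] k \<otimes> (y \<otimes> z) = \<zero>" by simp
    then have "(x \<oplus> y) [^] Suc k \<otimes> z = \<zero>" using c by (simp add: m_assoc l_distr r_distr)
    then show ?thesis using Suc.hyps(2) by simp
  qed
qed

lemma nilrad_ideal: "ideal (nilrad R) R"
proof (rule idealI[OF ring_axioms])
  have mult: "x \<otimes> a \<in> nilrad R" if "a \<in> nilrad R" "x \<in> carrier R" for a x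
    using that by (auto simp: nilrad_def nat_pow_distrib) (metis nat_pow_closed r_null)
  then show "x \<otimes> a \<in> nilrad R" "a \<otimes> x \<in> nilrad R" if "a \<in> nilrad R" "x \<in> carrier R" for a x
    using that by (auto simp: m_comm nilrad_def)
  have "\<zero> [^] (1::nat) = \<zero>" by simp
  then have zero: "\<zero> \<in> nilrad R" unfolding nilrad_def by blast
  show "subgroup (nilrad R) (add_monoid R)"
  proof (rule add.subgroupI)
    fix x y assume xy: "x \<in> nilrad R" "y \<in> nilrad R"
    then obtain n m :: nat where "x [^] n = \<zero>" "y [^] m = \<zero>" by (auto simp: nilrad_def)
    then have "(x \<oplus> y) [^] (n + m) = \<zero>"
      using pow_add_eq_zero[of x y \<one> n m] xy by (simp add: nilrad_def)
    then show "x \<oplus> y \<in> nilrad R" using xy by (auto simp: nilrad_def)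
  next
    fix x assume x: "x \<in> nilrad R"
    then have "\<ominus> x = (\<ominus> \<one>) \<otimes> x" by (simp add: nilrad_def l_minus)
    then show "\<ominus> x \<in> nilrad R" using mult[OF x, of "\<ominus> \<one>"] by simp
  qed (use zero in \<open>auto simp: nilrad_def\<close>)
qed

lemma nilrad_subset_prime:
  assumes "primeideal P R" shows "nilrad R \<subseteq> P"
proof
  interpret primeideal P R by fact
  fix x assume "x \<in> nilrad R"
  then obtain n :: nat where x: "x \<in> carrier R" "x [^] n = \<zero>" by (auto simp: nilrad_def)
  have "x [^] k \<in> P \<Longrightarrow> x \<in> P" for k :: nat
  proof (induction k)
    case 0 then show ?case using I_notcarr one_imp_carrier by simp
  next
    case (Suc k) then show ?case using I_prime[of "x [^] k" x] x by auto
  qed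
  then show "x \<in> P" using x zero_closed additive_subgroup.zero_closed is_additive_subgroup by metis
qed

end

text \<open>Ideals of \<open>S\<close> are pulled back to \<open>R\<close>, where the chain
  stabilises up to isomorphism. Such an isomorphism induces one between the images when it respects
  the kernel of \<open>h\<close> in both directions, which is what \<open>ker\<close> demands. This
  can fail: doubling maps Z onto 2Z without preserving membership in 2Z.\<close>

lemma isoartinian_hom_image:
  assumes hom: "ring_hom_ring R S h" and "cring R" and surj: "h ` carrier R = carrier S"
    and ker: "\<And>I J \<phi> x. ideal I R \<Longrightarrow> ideal J R \<Longrightarrow> bij_betw \<phi> I J \<Longrightarrow>
      (\<And>r x. r \<in> carrier R \<Longrightarrow> x \<in> I \<Longrightarrow> \<phi> (r \<otimes>\<^bsub>R\<^esub> x) = r \<otimes>\<^bsub>R\<^esub> \<phi> x) \<Longrightarrow> x \<in> I \<Longrightarrow>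
      h (\<phi> x) = \<zero>\<^bsub>S\<^esub> \<longleftrightarrow> h x = \<zero>\<^bsub>S\<^esub>"
    and isoart: "isoartinian R"
  shows "isoartinian S"
  unfolding isoartinian_def
proof (intro allI impI)
  interpret ring_hom_ring R S h by fact
  interpret R: cring R by fact
  fix I assume chain: "descending_ideal_chain S I"
  define I' where "I' n = {r \<in> carrier R. h r \<in> I n}" for n :: nat
  have I: "ideal (I n) S" for n using chain by (simp add: descending_ideal_chain_def)
  have I': "ideal (I' n) R" for n unfolding I'_def by (rule ideal_vimage[OF I])
  have "descending_ideal_chain R I'"
    using chain I' by (auto simp: descending_ideal_chain_def I'_def)
  then obtain n where n: "\<And>i. i \<ge> n \<Longrightarrow> ideals_isomorphic R (I' n) (I' i)"
    using isoart unfolding isoartinian_def by blast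
  have "ideals_isomorphic S (I n) (I i)" if ni: "i \<ge> n" for i
  proof -
    obtain \<phi> where \<phi>: "bij_betw \<phi> (I' n) (I' i)"
        and add: "\<And>x y. x \<in> I' n \<Longrightarrow> y \<in> I' n \<Longrightarrow> \<phi> (x \<oplus>\<^bsub>R\<^esub> y) = \<phi> x \<oplus>\<^bsub>R\<^esub> \<phi> y"
        and lin: "\<And>r x. r \<in> carrier R \<Longrightarrow> x \<in> I' n \<Longrightarrow> \<phi> (r \<otimes>\<^bsub>R\<^esub> x) = r \<otimes>\<^bsub>R\<^esub> \<phi> x"
      using ideals_isomorphicE[OF n[OF ni]] by metis
    have \<phi>I: "\<phi> x \<in> I' i" if "x \<in> I' n" for x using \<phi> that by (auto simp: bij_betw_def)
    have c: "x \<in> carrier R" if "x \<in> I' k" for x k using that by (simp add: I'_def)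
    have h_eq: "h (\<phi> x) = h (\<phi> y) \<longleftrightarrow> h x = h y" if xy: "x \<in> I' n" "y \<in> I' n" for x y
    proof -
      have "x \<ominus>\<^bsub>R\<^esub> y \<in> I' n"
        using R.minus_eq xy I'[of n] by (metis additive_subgroup.a_closed additive_subgroup.a_inv_closed ideal.axioms(1))
      then have "h (\<phi> (x \<ominus>\<^bsub>R\<^esub> y)) = \<zero>\<^bsub>S\<^esub> \<longleftrightarrow> h (x \<ominus>\<^bsub>R\<^esub> y) = \<zero>\<^bsub>S\<^esub>"
        using ker[OF I' I' \<phi> lin] by blast
      moreover have "\<phi> (x \<ominus>\<^bsub>R\<^esub> y) = \<phi> x \<ominus>\<^bsub>R\<^esub> \<phi> y"
        by (rule R.linear_map_diff[OF I' I' _ add lin xy]) (use \<phi> in \<open>auto simp: bij_betw_def\<close>)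
      ultimately show ?thesis
        using xy[THEN c] xy[THEN \<phi>I, THEN c] by (simp add: R.minus_eq S.r_right_minus_eq[unfolded S.minus_eq])
    qed
    \<comment> \<open>The choice of the lift is harmless by \<open>h_eq\<close>, whose other
      direction makes \<open>\<psi>\<close> injective.\<close>
    define \<psi> where "\<psi> y = h (\<phi> (SOME x. x \<in> I' n \<and> h x = y))" for y
    have \<psi>: "\<psi> (h x) = h (\<phi> x)" if "x \<in> I' n" for x
      using someI[of "\<lambda>x'. x' \<in> I' n \<and> h x' = h x" x] that h_eq unfolding \<psi>_def by blast
    have lift: "\<exists>x\<in>I' k. y = h x" if "y \<in> I k" for y k
      using that surj ideal.Icarr[OF I that] unfolding I'_def by (metis (mono_tags, lifting) imageE mem_Collect_eq)
    have hI: "h x \<in> I k" if "x \<in> I' k" for x k using that by (simp add: I'_def)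
    have closed: "x \<oplus>\<^bsub>R\<^esub> y \<in> I' n" "r \<otimes>\<^bsub>R\<^esub> x \<in> I' n" if "x \<in> I' n" "y \<in> I' n" "r \<in> carrier R" for x y r
      using that I'[of n] by (simp_all add: additive_subgroup.a_closed ideal.I_l_closed ideal.axioms(1))
    show ?thesis
    proof (rule ideals_isomorphicI[of \<psi>])
      show "bij_betw \<psi> (I n) (I i)"
      proof (rule bij_betwI')
        fix x y assume "x \<in> I n" "y \<in> I n"
        then show "\<psi> x = \<psi> y \<longleftrightarrow> x = y" using lift[of _ n] \<psi> h_eq by metis
      next
        fix x assume "x \<in> I n"
        then show "\<psi> x \<in> I i" using lift[of x n] \<psi> \<phi>I hI by metis
      next
        fix y assume "y \<in> I i"
        then obtain z where z: "z \<in> I' i" "y = h z" using lift by blast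
        then obtain x where "x \<in> I' n" "z = \<phi> x" using \<phi> by (auto simp: bij_betw_def)
        then show "\<exists>x\<in>I n. y = \<psi> x" using \<psi> z hI by metis
      qed
    next
      fix x y assume "x \<in> I n" "y \<in> I n"
      then obtain x' y' where "x' \<in> I' n" "x = h x'" "y' \<in> I' n" "y = h y'" using lift by metis
      then show "\<psi> (x \<oplus>\<^bsub>S\<^esub> y) = \<psi> x \<oplus>\<^bsub>S\<^esub> \<psi> y"
        using \<psi>[OF closed(1)[of x' y' "\<zero>\<^bsub>R\<^esub>"]] add c[of _ n] c[OF \<phi>I] by (simp add: \<psi>)
    next
      fix s x assume "s \<in> carrier S" "x \<in> I n"
      then obtain r x' where "r \<in> carrier R" "s = h r" "x' \<in> I' n" "x = h x'"
        using lift surj by (metis imageE)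
      then show "\<psi> (s \<otimes>\<^bsub>S\<^esub> x) = s \<otimes>\<^bsub>S\<^esub> \<psi> x"
        using \<psi>[OF closed(2)[of x' x' r]] lin c[of _ n] c[OF \<phi>I] by (simp add: \<psi>)
    qed
  qed
  then show "\<exists>n. \<forall>i\<ge>n. ideals_isomorphic S (I n) (I i)" by blast
qed

lemma isoartinian_ring_iso:
  assumes h: "h \<in> ring_iso R S" and "cring R" "ring S" and "isoartinian R"
  shows "isoartinian S"
proof (rule isoartinian_hom_image[OF _ \<open>cring R\<close> _ _ \<open>isoartinian R\<close>])
  interpret R: cring R by fact
  interpret S: ring S by fact
  interpret ring_hom_ring R S h
    using h by (intro ring_hom_ringI2) (auto simp: ring_iso_def R.ring_axioms S.ring_axioms)
  show "ring_hom_ring R S h" by (rule ring_hom_ring_axioms)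
  show "h ` carrier R = carrier S" using h by (auto simp: ring_iso_def bij_betw_def)
  have h0: "h x = \<zero>\<^bsub>S\<^esub> \<longleftrightarrow> x = \<zero>\<^bsub>R\<^esub>" if "x \<in> carrier R" for x
    using h that inj_on_eq_iff[of h "carrier R" x "\<zero>\<^bsub>R\<^esub>"] by (auto simp: ring_iso_def bij_betw_def)
  fix I J \<phi> x assume a: "ideal I R" "ideal J R" "bij_betw \<phi> I J"
     "\<And>r x. r \<in> carrier R \<Longrightarrow> x \<in> I \<Longrightarrow> \<phi> (r \<otimes>\<^bsub>R\<^esub> x) = r \<otimes>\<^bsub>R\<^esub> \<phi> x" "x \<in> I"
  moreover have "\<phi> x \<in> J" using a(3,5) by (auto simp: bij_betw_def)
  ultimately show "h (\<phi> x) = \<zero>\<^bsub>S\<^esub> \<longleftrightarrow> h x = \<zero>\<^bsub>S\<^esub>"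
    using R.linear_bij_eq_zero_iff[OF a] h0 ideal.Icarr by metis
qed

text \<open>The kernel is the nilradical here, and \<open>linear_bij_nilpotent_iff\<close> is
  precisely the condition on the kernel that \<open>isoartinian_hom_image\<close> asks for.\<close>

lemma (in cring) isoartinian_Quot_nilrad:
  assumes "isoartinian R" shows "isoartinian (R Quot nilrad R)"
proof (rule isoartinian_hom_image[OF _ is_cring _ _ assms])
  interpret N: ideal "nilrad R" R by (rule nilrad_ideal)
  show "ring_hom_ring R (R Quot nilrad R) ((+>) (nilrad R))" by (rule N.rcos_ring_hom_ring)
  show "(+>) (nilrad R) ` carrier R = carrier (R Quot nilrad R)"
    by (auto simp: FactRing_simps)
  have z: "nilrad R +> x = \<zero>\<^bsub>R Quot nilrad R\<^esub> \<longleftrightarrow> x \<in> nilrad R" if "x \<in> carrier R" for x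
    using that N.rcos_const_imp_mem a_rcos_zero[OF nilrad_ideal] by (auto simp: FactRing_def)
  fix I J \<phi> x assume a: "ideal I R" "ideal J R" "bij_betw \<phi> I J"
     "\<And>r x. r \<in> carrier R \<Longrightarrow> x \<in> I \<Longrightarrow> \<phi> (r \<otimes> x) = r \<otimes> \<phi> x" "x \<in> I"
  moreover have "\<phi> x \<in> J" using a(3,5) by (auto simp: bij_betw_def)
  ultimately show "nilrad R +> \<phi> x = \<zero>\<^bsub>R Quot nilrad R\<^esub> \<longleftrightarrow> nilrad R +> x = \<zero>\<^bsub>R Quot nilrad R\<^esub>"
    using linear_bij_nilpotent_iff[OF a] z ideal.Icarr by metis
qed

section \<open>Reduced isoartinian rings\<close>

context cring
begin

lemma ideal_mult_image:
  assumes L: "ideal L R" and c: "c \<in> carrier R"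
  shows "ideal ((\<otimes>) c ` L) R"
proof (rule idealI[OF ring_axioms])
  interpret L: ideal L R by fact
  show "subgroup ((\<otimes>) c ` L) (add_monoid R)"
  proof (rule add.subgroupI)
    fix x y assume "x \<in> (\<otimes>) c ` L" "y \<in> (\<otimes>) c ` L"
    then obtain u v where "u \<in> L" "x = c \<otimes> u" "v \<in> L" "y = c \<otimes> v" by blast
    then have "x \<oplus> y = c \<otimes> (u \<oplus> v)" "u \<oplus> v \<in> L" using c by (simp_all add: r_distr)
    then show "x \<oplus> y \<in> (\<otimes>) c ` L" by blast
  next
    show "(\<otimes>) c ` L \<noteq> {}" using L.zero_closed by blast
  next
    fix x assume "x \<in> (\<otimes>) c ` L"
    then obtain u where "u \<in> L" "x = c \<otimes> u" by blast
    then have "\<ominus> x = c \<otimes> (\<ominus> u)" "\<ominus> u \<in> L" using c by (simp_all add: r_minus)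
    then show "\<ominus> x \<in> (\<otimes>) c ` L" by blast
  qed (use c in auto)
  fix a x assume "a \<in> (\<otimes>) c ` L" and x: "x \<in> carrier R"
  then obtain u where u: "u \<in> L" "a = c \<otimes> u" by blast
  then have "x \<otimes> a = c \<otimes> (x \<otimes> u)" "x \<otimes> u \<in> L"
    using c x L.Icarr[of u] L.I_l_closed by (simp_all add: m_lcomm)
  then show "x \<otimes> a \<in> (\<otimes>) c ` L" by blast
  moreover have "a \<otimes> x = x \<otimes> a" using u c x L.Icarr[of u] by (simp add: m_comm)
  ultimately show "a \<otimes> x \<in> (\<otimes>) c ` L" by simp
qed

lemma square_eq_zero:
  assumes "nilrad R = {\<zero>}" "x \<in> carrier R" "x \<otimes> x = \<zero>" shows "x = \<zero>"
proof -
  have "x [^] (2::nat) = \<zero>" using assms by (simp add: numeral_2_eq_2)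
  then have "x \<in> nilrad R" unfolding nilrad_def using assms by blast
  then show ?thesis using assms by simp
qed

text \<open>Take \<open>x\<close> in \<open>K\<close> with minimal annihilator. If \<open>y\<close>
  kills \<open>x\<close> and \<open>k\<close> is in \<open>K\<close>, then any \<open>r\<close>
  killing x + y k satisfies (r x)^2 = 0 and so kills \<open>x\<close>. By minimality
  \<open>y\<close> kills x + y k, whence (y k)^2 = 0 and y k = 0.\<close>

lemma isoartinian_reduced_exists_ann:
  assumes isoart: "isoartinian R" and red: "nilrad R = {\<zero>}" and K: "ideal K R"
  obtains x where "x \<in> K" "annihilator R x = ann R K"
proof -
  interpret K: ideal K R by fact
  define F where "F = annihilator R ` K"
  have "F \<noteq> {}" unfolding F_def using K.zero_closed by blast
  moreover have "ideal I R" if "I \<in> F" for I using that by (auto simp: F_def intro: annihilator_ideal)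
  ultimately obtain A where A: "A \<in> F" "\<And>L. L \<in> F \<Longrightarrow> L \<subseteq> A \<Longrightarrow> ideals_isomorphic R A L"
    using isoartinian_minimal[OF isoart, of F] by blast
  then obtain x where x: "x \<in> K" "A = annihilator R x" by (auto simp: F_def)
  have min: "annihilator R y = annihilator R x" if y: "y \<in> K" "annihilator R y \<subseteq> annihilator R x" for y
  proof -
    have "ideals_isomorphic R (annihilator R x) (annihilator R y)"
      using A(2)[of "annihilator R y"] y x by (auto simp: F_def)
    \<comment> \<open>The isomorphism equates the double annihilators; one more \<open>ann\<close>
      and \<open>ann_ann_ann\<close> turn this into equality of the annihilators themselves, so
      minimality up to isomorphism becomes genuine minimality.\<close>
    then have "ann R (ann R (ann R {x})) = ann R (ann R (ann R {y}))"
      using ideals_isomorphic_ann[OF _ annihilator_ideal annihilator_ideal] x(1) y(1)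
      by (simp add: annihilator_eq_ann)
    then show ?thesis using x(1) y(1) by (simp add: ann_ann_ann annihilator_eq_ann)
  qed
  have "y \<otimes> k = \<zero>" if y: "y \<in> annihilator R x" and k: "k \<in> K" for y k
  proof -
    have c: "x \<in> carrier R" "y \<in> carrier R" "k \<in> carrier R" and yx: "y \<otimes> x = \<zero>"
      using x(1) y k by (auto simp: annihilator_def)
    let ?x' = "x \<oplus> y \<otimes> k"
    have x': "?x' \<in> K" using x(1) k c K.I_l_closed by simp
    have "annihilator R ?x' \<subseteq> annihilator R x"
    proof
      fix r assume "r \<in> annihilator R ?x'"
      then have r: "r \<in> carrier R" "r \<otimes> ?x' = \<zero>" by (auto simp: annihilator_def)
      have "(r \<otimes> x) \<otimes> (r \<otimes> x) = r \<otimes> x \<otimes> (r \<otimes> ?x') \<ominus> r \<otimes> r \<otimes> k \<otimes> (y \<otimes> x)"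
        using c r(1) by algebra
      also have "\<dots> = \<zero>" using c r yx by (simp add: minus_eq)
      finally have "r \<otimes> x = \<zero>" using square_eq_zero[OF red, of "r \<otimes> x"] c r(1) by blast
      then show "r \<in> annihilator R x" using r(1) by (simp add: annihilator_def)
    qed
    then have "y \<in> annihilator R ?x'" using min[OF x'] y by simp
    then have "y \<otimes> ?x' = \<zero>" by (simp add: annihilator_def)
    moreover have "(y \<otimes> k) \<otimes> (y \<otimes> k) = k \<otimes> (y \<otimes> ?x') \<ominus> k \<otimes> (y \<otimes> x)" using c by algebra
    ultimately have "(y \<otimes> k) \<otimes> (y \<otimes> k) = \<zero>" using c yx by (simp add: minus_eq)
    then show ?thesis using square_eq_zero[OF red, of "y \<otimes> k"] c by blast
  qed
  then have "annihilator R x = ann R K" using x(1) by (auto simp: annihilator_def ann_def)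
  then show thesis using that x(1) by blast
qed

text \<open>Among the ideals with zero annihilator there is one, \<open>K\<close>, that is minimal up to isomorphism. If \<open>c \<in> K\<close>
  is regular, then \<open>L \<cong> cL \<cong> K\<close> for every such \<open>L\<close>; so they are all isomorphic to \<open>R\<close>.\<close>

lemma isoartinian_reduced_faithful_principal:
  assumes isoart: "isoartinian R" and red: "nilrad R = {\<zero>}"
    and L: "ideal L R" and L0: "ann R L = {\<zero>}"
  obtains c where "c \<in> L" "L = PIdl c" "annihilator R c = {\<zero>}"
proof -
  define F where "F = {K. ideal K R \<and> ann R K = {\<zero>}}"
  have "r = \<zero>" if "r \<in> carrier R" "\<forall>x\<in>carrier R. r \<otimes> x = \<zero>" for r
    using that by (metis one_closed r_one)
  then have R: "carrier R \<in> F" by (auto simp: F_def ann_def oneideal)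
  obtain K where K: "K \<in> F" "\<And>L. L \<in> F \<Longrightarrow> L \<subseteq> K \<Longrightarrow> ideals_isomorphic R K L"
    using isoartinian_minimal[OF isoart, of F] R unfolding F_def by blast
  have Ki: "ideal K R" using K(1) by (simp add: F_def)
  then obtain c0 where c0: "c0 \<in> K" "annihilator R c0 = {\<zero>}"
    using isoartinian_reduced_exists_ann[OF isoart red Ki] K(1) unfolding F_def by auto
  have c0c: "c0 \<in> carrier R" using ideal.Icarr[OF Ki c0(1)] .
  have reg: "x = \<zero>" if "x \<in> carrier R" "x \<otimes> c0 = \<zero>" for x
    using that c0(2) by (auto simp: annihilator_def)
  have iso: "ideals_isomorphic R L' K" if "L' \<in> F" for L'
  proof -
    interpret L': ideal L' R using that by (simp add: F_def)
    let ?cL = "(\<otimes>) c0 ` L'"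
    have cL: "ideal ?cL R" by (rule ideal_mult_image[OF L'.is_ideal c0c])
    have "inj_on ((\<otimes>) c0) L'"
    proof (rule inj_onI)
      fix x y assume xy: "x \<in> L'" "y \<in> L'" "c0 \<otimes> x = c0 \<otimes> y"
      then have "(x \<ominus> y) \<otimes> c0 = c0 \<otimes> x \<ominus> c0 \<otimes> y" using c0c L'.Icarr by algebra
      also have "\<dots> = \<zero>" using xy c0c by simp
      finally have "x \<ominus> y = \<zero>" using reg[of "x \<ominus> y"] xy(1,2) by simp
      then show "x = y" using xy(1,2) by simp
    qed
    then have 1: "ideals_isomorphic R L' ?cL"
      using c0c by (intro ideals_isomorphicI[of "(\<otimes>) c0"]) (auto simp: bij_betw_def r_distr m_lcomm)
    have "r = \<zero>" if r: "r \<in> ann R ?cL" for r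
    proof -
      have "r \<otimes> c0 \<in> ann R L'" using r c0c by (auto simp: ann_def m_assoc)
      then have "r \<otimes> c0 = \<zero>" using \<open>L' \<in> F\<close> by (simp add: F_def)
      then show ?thesis using reg[of r] r by (auto simp: ann_def)
    qed
    moreover have "\<zero> \<in> ann R ?cL" using c0c by (auto simp: ann_def)
    ultimately have "ann R ?cL = {\<zero>}" by blast
    then have "?cL \<in> F" using cL by (simp add: F_def)
    moreover have "?cL \<subseteq> K"
      using c0(1) ideal.I_r_closed[OF Ki] by auto
    ultimately have 2: "ideals_isomorphic R K ?cL" using K(2) by blast
    show ?thesis using ideals_isomorphic_trans[OF 1 ideals_isomorphic_sym[OF 2 Ki]] .
  qed
  have "L \<in> F" using L L0 by (simp add: F_def)
  then have "ideals_isomorphic R (carrier R) L"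
    using ideals_isomorphic_trans[OF iso[OF R] ideals_isomorphic_sym[OF iso L]] by simp
  then obtain h where h: "bij_betw h (carrier R) L"
      and lin: "\<And>r x. r \<in> carrier R \<Longrightarrow> x \<in> carrier R \<Longrightarrow> h (r \<otimes> x) = r \<otimes> h x"
    by (metis ideals_isomorphicE)
  \<comment> \<open>An ideal isomorphic to the ring is generated by the image of 1, so its
    annihilator is that of this generator.\<close>
  have c: "h \<one> \<in> L" using h by (auto simp: bij_betw_def)
  then have cc: "h \<one> \<in> carrier R" using ideal.Icarr[OF L] by blast
  have "L = PIdl (h \<one>)"
  proof
    show "L \<subseteq> PIdl (h \<one>)"
    proof
      fix y assume "y \<in> L"
      then obtain r where r: "r \<in> carrier R" "y = h r" using h by (auto simp: bij_betw_def)
      then have "y = r \<otimes> h \<one>" using lin[OF r(1) one_closed] by simp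
      then show "y \<in> PIdl (h \<one>)" using r(1) by (auto simp: cgenideal_def)
    qed
  qed (rule cgenideal_minimal[OF L c])
  moreover from this have "annihilator R (h \<one>) = {\<zero>}" using ann_PIdl[OF cc] L0 by simp
  ultimately show thesis using that c by blast
qed

text \<open>Let a b = 0 with both factors nonzero. The ideal aR + ann(a) has zero annihilator,
  because an element killing it has square zero; so it is generated by a regular \<open>c\<close>.
  Splitting \<open>c\<close> between the two summands yields an idempotent, and connectedness makes
  one component of \<open>c\<close> vanish; then \<open>a\<close> or \<open>b\<close> kills
  \<open>c\<close>. In a domain every nonzero ideal has zero annihilator, so the same generation
  lemma makes it principal.\<close>

lemma isoartinian_reduced_principal_domain:
  assumes isoart: "isoartinian R" and red: "nilrad R = {\<zero>}" and nz: "\<one> \<noteq> \<zero>"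
    and conn: "\<And>e. idempotent_elem R e \<Longrightarrow> e = \<zero> \<or> e = \<one>"
  shows "principal_domain R"
proof -
  have integral: "a = \<zero> \<or> b = \<zero>" if ab: "a \<otimes> b = \<zero>" and ac: "a \<in> carrier R" and bc: "b \<in> carrier R" for a b
  proof (rule ccontr)
    assume "\<not> (a = \<zero> \<or> b = \<zero>)"
    then have a0: "a \<noteq> \<zero>" and b0: "b \<noteq> \<zero>" by auto
    let ?J = "annihilator R a"
    have I: "ideal (PIdl a) R" and J: "ideal ?J R"
      using ac by (simp_all add: cgenideal_ideal annihilator_ideal)
    let ?L = "PIdl a <+>\<^bsub>R\<^esub> ?J"
    have L: "ideal ?L R" by (rule add_ideals[OF I J])
    have inL: "u \<otimes> a \<oplus> v \<in> ?L" if "u \<in> carrier R" "v \<in> ?J" for u v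
      using that by (auto simp: set_add_def' cgenideal_def)
    have J0: "\<zero> \<in> ?J" using ac by (simp add: annihilator_def)
    have "r = \<zero>" if r: "r \<in> ann R ?L" for r
    proof -
      have rc: "r \<in> carrier R" and rL: "\<And>x. x \<in> ?L \<Longrightarrow> r \<otimes> x = \<zero>" using r by (auto simp: ann_def)
      have "r \<otimes> a = \<zero>" using rL[OF inL[OF one_closed J0]] ac by simp
      then have rJ: "r \<in> ?J" using rc by (simp add: annihilator_def)
      show "r = \<zero>" using rL[OF inL[OF zero_closed rJ]] square_eq_zero[OF red rc] rc ac by simp
    qed
    moreover have "\<zero> \<in> ann R ?L" using ideal.Icarr[OF L] by (auto simp: ann_def)
    ultimately have "ann R ?L = {\<zero>}" by blast
    then obtain c where c: "c \<in> ?L" "?L = PIdl c" "annihilator R c = {\<zero>}"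
      using isoartinian_reduced_faithful_principal[OF isoart red L] by blast
    have reg: "x = \<zero>" if "x \<in> carrier R" "x \<otimes> c = \<zero>" for x
      using that c(3) by (auto simp: annihilator_def)
    obtain r s where rs: "r \<in> carrier R" "s \<in> ?J" "c = r \<otimes> a \<oplus> s"
      using c(1) by (auto simp: set_add_def' cgenideal_def)
    have sc: "s \<in> carrier R" and sa: "s \<otimes> a = \<zero>" using rs(2) by (auto simp: annihilator_def)
    have cc: "c \<in> carrier R" using rs sc ac by simp
    have "r \<otimes> a \<in> ?L" using inL[OF rs(1) J0] rs(1) ac by simp
    \<comment> \<open>The ideal is the direct sum of aR and ann(a) and is free on \<open>c\<close>,
      so the projection onto aR is multiplication by this \<open>v\<close>. That is why
      \<open>v\<close> turns out to be idempotent.\<close>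
    then obtain v where v: "v \<in> carrier R" "r \<otimes> a = v \<otimes> c"
      using c(2) by (auto simp: cgenideal_def)
    have e1: "r \<otimes> a \<ominus> v \<otimes> (r \<otimes> a) = v \<otimes> s"
    proof -
      have "v \<otimes> c = v \<otimes> (r \<otimes> a) \<oplus> v \<otimes> s" unfolding rs(3) using v(1) rs(1) sc ac by (simp add: r_distr)
      then have "r \<otimes> a = v \<otimes> (r \<otimes> a) \<oplus> v \<otimes> s" using v(2) by simp
      moreover have "(v \<otimes> (r \<otimes> a) \<oplus> v \<otimes> s) \<ominus> v \<otimes> (r \<otimes> a) = v \<otimes> s"
        using v(1) rs(1) sc ac by algebra
      ultimately show ?thesis by simp
    qed
    have "(v \<otimes> s) \<otimes> (v \<otimes> s) = (r \<otimes> a \<ominus> v \<otimes> (r \<otimes> a)) \<otimes> (v \<otimes> s)" using e1 by simp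
    also have "\<dots> = (r \<ominus> v \<otimes> r) \<otimes> v \<otimes> (s \<otimes> a)" using v(1) rs(1) sc ac by algebra
    also have "\<dots> = \<zero>" using sa v(1) rs(1) by simp
    finally have vs: "v \<otimes> s = \<zero>" using square_eq_zero[OF red, of "v \<otimes> s"] v(1) sc by blast
    then have "r \<otimes> a \<ominus> v \<otimes> (r \<otimes> a) = \<zero>" using e1 by simp
    then have vra: "v \<otimes> (r \<otimes> a) = r \<otimes> a" using v(1) rs(1) ac by simp
    have "(v \<otimes> v \<ominus> v) \<otimes> c = v \<otimes> (v \<otimes> c) \<ominus> v \<otimes> c" using v cc by algebra
    also have "\<dots> = \<zero>" using v(2)[symmetric] vra rs(1) ac by simp
    finally have "v \<otimes> v \<ominus> v = \<zero>" using reg[of "v \<otimes> v \<ominus> v"] v(1) by blast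
    then have "v \<otimes> v = v" using v(1) by simp
    then have "v = \<zero> \<or> v = \<one>" using conn v by (simp add: idempotent_elem_def)
    then show False
    proof
      assume "v = \<zero>"
      then have "r \<otimes> a = \<zero>" using v(2) cc by simp
      then have "c = s" using rs(3) sc by simp
      then have "a \<otimes> c = \<zero>" using sa sc ac by (simp add: m_comm)
      then show False using reg[OF ac] a0 by blast
    next
      assume "v = \<one>"
      then have "s = \<zero>" using vs sc by simp
      then have "b \<otimes> c = r \<otimes> (a \<otimes> b)" using rs(1,3) ac bc by (simp add: m_ac)
      then have "b \<otimes> c = \<zero>" using ab rs(1) by simp
      then show False using reg[OF bc] b0 by blast
    qed
  qed
  interpret domain R using integral nz by unfold_locales auto
  show ?thesis
  proof
    fix I assume I: "ideal I R"
    show "\<exists>a\<in>carrier R. I = PIdl a"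
    proof (cases "I = {\<zero>}")
      case True
      then have "I = PIdl \<zero>" by (auto simp: cgenideal_def intro: exI[of _ \<zero>])
      then show ?thesis by blast
    next
      case False
      then obtain x where x: "x \<in> I" "x \<noteq> \<zero>"
        using additive_subgroup.zero_closed[OF ideal.axioms(1)[OF I]] by blast
      have "r = \<zero>" if "r \<in> ann R I" for r
        using that x integral[of r x] ideal.Icarr[OF I x(1)] by (simp add: ann_def)
      moreover have "\<zero> \<in> ann R I" using ideal.Icarr[OF I] by (simp add: ann_def)
      ultimately have "ann R I = {\<zero>}" by blast
      then show ?thesis
        using isoartinian_reduced_faithful_principal[OF isoart red I] ideal.Icarr[OF I] by metis
    qed
  qed
qed

section \<open>Nilpotence and associated primes\<close>

text \<open>The principal ideal of \<open>t \<otimes> x\<close> lies in that of \<open>x\<close>, so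
  a choice of \<open>x\<close> with ideal minimal up to isomorphism makes the annihilators equal.
  Nilpotence of the nilradical, associated primes and the splitting by idempotents all rest on this
  form of the chain condition.\<close>

lemma isoartinian_minimal_annihilator:
  assumes isoart: "isoartinian R" and Y: "Y \<noteq> {}" "Y \<subseteq> carrier R"
  obtains x where "x \<in> Y"
    and "\<And>t. t \<in> carrier R \<Longrightarrow> t \<otimes> x \<in> Y \<Longrightarrow> annihilator R (t \<otimes> x) = annihilator R x"
proof -
  have "ideal I R" if "I \<in> cgenideal R ` Y" for I using that Y by (auto intro: cgenideal_ideal)
  then obtain K where K: "K \<in> cgenideal R ` Y"
      "\<And>L. L \<in> cgenideal R ` Y \<Longrightarrow> L \<subseteq> K \<Longrightarrow> ideals_isomorphic R K L"
    using isoartinian_minimal[OF isoart, of "cgenideal R ` Y"] Y by blast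
  then obtain x where x: "x \<in> Y" "K = PIdl x" by blast
  show thesis
  proof (rule that[OF x(1)])
    fix t assume t: "t \<in> carrier R" "t \<otimes> x \<in> Y"
    have xc: "x \<in> carrier R" using x Y by blast
    have "t \<otimes> x \<in> PIdl x" using t by (auto simp: cgenideal_def)
    then have "PIdl (t \<otimes> x) \<subseteq> PIdl x" using cgenideal_minimal[OF cgenideal_ideal[OF xc]] by blast
    then have "ideals_isomorphic R (PIdl x) (PIdl (t \<otimes> x))" using K(2) t x by blast
    then show "annihilator R (t \<otimes> x) = annihilator R x"
      using ideals_isomorphic_PIdl t xc by blast
  qed
qed

lemma ideal_pow_Suc:
  "ideal I R \<Longrightarrow> I [^]\<^bsub>ideals_set R\<^esub> Suc n = ideal_prod R (I [^]\<^bsub>ideals_set R\<^esub> n) I"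
  by (simp add: nat_pow_def ideals_set_def)

lemma ideal_pow_0: "I [^]\<^bsub>ideals_set R\<^esub> (0::nat) = carrier R"
  by (simp add: nat_pow_def ideals_set_def)

lemma ideal_pow_ideal:
  assumes "ideal I R" shows "ideal (I [^]\<^bsub>ideals_set R\<^esub> (n::nat)) R"
proof (induction n)
  case 0 show ?case unfolding ideal_pow_0 by (rule oneideal)
next
  case (Suc n) show ?case unfolding ideal_pow_Suc[OF assms] by (rule ideal_prod_is_ideal[OF Suc assms])
qed

text \<open>Two consecutive isomorphic powers N^n and N^(n+1) have a common annihilator A. If N^n
  were nonzero, pick \<open>x\<close> outside A as in
  \<open>isoartinian_minimal_annihilator\<close>. Were N x inside A, then \<open>x\<close> would
  kill N^(n+1) and lie in A. So some nilpotent \<open>q\<close> has q x outside A, hence with the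
  same annihilator as \<open>x\<close>; now \<open>q\<close> can be cancelled from q^m x = 0 until x
  = 0 remains.\<close>

theorem isoartinian_nilrad_nilpotent:
  assumes isoart: "isoartinian R" shows "nilpotent_ideal R (nilrad R)"
proof -
  let ?N = "nilrad R"
  define I where "I n = ?N [^]\<^bsub>ideals_set R\<^esub> n" for n :: nat
  have N: "ideal ?N R" by (rule nilrad_ideal)
  have Ii: "ideal (I n) R" for n unfolding I_def by (rule ideal_pow_ideal[OF N])
  have ISuc: "I (Suc n) = ideal_prod R (I n) ?N" for n unfolding I_def by (rule ideal_pow_Suc[OF N])
  have "descending_ideal_chain R I"
    using Ii ideal_prod_inter[OF Ii N] by (auto simp: descending_ideal_chain_def ISuc)
  then obtain n where n: "\<And>i. i \<ge> n \<Longrightarrow> ideals_isomorphic R (I n) (I i)"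
    using isoart unfolding isoartinian_def by blast
  then have ann_eq: "ann R (I n) = ann R (I (Suc n))"
    using ideals_isomorphic_ann[OF n Ii Ii, of "Suc n"] by simp
  have z: "\<zero> \<in> I n" using Ii[of n] additive_subgroup.zero_closed ideal.axioms(1) by blast
  have "I n = {\<zero>}"
  proof (rule ccontr)
    assume "I n \<noteq> {\<zero>}"
    then obtain w where w: "w \<in> I n" "w \<noteq> \<zero>" using z by blast
    then have "\<one> \<notin> ann R (I n)" using ideal.Icarr[OF Ii w(1)] by (auto simp: ann_def intro: bexI[of _ w])
    then obtain x where x: "x \<in> carrier R - ann R (I n)"
      and min: "\<And>t. t \<in> carrier R \<Longrightarrow> t \<otimes> x \<in> carrier R - ann R (I n) \<Longrightarrow>
        annihilator R (t \<otimes> x) = annihilator R x"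
      using isoartinian_minimal_annihilator[OF isoart, of "carrier R - ann R (I n)"] by blast
    have xc: "x \<in> carrier R" using x by blast
    have "\<exists>q\<in>?N. q \<otimes> x \<notin> ann R (I n)"
    proof (rule ccontr)
      assume no: "\<not> ?thesis"
      have "x \<otimes> y = \<zero>" if "y \<in> ideal_prod R (I n) ?N" for y
        using that
      proof induction
        case (prod i q)
        have c: "i \<in> carrier R" "q \<in> carrier R" using ideal.Icarr[OF Ii prod(1)] ideal.Icarr[OF N prod(2)] .
        have "(q \<otimes> x) \<otimes> i = \<zero>" using no prod by (auto simp: ann_def)
        then show ?case using c xc by (simp add: m_ac)
      next
        case (sum s1 s2)
        then have "s1 \<in> carrier R" "s2 \<in> carrier R" using ideal_prod_in_carrier[OF Ii N] by blast+
        then show ?case using sum xc by (simp add: r_distr)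
      qed
      then have "x \<in> ann R (I n)" unfolding ann_eq ISuc using xc by (simp add: ann_def)
      then show False using x by blast
    qed
    then obtain q where q: "q \<in> ?N" "q \<otimes> x \<notin> ann R (I n)" by blast
    then obtain m :: nat where qc: "q \<in> carrier R" and m: "q [^] m = \<zero>" by (auto simp: nilrad_def)
    have a: "annihilator R (q \<otimes> x) = annihilator R x" using min q qc xc by simp
    have "q [^] k \<otimes> x = \<zero> \<Longrightarrow> x = \<zero>" for k :: nat
    proof (induction k)
      case 0 then show ?case using xc by simp
    next
      case (Suc k)
      then have "q [^] k \<in> annihilator R (q \<otimes> x)" using qc xc by (simp add: annihilator_def m_assoc)
      then have "q [^] k \<otimes> x = \<zero>" unfolding a by (simp add: annihilator_def)
      then show ?case by (rule Suc.IH)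
    qed
    from this[of m] have "x = \<zero>" using m xc by simp
    then show False using x ideal.Icarr[OF Ii] by (auto simp: ann_def)
  qed
  then show ?thesis unfolding nilpotent_ideal_def I_def by blast
qed

text \<open>The chosen \<open>s\<close> outside \<open>p\<close> has an annihilator that no further
  factor outside \<open>p\<close> can enlarge; it is the kernel of the localisation at
  \<open>p\<close>. With \<open>y\<close> in the last power of \<open>p\<close> that does not kill
  \<open>s\<close>, the product y s is killed by \<open>p\<close>; and if some \<open>r\<close>
  outside \<open>p\<close> killed it, then \<open>y\<close> would kill r s and hence
  \<open>s\<close>.\<close>

lemma isoartinian_nilpotent_prime_associated:
  assumes isoart: "isoartinian R" and prime: "primeideal p R" and nilp: "nilpotent_ideal R p"
  shows "p \<in> ass_primes R"
proof -
  interpret primeideal p R by fact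
  have one: "\<one> \<notin> p" using I_notcarr one_imp_carrier by blast
  then obtain s where s: "s \<in> carrier R - p"
    and min: "\<And>t. t \<in> carrier R \<Longrightarrow> t \<otimes> s \<in> carrier R - p \<Longrightarrow> annihilator R (t \<otimes> s) = annihilator R s"
    using isoartinian_minimal_annihilator[OF isoart, of "carrier R - p"] by blast
  have sc: "s \<in> carrier R" using s by blast
  have min': "annihilator R (t \<otimes> s) = annihilator R s" if "t \<in> carrier R - p" for t
    using min[of t] that s I_prime[of t s] by auto
  let ?P = "\<lambda>k::nat. p [^]\<^bsub>ideals_set R\<^esub> k \<subseteq> annihilator R s"
  obtain m :: nat where "p [^]\<^bsub>ideals_set R\<^esub> m = {\<zero>}" using nilp by (auto simp: nilpotent_ideal_def)
  then have "?P m" using sc by (simp add: annihilator_def)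
  then have L: "?P (LEAST k. ?P k)" by (rule LeastI)
  have "s \<noteq> \<zero>" using s additive_subgroup.zero_closed[OF is_additive_subgroup] by blast
  then have "\<one> \<notin> annihilator R s" using sc by (simp add: annihilator_def)
  then have "\<not> ?P 0" unfolding ideal_pow_0 using one_closed by blast
  \<comment> \<open>Exponent 0 is excluded because \<open>s\<close> is nonzero, so the least
    exponent is a successor and the power below it still contains an element not killing
    \<open>s\<close>.\<close>
  then obtain k where k: "(LEAST k. ?P k) = Suc k" using L by (metis not0_implies_Suc)
  then have "\<not> ?P k" using not_less_Least[of k ?P] by simp
  then obtain y where y: "y \<in> p [^]\<^bsub>ideals_set R\<^esub> k" "y \<notin> annihilator R s" by blast
  have yc: "y \<in> carrier R" using ideal.Icarr[OF ideal_pow_ideal[OF is_ideal] y(1)] .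
  have "p = annihilator R (y \<otimes> s)"
  proof
    show "p \<subseteq> annihilator R (y \<otimes> s)"
    proof
      fix r assume r: "r \<in> p"
      then have "y \<otimes> r \<in> p [^]\<^bsub>ideals_set R\<^esub> Suc k"
        unfolding ideal_pow_Suc[OF is_ideal] using y(1) by (intro ideal_prod.prod)
      then have "y \<otimes> r \<in> annihilator R s" using L k by auto
      then show "r \<in> annihilator R (y \<otimes> s)" using r yc sc Icarr by (simp add: annihilator_def m_ac)
    qed
    show "annihilator R (y \<otimes> s) \<subseteq> p"
    proof (rule ccontr)
      assume "\<not> annihilator R (y \<otimes> s) \<subseteq> p"
      then obtain r where r: "r \<in> carrier R - p" "r \<otimes> (y \<otimes> s) = \<zero>" by (auto simp: annihilator_def)
      then have "y \<in> annihilator R (r \<otimes> s)" using yc sc by (simp add: annihilator_def m_lcomm)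
      then show False using min'[OF r(1)] y(2) by simp
    qed
  qed
  then show ?thesis unfolding ass_primes_def using prime yc sc by blast
qed

text \<open>Only the first of the two comaximal elements is raised to a power; a second application
  with the roles exchanged treats the other.\<close>

lemma comaximal_pow:
  fixes n :: nat
  assumes ab: "a \<in> carrier R" "b \<in> carrier R"
    and uv: "u \<in> carrier R" "v \<in> carrier R" "u \<otimes> a \<oplus> v \<otimes> b = \<one>"
  obtains u' v' where "u' \<in> carrier R" "v' \<in> carrier R" "u' \<otimes> a [^] n \<oplus> v' \<otimes> b = \<one>"
proof -
  have "\<exists>u'\<in>carrier R. \<exists>v'\<in>carrier R. u' \<otimes> a [^] n \<oplus> v' \<otimes> b = \<one>"
  proof (induction n)
    case 0 then show ?case using ab by (intro bexI[of _ \<one>] bexI[of _ \<zero>]) auto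
  next
    case (Suc n)
    then obtain x y where xy: "x \<in> carrier R" "y \<in> carrier R" "x \<otimes> a [^] n \<oplus> y \<otimes> b = \<one>" by blast
    define c where "c = a [^] n"
    have c: "c \<in> carrier R" using ab by (simp add: c_def)
    have "(x \<otimes> u) \<otimes> (c \<otimes> a) \<oplus> (x \<otimes> c \<otimes> v \<oplus> y) \<otimes> b =
       x \<otimes> c \<otimes> (u \<otimes> a \<oplus> v \<otimes> b) \<oplus> y \<otimes> b"
      using ab uv(1,2) xy(1,2) c by algebra
    also have "\<dots> = \<one>" using uv xy c by (simp add: c_def)
    finally have "(x \<otimes> u) \<otimes> a [^] Suc n \<oplus> (x \<otimes> c \<otimes> v \<oplus> y) \<otimes> b = \<one>" by (simp add: c_def)
    then show ?case using ab uv xy c by (metis m_closed a_closed)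
  qed
  then show thesis using that by blast
qed

text \<open>Idempotents lift modulo the nilradical. For large n the powers x^n and (1 - x)^n are
  comaximal with product zero, so the part of 1 that lies in the ideal of x^n is idempotent. If it
  is 0 then x^n = 0, and if it is 1 then (1 - x)^n = 0.\<close>

lemma connected_imp_nilrad_connected:
  assumes conn: "\<And>e. idempotent_elem R e \<Longrightarrow> e = \<zero> \<or> e = \<one>"
    and x: "x \<in> carrier R" "x \<otimes> (\<one> \<ominus> x) \<in> nilrad R"
  shows "x \<in> nilrad R \<or> \<one> \<ominus> x \<in> nilrad R"
proof -
  obtain n :: nat where n: "(x \<otimes> (\<one> \<ominus> x)) [^] n = \<zero>" using x by (auto simp: nilrad_def)
  let ?a = "x [^] n" and ?b = "(\<one> \<ominus> x) [^] n"
  have c: "?a \<in> carrier R" "?b \<in> carrier R" using x by simp_all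
  have ab: "?a \<otimes> ?b = \<zero>" using n x by (simp add: nat_pow_distrib)
  have "\<one> \<otimes> x \<oplus> \<one> \<otimes> (\<one> \<ominus> x) = \<one>" using x(1) by algebra
  then obtain u v where uv: "u \<in> carrier R" "v \<in> carrier R" "u \<otimes> ?a \<oplus> v \<otimes> (\<one> \<ominus> x) = \<one>"
    using comaximal_pow[of x "\<one> \<ominus> x" \<one> \<one> n] x by (metis minus_closed one_closed)
  then have "v \<otimes> (\<one> \<ominus> x) \<oplus> u \<otimes> ?a = \<one>" using c x by (simp add: a_comm)
  then obtain v' u' where uv': "u' \<in> carrier R" "v' \<in> carrier R" "v' \<otimes> ?b \<oplus> u' \<otimes> ?a = \<one>"
    using comaximal_pow[of "\<one> \<ominus> x" ?a v u n] uv c x by (metis minus_closed one_closed)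
  let ?e = "u' \<otimes> ?a"
  have "?e = (v' \<otimes> ?b \<oplus> ?e) \<otimes> ?e" using uv' c by simp
  also have "\<dots> = v' \<otimes> u' \<otimes> (?a \<otimes> ?b) \<oplus> ?e \<otimes> ?e" using uv'(1,2) c by algebra
  also have "\<dots> = ?e \<otimes> ?e" using uv'(1,2) c ab by simp
  finally have "idempotent_elem R ?e" using uv'(1) c by (simp add: idempotent_elem_def)
  then consider "?e = \<zero>" | "?e = \<one>" using conn by blast
  then show ?thesis
  proof cases
    case 1
    then have "v' \<otimes> ?b = \<one>" using uv' c by simp
    then have "?a = v' \<otimes> (?a \<otimes> ?b)" using uv'(2) c by (metis m_lcomm r_one)
    then have "?a = \<zero>" using ab uv'(2) by simp
    then show ?thesis using x by (auto simp: nilrad_def)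
  next
    case 2
    then have "?b = u' \<otimes> (?a \<otimes> ?b)" using uv'(1) c by (metis m_assoc l_one)
    then have "?b = \<zero>" using ab uv'(1) by simp
    then show ?thesis using x by (auto simp: nilrad_def)
  qed
qed

end

text \<open>The quotient is reduced and isoartinian, and it inherits connectedness by lifting
  idempotents. This is also where the nilradical of a connected isoartinian ring is found to be
  prime.\<close>

lemma isoartinian_connected_Quot_nilrad:
  assumes "cring R" and isoart: "isoartinian R" and nz: "\<one>\<^bsub>R\<^esub> \<noteq> \<zero>\<^bsub>R\<^esub>"
    and conn: "\<And>e. idempotent_elem R e \<Longrightarrow> e = \<zero>\<^bsub>R\<^esub> \<or> e = \<one>\<^bsub>R\<^esub>"
  shows "principal_domain (R Quot nilrad R)"
proof -
  interpret R: cring R by fact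
  define N where "N = nilrad R"
  define S where "S = R Quot N"
  have N: "ideal N R" unfolding N_def by (rule R.nilrad_ideal)
  have S: "cring S" unfolding S_def by (rule ideal.quotient_is_cring[OF N \<open>cring R\<close>])
  have hom: "ring_hom_ring R S ((+>\<^bsub>R\<^esub>) N)" unfolding S_def by (rule ideal.rcos_ring_hom_ring[OF N])
  note h = ring_hom_ring.homh[OF hom]
  have z: "N +>\<^bsub>R\<^esub> x = \<zero>\<^bsub>S\<^esub> \<longleftrightarrow> x \<in> N" if "x \<in> carrier R" for x
    using that ideal.rcos_const_imp_mem[OF N] R.a_rcos_zero[OF N] by (auto simp: S_def FactRing_def)
  have ex: "\<exists>x\<in>carrier R. y = N +>\<^bsub>R\<^esub> x" if "y \<in> carrier S" for y
    using that by (auto simp: S_def FactRing_simps)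
  have nilS: "y = \<zero>\<^bsub>S\<^esub>" if "y \<in> nilrad S" for y
  proof -
    obtain n :: nat where y: "y \<in> carrier S" "y [^]\<^bsub>S\<^esub> n = \<zero>\<^bsub>S\<^esub>"
      using \<open>y \<in> nilrad S\<close> by (auto simp: nilrad_def)
    then obtain x where x: "x \<in> carrier R" "y = N +>\<^bsub>R\<^esub> x" using ex by blast
    then have "N +>\<^bsub>R\<^esub> (x [^]\<^bsub>R\<^esub> n) = \<zero>\<^bsub>S\<^esub>" using y ring_hom_ring.hom_nat_pow[OF hom x(1), of n] by simp
    then have "x [^]\<^bsub>R\<^esub> n \<in> N" using z[of "x [^]\<^bsub>R\<^esub> n"] x by simp
    then obtain m :: nat where "(x [^]\<^bsub>R\<^esub> n) [^]\<^bsub>R\<^esub> m = \<zero>\<^bsub>R\<^esub>" by (auto simp: N_def nilrad_def)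
    then have "x [^]\<^bsub>R\<^esub> (n * m) = \<zero>\<^bsub>R\<^esub>" using x by (simp add: R.nat_pow_pow)
    then have "x \<in> N" using x unfolding N_def nilrad_def by blast
    then show ?thesis using z x by simp
  qed
  have connS: "e = \<zero>\<^bsub>S\<^esub> \<or> e = \<one>\<^bsub>S\<^esub>" if "idempotent_elem S e" for e
  proof -
    have e: "e \<in> carrier S" "e \<otimes>\<^bsub>S\<^esub> e = e" using that by (auto simp: idempotent_elem_def)
    then obtain x where x: "x \<in> carrier R" "e = N +>\<^bsub>R\<^esub> x" using ex by blast
    have "x \<otimes>\<^bsub>R\<^esub> (\<one>\<^bsub>R\<^esub> \<ominus>\<^bsub>R\<^esub> x) = x \<ominus>\<^bsub>R\<^esub> (x \<otimes>\<^bsub>R\<^esub> x)" using x(1) by algebra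
    moreover have "N +>\<^bsub>R\<^esub> (x \<otimes>\<^bsub>R\<^esub> x) = N +>\<^bsub>R\<^esub> x" using ring_hom_mult[OF h x(1) x(1)] e x by simp
    ultimately have "x \<otimes>\<^bsub>R\<^esub> (\<one>\<^bsub>R\<^esub> \<ominus>\<^bsub>R\<^esub> x) \<in> N"
      using R.quotient_eq_iff_same_a_r_cos[OF N x(1) R.m_closed[OF x(1) x(1)]] by simp
    then have "x \<in> N \<or> \<one>\<^bsub>R\<^esub> \<ominus>\<^bsub>R\<^esub> x \<in> N"
      using R.connected_imp_nilrad_connected[OF conn x(1)] by (simp add: N_def)
    then show "e = \<zero>\<^bsub>S\<^esub> \<or> e = \<one>\<^bsub>S\<^esub>"
    proof
      assume "x \<in> N" then show ?thesis using z x by simp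
    next
      assume "\<one>\<^bsub>R\<^esub> \<ominus>\<^bsub>R\<^esub> x \<in> N"
      then have "N +>\<^bsub>R\<^esub> \<one>\<^bsub>R\<^esub> = N +>\<^bsub>R\<^esub> x"
        using R.quotient_eq_iff_same_a_r_cos[OF N R.one_closed x(1)] by simp
      then show ?thesis using x ring_hom_one[OF h] by simp
    qed
  qed
  have "principal_domain S"
  proof (rule cring.isoartinian_reduced_principal_domain[OF S _ _ _ connS])
    show "isoartinian S" unfolding S_def N_def by (rule R.isoartinian_Quot_nilrad[OF isoart])
    have "\<one>\<^bsub>R\<^esub> \<notin> N" using nz by (simp add: N_def nilrad_def)
    then show "\<one>\<^bsub>S\<^esub> \<noteq> \<zero>\<^bsub>S\<^esub>" using z[of "\<one>\<^bsub>R\<^esub>"] ring_hom_one[OF h] by simp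
    show "nilrad S = {\<zero>\<^bsub>S\<^esub>}"
      using nilS additive_subgroup.zero_closed[OF ideal.axioms(1)[OF cring.nilrad_ideal[OF S]]] by blast
  qed
  then show ?thesis by (simp add: S_def N_def)
qed

section \<open>Noetherian rings\<close>

text \<open>The ascending chain condition enters as the fact that a nonempty chain of ideals
  contains its union, so Zorn's lemma applies to any nonempty family of ideals.\<close>

lemma (in noetherian_ring) exists_maximal_member:
  assumes "F \<noteq> {}" and "\<And>I. I \<in> F \<Longrightarrow> ideal I R"
  obtains M where "M \<in> F" "\<And>L. L \<in> F \<Longrightarrow> M \<subseteq> L \<Longrightarrow> L = M"
proof -
  have "\<exists>M\<in>F. \<forall>L\<in>F. M \<subseteq> L \<longrightarrow> L = M"
  proof (rule subset_Zorn_nonempty[OF assms(1)])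
    fix C assume C: "C \<noteq> {}" "subset.chain F C"
    then have "subset.chain {I. ideal I R} C" using assms(2) by (auto simp: pred_on.chain_def)
    then have "\<Union>C \<in> C" by (rule ideal_chain_is_trivial[OF C(1)])
    then show "\<Union>C \<in> F" using C by (auto simp: pred_on.chain_def)
  qed
  then show thesis using that by blast
qed

lemma descending_ideal_chain_le:
  assumes "descending_ideal_chain R I" "n \<le> i" shows "I i \<subseteq> I n"
  using assms lift_Suc_antimono_le[of I n i] by (simp add: descending_ideal_chain_def)

context cring
begin

text \<open>A maximal member among the annihilators of nonzero elements killed by \<open>s\<close>
  is prime: replacing \<open>y\<close> by a nonzero multiple b y can only enlarge the annihilator,
  hence does not change it. All these annihilators contain \<open>s\<close>.\<close>

lemma noetherian_zero_divisor_associated: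
  assumes noeth: "noetherian_ring R" and sx: "s \<in> carrier R" "x \<in> carrier R" "s \<otimes> x = \<zero>" "x \<noteq> \<zero>"
  obtains P where "P \<in> ass_primes R" "s \<in> P"
proof -
  define F where "F = {annihilator R y | y. y \<in> carrier R \<and> y \<noteq> \<zero> \<and> s \<otimes> y = \<zero>}"
  have "F \<noteq> {}" using sx by (auto simp: F_def)
  moreover have "ideal I R" if "I \<in> F" for I using that by (auto simp: F_def annihilator_ideal)
  ultimately obtain M where M: "M \<in> F" and max: "\<And>L. L \<in> F \<Longrightarrow> M \<subseteq> L \<Longrightarrow> L = M"
    using noetherian_ring.exists_maximal_member[OF noeth, of F] by blast
  obtain y where y: "y \<in> carrier R" "y \<noteq> \<zero>" "s \<otimes> y = \<zero>" "M = annihilator R y"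
    using M unfolding F_def by blast
  have "primeideal M R"
  proof (rule primeidealI)
    show "ideal M R" using y by (simp add: annihilator_ideal)
    show "cring R" by (rule is_cring)
    have "\<one> \<notin> M" using y by (simp add: annihilator_def)
    then show "carrier R \<noteq> M" using one_closed by blast
    fix a b assume ab: "a \<in> carrier R" "b \<in> carrier R" "a \<otimes> b \<in> M"
    show "a \<in> M \<or> b \<in> M"
    proof (cases "b \<in> M")
      case False
      have yb: "b \<otimes> y \<in> carrier R" "b \<otimes> y \<noteq> \<zero>" using False ab y by (simp_all add: annihilator_def)
      have "s \<otimes> (b \<otimes> y) = b \<otimes> (s \<otimes> y)" using sx(1) ab y(1) by (simp add: m_lcomm)
      then have "annihilator R (b \<otimes> y) \<in> F" using yb y ab unfolding F_def by auto
      moreover have "r \<otimes> (b \<otimes> y) = \<zero>" if "r \<in> carrier R" "r \<otimes> y = \<zero>" for r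
        using that ab(2) y(1) by (simp add: m_lcomm[of r b y])
      then have "M \<subseteq> annihilator R (b \<otimes> y)" unfolding y(4) by (auto simp: annihilator_def)
      ultimately have "annihilator R (b \<otimes> y) = M" by (rule max)
      moreover have "a \<in> annihilator R (b \<otimes> y)" using ab y by (simp add: annihilator_def m_assoc)
      ultimately show ?thesis by simp
    qed simp
  qed
  then have "M \<in> ass_primes R" using y by (auto simp: ass_primes_def)
  moreover have "s \<in> M" using y sx by (simp add: annihilator_def)
  ultimately show thesis by (rule that)
qed

text \<open>An ideal that is maximal among those lying below a non-stabilising chain is prime.\<close>

lemma noetherian_primes_maximal_artinian:
  assumes noeth: "noetherian_ring R" and primes: "\<And>P. primeideal P R \<Longrightarrow> maximalideal P R"
  shows "artinian R"
proof (rule ccontr)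
  assume no: "\<not> artinian R"
  define stable where "stable I \<longleftrightarrow> (\<exists>n. \<forall>i\<ge>n. I n = I i)" for I :: "nat \<Rightarrow> 'a set"
  define F where "F = {J. ideal J R \<and> (\<exists>I. descending_ideal_chain R I \<and> (\<forall>n. J \<subseteq> I n) \<and> \<not> stable I)}"
  obtain I0 where "descending_ideal_chain R I0" "\<not> stable I0"
    using no unfolding artinian_def stable_def by blast
  moreover from this have "\<forall>n. {\<zero>} \<subseteq> I0 n"
    using additive_subgroup.zero_closed ideal.axioms(1) unfolding descending_ideal_chain_def by blast
  ultimately have "{\<zero>} \<in> F" using zeroideal unfolding F_def by blast
  then obtain M where M: "M \<in> F" and max: "\<And>L. L \<in> F \<Longrightarrow> M \<subseteq> L \<Longrightarrow> L = M"
    using noetherian_ring.exists_maximal_member[OF noeth, of F] unfolding F_def by blast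
  obtain I where Mi: "ideal M R" and I: "descending_ideal_chain R I" "\<And>n. M \<subseteq> I n" "\<not> stable I"
    using M unfolding F_def by blast
  have Ii: "ideal (I n) R" for n using I(1) by (simp add: descending_ideal_chain_def)
  note dec = descending_ideal_chain_le[OF I(1)]
  have "primeideal M R"
  proof (rule primeidealI[OF Mi is_cring])
    have "stable I" if "carrier R = M"
    proof -
      have "I n = M" for n using that I(2)[of n] ideal.Icarr[OF Ii] by blast
      then show ?thesis by (simp add: stable_def)
    qed
    then show "carrier R \<noteq> M" using I(3) by blast
    fix a b assume ab: "a \<in> carrier R" "b \<in> carrier R" "a \<otimes> b \<in> M"
    show "a \<in> M \<or> b \<in> M"
    proof (rule ccontr)
      assume notin: "\<not> (a \<in> M \<or> b \<in> M)"
      \<comment> \<open>\<open>S J\<close> is J + aR and \<open>Q J\<close> is the colon ideal (J :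
        a). Both are strictly larger than \<open>M\<close> for J = M, the first because of
        \<open>a\<close> and the second because of \<open>b\<close>, so by maximality both derived
        chains stabilise; together they determine the original chain.\<close>
      define S where "S J = J <+>\<^bsub>R\<^esub> PIdl a" for J
      define Q where "Q J = {x \<in> carrier R. a \<otimes> x \<in> J}" for J
      have Si: "ideal (S J) R" if "ideal J R" for J
        unfolding S_def by (rule add_ideals[OF that cgenideal_ideal[OF ab(1)]])
      have Qi: "ideal (Q J) R" if "ideal J R" for J
        unfolding Q_def by (rule ideal.helper_max_prime[OF that is_cring ab(1)])
      have monoS: "S J \<subseteq> S J'" if "J \<subseteq> J'" for J J' using that by (auto simp: S_def set_add_def')
      have monoQ: "Q J \<subseteq> Q J'" if "J \<subseteq> J'" for J J' using that by (auto simp: Q_def)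
      have inS: "u \<oplus> r \<otimes> a \<in> S J" if "u \<in> J" "r \<in> carrier R" for u r J
        using that by (auto simp: S_def set_add_def' cgenideal_def)
      have M0: "\<zero> \<in> M" using Mi additive_subgroup.zero_closed ideal.axioms(1) by blast
      have "stable (\<lambda>n. S (I n))"
      proof (rule ccontr)
        assume "\<not> stable (\<lambda>n. S (I n))"
        moreover have "descending_ideal_chain R (\<lambda>n. S (I n))"
          using Si[OF Ii] monoS[OF dec[of _ "Suc _"]] by (simp add: descending_ideal_chain_def)
        moreover have "\<forall>n. S M \<subseteq> S (I n)" using monoS[OF I(2)] by simp
        ultimately have "S M \<in> F" using Si[OF Mi] unfolding F_def by blast
        moreover have "M \<subseteq> S M" using inS[of _ M \<zero>] ab(1) ideal.Icarr[OF Mi] by fastforce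
        ultimately have "S M = M" by (rule max)
        then show False using inS[OF M0 one_closed] ab(1) notin by simp
      qed
      moreover have "stable (\<lambda>n. Q (I n))"
      proof (rule ccontr)
        assume "\<not> stable (\<lambda>n. Q (I n))"
        moreover have "descending_ideal_chain R (\<lambda>n. Q (I n))"
          using Qi[OF Ii] monoQ[OF dec[of _ "Suc _"]] by (simp add: descending_ideal_chain_def)
        moreover have "\<forall>n. Q M \<subseteq> Q (I n)" using monoQ[OF I(2)] by simp
        ultimately have "Q M \<in> F" using Qi[OF Mi] unfolding F_def by blast
        moreover have "M \<subseteq> Q M" using ab(1) ideal.Icarr[OF Mi] ideal.I_l_closed[OF Mi] by (auto simp: Q_def)
        ultimately have "Q M = M" by (rule max)
        then show False using ab notin by (auto simp: Q_def)
      qed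
      ultimately obtain n1 n2 where n1: "\<And>i. i \<ge> n1 \<Longrightarrow> S (I n1) = S (I i)"
        and n2: "\<And>i. i \<ge> n2 \<Longrightarrow> Q (I n2) = Q (I i)" unfolding stable_def by blast
      define n where "n = max n1 n2"
      \<comment> \<open>An element of \<open>I n\<close> lies in \<open>S (I i)\<close>, so it is y
        + r a with \<open>y\<close> in \<open>I i\<close>. Then r a is in \<open>I n\<close>, so
        \<open>r\<close> is in the colon ideal, which no longer changes, and r a is in
        \<open>I i\<close>.\<close>
      have "I n \<subseteq> I i" if ni: "i \<ge> n" for i
      proof
        fix x assume x: "x \<in> I n"
        have xc: "x \<in> carrier R" by (rule ideal.Icarr[OF Ii x])
        have "S (I n) = S (I i)" "Q (I n) = Q (I i)"
          using n1[of n] n1[of i] n2[of n] n2[of i] ni by (auto simp: n_def)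
        moreover have "x \<in> S (I n)" using inS[OF x zero_closed] ab(1) xc by simp
        ultimately have "x \<in> S (I i)" by simp
        then obtain y r where y: "y \<in> I i" "r \<in> carrier R" "x = y \<oplus> r \<otimes> a"
          by (auto simp: S_def set_add_def' cgenideal_def)
        have yc: "y \<in> carrier R" by (rule ideal.Icarr[OF Ii y(1)])
        have "r \<otimes> a = x \<oplus> \<ominus> y" unfolding y(3) using y(2) yc ab(1) by algebra
        moreover have "y \<in> I n" using dec[OF ni] y(1) by blast
        ultimately have "r \<otimes> a \<in> I n"
          using x Ii[of n] additive_subgroup.a_closed additive_subgroup.a_inv_closed ideal.axioms(1) by metis
        then have "r \<in> Q (I n)" using y(2) ab(1) by (simp add: Q_def m_comm)
        then have "r \<in> Q (I i)" using \<open>Q (I n) = Q (I i)\<close> by simp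
        then have "r \<otimes> a \<in> I i" using ab(1) by (auto simp: Q_def m_comm)
        from additive_subgroup.a_closed[OF ideal.axioms(1)[OF Ii] y(1) this]
        show "x \<in> I i" unfolding y(3) .
      qed
      then have "\<forall>i\<ge>n. I n = I i" using dec by blast
      then show False using I(3) unfolding stable_def by blast
    qed
  qed
  then interpret M: maximalideal M R by (rule primes)
  \<comment> \<open>The chain lies above the maximal ideal \<open>M\<close>, where only two ideals
    are left.\<close>
  have dich: "I n = M \<or> I n = carrier R" for n
    using M.I_maximal[OF Ii I(2)] ideal.Icarr[OF Ii] by blast
  have "stable I"
  proof (cases "\<exists>n. I n = M")
    case True
    then obtain n where n: "I n = M" by blast
    then have "I n = I i" if "i \<ge> n" for i using dec[OF that] I(2)[of i] by blast
    then show ?thesis unfolding stable_def by blast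
  next
    case False
    then have "I n = carrier R" for n using dich by blast
    then show ?thesis unfolding stable_def by simp
  qed
  then show False using I(3) by blast
qed

end

text \<open>For \<open>P\<close> prime and \<open>I\<close> an ideal this is the preimage in
  \<open>R\<close> of the extension of \<open>I\<close> to the localisation at \<open>P\<close>; for
  \<open>I\<close> a power of \<open>P\<close> it is a symbolic power.\<close>

definition saturation :: "('a, 'm) ring_scheme \<Rightarrow> 'a set \<Rightarrow> 'a set \<Rightarrow> 'a set" where
  "saturation R P I = {x \<in> carrier R. \<exists>s\<in>carrier R - P. s \<otimes>\<^bsub>R\<^esub> x \<in> I}"

context cring
begin

lemma prime_mult_notin:
  "primeideal P R \<Longrightarrow> s \<in> carrier R - P \<Longrightarrow> t \<in> carrier R - P \<Longrightarrow> s \<otimes> t \<in> carrier R - P"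
  using primeideal.I_prime by fastforce

lemma saturation_saturated:
  assumes P: "primeideal P R" and x: "x \<in> carrier R" "s \<in> carrier R - P" "s \<otimes> x \<in> saturation R P I"
  shows "x \<in> saturation R P I"
proof -
  obtain s' where s': "s' \<in> carrier R - P" "s' \<otimes> (s \<otimes> x) \<in> I" using x by (auto simp: saturation_def)
  then have "(s' \<otimes> s) \<otimes> x \<in> I" using x by (simp add: m_assoc)
  then show ?thesis using prime_mult_notin[OF P s'(1) x(2)] x(1) unfolding saturation_def by blast
qed

lemma saturation_ideal:
  assumes P: "primeideal P R" and I: "ideal I R"
  shows "ideal (saturation R P I) R"
proof (rule idealI[OF ring_axioms])
  interpret I: ideal I R by fact
  have one: "\<one> \<in> carrier R - P"
    using primeideal.I_notcarr[OF P] ideal.one_imp_carrier[OF primeideal.axioms(1)[OF P]] by blast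
  have mult: "x \<otimes> a \<in> saturation R P I" if a: "a \<in> saturation R P I" and x: "x \<in> carrier R" for a x
  proof -
    obtain s where s: "s \<in> carrier R - P" "s \<otimes> a \<in> I" and ac: "a \<in> carrier R"
      using a by (auto simp: saturation_def)
    have "s \<otimes> (x \<otimes> a) = x \<otimes> (s \<otimes> a)" using s(1) ac x by (simp add: m_lcomm)
    then have "s \<otimes> (x \<otimes> a) \<in> I" using I.I_l_closed[OF s(2) x] by simp
    then show ?thesis using s(1) ac x unfolding saturation_def by blast
  qed
  then show "x \<otimes> a \<in> saturation R P I" "a \<otimes> x \<in> saturation R P I"
    if "a \<in> saturation R P I" "x \<in> carrier R" for a x
    using that mult[OF that] m_comm[of a x] by (simp_all add: saturation_def)
  show "subgroup (saturation R P I) (add_monoid R)"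
  proof (rule add.subgroupI)
    show "saturation R P I \<noteq> {}"
      using one I.zero_closed unfolding saturation_def by (auto intro!: exI[of _ \<zero>] bexI[of _ \<one>])
  next
    fix x assume x: "x \<in> saturation R P I"
    then have "\<ominus> x = (\<ominus> \<one>) \<otimes> x" by (simp add: saturation_def l_minus)
    then show "\<ominus> x \<in> saturation R P I" using mult[OF x, of "\<ominus> \<one>"] by simp
  next
    fix x y assume "x \<in> saturation R P I" "y \<in> saturation R P I"
    then obtain s t where c: "x \<in> carrier R" "y \<in> carrier R" and
      s: "s \<in> carrier R - P" "s \<otimes> x \<in> I" and t: "t \<in> carrier R - P" "t \<otimes> y \<in> I"
      by (auto simp: saturation_def)
    have sc: "s \<in> carrier R" "t \<in> carrier R" using s t by auto
    have "(s \<otimes> t) \<otimes> (x \<oplus> y) = t \<otimes> (s \<otimes> x) \<oplus> s \<otimes> (t \<otimes> y)" using c sc by algebra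
    then have "(s \<otimes> t) \<otimes> (x \<oplus> y) \<in> I" using s(2) t(2) sc I.I_l_closed by simp
    then show "x \<oplus> y \<in> saturation R P I"
      using prime_mult_notin[OF P s(1) t(1)] c unfolding saturation_def by blast
  qed (auto simp: saturation_def)
qed

text \<open>If \<open>p\<close> were the only associated prime, all elements outside \<open>p\<close> would be regular. Compare the
  ideals \<open>t\<^sup>nR + p\<close> for some \<open>t \<notin> p\<close> that is not a unit modulo \<open>p\<close>: an isomorphism between two consecutive
  ones forces \<open>M = tM\<close> for the torsion-free \<open>R/p\<close>-module \<open>M = p/p\<^sup>(\<^sup>2\<^sup>)\<close>, where \<open>p\<^sup>(\<^sup>2\<^sup>)\<close> is the symbolic
  square; so \<open>M = 0\<close>. Then \<open>p\<close> lies in all its symbolic powers and, being nilpotent, is zero.\<close>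

lemma noetherian_isoartinian_second_associated:
  assumes noeth: "noetherian_ring R" and isoart: "isoartinian R"
    and prime: "primeideal (nilrad R) R" and nz: "nilrad R \<noteq> {\<zero>}"
    and J: "ideal J R" "nilrad R \<subset> J" "J \<noteq> carrier R"
  shows "\<exists>P\<in>ass_primes R. P \<noteq> nilrad R"
proof (rule ccontr)
  assume no: "\<not> (\<exists>P\<in>ass_primes R. P \<noteq> nilrad R)"
  define p where "p = nilrad R"
  define p2 where "p2 = ideal_prod R p p"
  define q where "q = saturation R p p2"
  have prime: "primeideal p R" using prime by (simp add: p_def)
  interpret p: primeideal p R by (rule prime)
  have regular: "x = \<zero>" if "s \<in> carrier R - p" "x \<in> carrier R" "s \<otimes> x = \<zero>" for s x
  proof (rule ccontr)
    assume "x \<noteq> \<zero>"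
    then obtain P where "P \<in> ass_primes R" "s \<in> P"
      using noetherian_zero_divisor_associated[OF noeth, of s x] \<open>s \<in> carrier R - p\<close> \<open>x \<in> carrier R\<close> \<open>s \<otimes> x = \<zero>\<close> by blast
    then show False using no \<open>s \<in> carrier R - p\<close> by (auto simp: p_def)
  qed
  have p2i: "ideal p2 R" unfolding p2_def by (rule ideal_prod_is_ideal[OF p.is_ideal p.is_ideal])
  have one: "\<one> \<in> carrier R - p" using p.I_notcarr p.one_imp_carrier by blast
  have qi: "ideal q R" unfolding q_def by (rule saturation_ideal[OF prime p2i])
  interpret q: ideal q R by (rule qi)
  have "\<not> p \<subseteq> q"
  proof
    assume pq: "p \<subseteq> q"
    define pw where "pw k = p [^]\<^bsub>ideals_set R\<^esub> k" for k :: nat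
    have pwi: "ideal (pw k) R" for k unfolding pw_def by (rule ideal_pow_ideal[OF p.is_ideal])
    have pwS: "pw (Suc k) = ideal_prod R (pw k) p" for k unfolding pw_def by (rule ideal_pow_Suc[OF p.is_ideal])
    have sati: "ideal (saturation R p (pw k)) R" for k by (rule saturation_ideal[OF prime pwi])
    \<comment> \<open>The assumption says that, up to a factor outside \<open>p\<close>, elements of
      \<open>p\<close> lie in p^2. By the induction hypothesis the first factor of each product in
      p^2 lies in the saturation of p^(k+1), so the product lies in that of p^(k+2).\<close>
    have sub: "p \<subseteq> saturation R p (pw (Suc k))" for k
    proof (induction k)
      case 0
      show ?case
      proof
        fix x assume x: "x \<in> p"
        have "\<one> \<in> pw 0" unfolding pw_def ideal_pow_0 by simp
        then have "\<one> \<otimes> x \<in> pw (Suc 0)" unfolding pwS using x by (rule ideal_prod.prod)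
        then show "x \<in> saturation R p (pw (Suc 0))" using one p.Icarr[OF x] unfolding saturation_def by blast
      qed
    next
      case (Suc k)
      have *: "z \<in> saturation R p (pw (Suc (Suc k)))" if "z \<in> p2" for z
        using that unfolding p2_def
      proof induction
        case (prod i j)
        then obtain s where s: "s \<in> carrier R - p" "s \<otimes> i \<in> pw (Suc k)" using Suc.IH by (auto simp: saturation_def)
        have c: "i \<in> carrier R" "j \<in> carrier R" "s \<in> carrier R" using prod s by auto
        have "(s \<otimes> i) \<otimes> j \<in> pw (Suc (Suc k))"
          unfolding pwS[of "Suc k"] using s(2) prod(2) by (rule ideal_prod.prod)
        then have "s \<otimes> (i \<otimes> j) \<in> pw (Suc (Suc k))" using c by (simp add: m_assoc)
        then show ?case using s(1) c unfolding saturation_def by blast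
      next
        case (sum s1 s2)
        then show ?case by (intro additive_subgroup.a_closed[OF ideal.axioms(1)[OF sati]])
      qed
      show ?case
      proof
        fix x assume x: "x \<in> p"
        then have "x \<in> saturation R p p2" using pq unfolding q_def by blast
        then obtain s where s: "s \<in> carrier R - p" "s \<otimes> x \<in> p2" unfolding saturation_def by blast
        show "x \<in> saturation R p (pw (Suc (Suc k)))"
          by (rule saturation_saturated[OF prime p.Icarr[OF x] s(1) *[OF s(2)]])
      qed
    qed
    obtain m :: nat where "pw m = {\<zero>}"
      using isoartinian_nilrad_nilpotent[OF isoart] by (auto simp: nilpotent_ideal_def pw_def p_def)
    then have "pw (Suc m) \<subseteq> {\<zero>}" using ideal_prod_inter[OF pwi[of m] p.is_ideal] by (auto simp: pwS)
    then have "x = \<zero>" if "x \<in> p" for x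
      using subsetD[OF sub[of m] that] regular[of _ x] unfolding saturation_def by blast
    then show False using nz p.zero_closed unfolding p_def by blast
  qed
  then obtain x0 where x0: "x0 \<in> p - q" by blast
  obtain t where t: "t \<in> J" "t \<in> carrier R - p" using J ideal.Icarr[OF J(1)] unfolding p_def by blast
  have tc: "t \<in> carrier R" using t by blast
  have tn: "t [^] n \<in> carrier R - p" for n :: nat
  proof (induction n)
    case 0 then show ?case using one by simp
  next
    case (Suc n) then show ?case using prime_mult_notin[OF prime Suc t(2)] by simp
  qed
  have "\<exists>y\<in>p. x \<ominus> t \<otimes> y \<in> q" if x: "x \<in> p" for x
  proof -
    define I where "I n = PIdl (t [^] n) <+>\<^bsub>R\<^esub> p" for n :: nat
    have Ii: "ideal (I n) R" for n
      unfolding I_def using tc by (intro add_ideals cgenideal_ideal p.is_ideal) simp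
    have inI: "r \<otimes> t [^] n \<oplus> b \<in> I n" if "r \<in> carrier R" "b \<in> p" for r b n
      using that by (auto simp: I_def set_add_def' cgenideal_def)
    have elimI: "\<exists>r\<in>carrier R. \<exists>b\<in>p. z = r \<otimes> t [^] n \<oplus> b" if "z \<in> I n" for z n
      using that by (auto simp: I_def set_add_def' cgenideal_def)
    have "I (Suc n) \<subseteq> I n" for n
    proof
      fix z assume "z \<in> I (Suc n)"
      then obtain r b where z: "r \<in> carrier R" "b \<in> p" "z = r \<otimes> t [^] Suc n \<oplus> b" using elimI by blast
      then have "z = (r \<otimes> t) \<otimes> t [^] n \<oplus> b" using tc by (simp add: m_ac)
      then show "z \<in> I n" using inI[of "r \<otimes> t" b n] z tc by simp
    qed
    then have "descending_ideal_chain R I" using Ii by (simp add: descending_ideal_chain_def)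
    then obtain n where "ideals_isomorphic R (I n) (I (Suc n))"
      using isoart unfolding isoartinian_def by (meson le_SucI order_refl)
    then obtain h where h: "bij_betw h (I n) (I (Suc n))"
      and lin: "\<And>r x. r \<in> carrier R \<Longrightarrow> x \<in> I n \<Longrightarrow> h (r \<otimes> x) = r \<otimes> h x"
      by (metis ideals_isomorphicE)
    have "x \<in> I (Suc n)" using inI[OF zero_closed x] tc x p.Icarr by simp
    then obtain y where y: "y \<in> I n" "x = h y" using h by (auto simp: bij_betw_def)
    \<comment> \<open>\<open>p\<close> is the nilradical and isomorphisms of ideals reflect
      nilpotency, so the preimage \<open>y\<close> stays in \<open>p\<close>.\<close>
    then have yp: "y \<in> p" using linear_bij_nilpotent_iff[OF Ii Ii h lin y(1)] x by (simp add: p_def)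
    have tI: "t [^] n \<in> I n" using inI[OF one_closed p.zero_closed, of n] tc by simp
    then have "h (t [^] n) \<in> I (Suc n)" using h by (auto simp: bij_betw_def)
    then obtain r b where rb: "r \<in> carrier R" "b \<in> p" "h (t [^] n) = r \<otimes> t [^] Suc n \<oplus> b"
      using elimI by blast
    define c where "c = t [^] n"
    have cc: "c \<in> carrier R" "y \<in> carrier R" "b \<in> carrier R" "x \<in> carrier R"
      using tc yp rb(2) x p.Icarr by (auto simp: c_def)
    \<comment> \<open>Computing h (c y) in two ways, with c = t^n, gives c x = y (r c t + b). Hence
      c (x - t r y) = y b lies in p^2 while \<open>c\<close> lies outside \<open>p\<close>.\<close>
    have "c \<otimes> x = h (c \<otimes> y)" using lin y cc by simp
    also have "c \<otimes> y = y \<otimes> c" using cc by (simp add: m_comm)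
    also have "h (y \<otimes> c) = y \<otimes> (r \<otimes> (c \<otimes> t) \<oplus> b)" using lin[OF cc(2) tI] rb(3) by (simp add: c_def)
    finally have e: "c \<otimes> x = y \<otimes> (r \<otimes> (c \<otimes> t) \<oplus> b)" .
    have "c \<otimes> (x \<ominus> t \<otimes> (r \<otimes> y)) = c \<otimes> x \<ominus> y \<otimes> (r \<otimes> (c \<otimes> t))"
      using cc tc rb(1) by algebra
    also have "\<dots> = y \<otimes> b" unfolding e using cc tc rb(1) by algebra
    also have "y \<otimes> b \<in> p2" unfolding p2_def using yp rb(2) by (rule ideal_prod.prod)
    finally have "c \<otimes> (x \<ominus> t \<otimes> (r \<otimes> y)) \<in> p2" .
    then have "x \<ominus> t \<otimes> (r \<otimes> y) \<in> q"
      using tn[of n] cc tc rb(1) unfolding q_def saturation_def c_def by blast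
    moreover have "r \<otimes> y \<in> p" using yp rb(1) p.I_l_closed by simp
    ultimately show ?thesis by blast
  qed
  note divisible = this
  \<comment> \<open>This replaces Nakayama's lemma. Take xR + q maximal among these ideals with
    \<open>x\<close> in \<open>p\<close> outside \<open>q\<close>. Since x = t y + w with
    \<open>w\<close> in \<open>q\<close>, it lies in yR + q, so both are equal and y = d x + v;
    therefore (1 - d t) y is in \<open>q\<close>. As \<open>t\<close> lies in the proper ideal
    \<open>J\<close> above \<open>p\<close>, the factor 1 - d t is outside \<open>p\<close>, which
    forces \<open>y\<close> into \<open>q\<close>.\<close>
  define G where "G x = PIdl x <+>\<^bsub>R\<^esub> q" for x
  have Gi: "ideal (G x) R" if "x \<in> p" for x
    unfolding G_def using that p.Icarr by (intro add_ideals cgenideal_ideal qi) simp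
  have inG: "r \<otimes> x \<oplus> w \<in> G x" if "r \<in> carrier R" "w \<in> q" for r w x
    using that by (auto simp: G_def set_add_def' cgenideal_def)
  have "G ` (p - q) \<noteq> {}" using x0 by blast
  then obtain M where "M \<in> G ` (p - q)" and max: "\<And>L. L \<in> G ` (p - q) \<Longrightarrow> M \<subseteq> L \<Longrightarrow> L = M"
    using noetherian_ring.exists_maximal_member[OF noeth, of "G ` (p - q)"] Gi by blast
  then obtain x where x: "x \<in> p - q" "M = G x" by blast
  obtain y where y: "y \<in> p" "x \<ominus> t \<otimes> y \<in> q" using divisible x by blast
  define w where "w = x \<ominus> t \<otimes> y"
  have c: "x \<in> carrier R" "y \<in> carrier R" using x y p.Icarr by auto
  have w: "w \<in> q" "w \<in> carrier R" using y q.Icarr by (auto simp: w_def)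
  have x_eq: "x = t \<otimes> y \<oplus> w" unfolding w_def using c tc by algebra
  have "y \<notin> q"
  proof
    assume "y \<in> q"
    then have "t \<otimes> y \<oplus> w \<in> q" using w tc q.I_l_closed by simp
    then show False using x x_eq by simp
  qed
  then have yG: "G y \<in> G ` (p - q)" using y by blast
  have "G x \<subseteq> G y"
  proof
    fix z assume "z \<in> G x"
    then obtain r v where z: "r \<in> carrier R" "v \<in> q" "z = r \<otimes> x \<oplus> v"
      by (auto simp: G_def set_add_def' cgenideal_def)
    have vc: "v \<in> carrier R" using z q.Icarr by blast
    have "z = (r \<otimes> t) \<otimes> y \<oplus> (r \<otimes> w \<oplus> v)" unfolding z(3) x_eq using c w tc z(1) vc by algebra
    moreover have "r \<otimes> w \<oplus> v \<in> q" using w z q.I_l_closed by simp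
    ultimately show "z \<in> G y" using inG[of "r \<otimes> t" "r \<otimes> w \<oplus> v" y] z(1) tc by simp
  qed
  then have "G y = G x" using max[OF yG] x by simp
  moreover have "y \<in> G y" using inG[OF one_closed q.zero_closed, of y] c by simp
  ultimately have "y \<in> G x" by simp
  then obtain d v where d: "d \<in> carrier R" "v \<in> q" "y = d \<otimes> x \<oplus> v"
    by (auto simp: G_def set_add_def' cgenideal_def)
  have vc: "v \<in> carrier R" using d q.Icarr by blast
  have "(\<one> \<ominus> d \<otimes> t) \<otimes> y = y \<ominus> d \<otimes> (t \<otimes> y)" using c d(1) tc by algebra
  also have "\<dots> = d \<otimes> (t \<otimes> y \<oplus> w) \<oplus> v \<ominus> d \<otimes> (t \<otimes> y)" using d(3) x_eq by simp
  also have "\<dots> = d \<otimes> w \<oplus> v" using c d(1) tc w(2) vc by algebra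
  also have "\<dots> \<in> q" using w d q.I_l_closed by simp
  finally have inq: "(\<one> \<ominus> d \<otimes> t) \<otimes> y \<in> q" .
  have "\<one> \<ominus> d \<otimes> t \<notin> p"
  proof
    assume "\<one> \<ominus> d \<otimes> t \<in> p"
    then have "\<one> \<ominus> d \<otimes> t \<in> J" using J by (auto simp: p_def)
    moreover have "d \<otimes> t \<in> J" using ideal.I_l_closed[OF J(1) t(1) d(1)] .
    ultimately have "(\<one> \<ominus> d \<otimes> t) \<oplus> d \<otimes> t \<in> J"
      by (rule additive_subgroup.a_closed[OF ideal.axioms(1)[OF J(1)]])
    moreover have "(\<one> \<ominus> d \<otimes> t) \<oplus> d \<otimes> t = \<one>" using d(1) tc by algebra
    ultimately show False using ideal.one_imp_carrier[OF J(1)] J(3) by simp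
  qed
  then have "\<one> \<ominus> d \<otimes> t \<in> carrier R - p" using d(1) tc by simp
  from saturation_saturated[OF prime c(2) this inq[unfolded q_def]] have "y \<in> q" unfolding q_def .
  then show False using \<open>y \<notin> q\<close> by blast
qed

end

section \<open>The six types\<close>

definition listed_type :: "('a, 'm) ring_scheme \<Rightarrow> bool" where
  "listed_type A \<longleftrightarrow> type_i A \<or> type_ii A \<or> type_iii A \<or> type_iv A \<or> type_v A \<or> type_vi A"

lemma decomposition_iff: "decomposition R As \<longleftrightarrow> (\<forall>A\<in>set As. listed_type A) \<and> R \<simeq> RDirProd_list As"
  by (simp add: decomposition_def listed_type_def)

text \<open>The nilradical is prime because its quotient is a domain, and it lies in every prime, so
  it is the only minimal prime. Its maximality is tested before its vanishing; a field thus lands in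
  type (i), in agreement with its exclusion from type (iii).\<close>

lemma isoartinian_connected_listed_type:
  assumes nzc: "nonzero_cring R" and isoart: "isoartinian R"
    and conn: "\<And>e. idempotent_elem R e \<Longrightarrow> e = \<zero>\<^bsub>R\<^esub> \<or> e = \<one>\<^bsub>R\<^esub>"
  shows "listed_type R"
proof -
  have cr: "cring R" and nz: "\<one>\<^bsub>R\<^esub> \<noteq> \<zero>\<^bsub>R\<^esub>" using nzc by (auto simp: nonzero_cring_def)
  interpret cring R by (rule cr)
  define p where "p = nilrad R"
  have pd: "principal_domain (R Quot p)"
    unfolding p_def by (rule isoartinian_connected_Quot_nilrad[OF cr isoart nz conn])
  have pi: "ideal p R" unfolding p_def by (rule nilrad_ideal)
  have prime: "primeideal p R"
    using quot_domain_imp_primeideal[OF pi] principal_domain.axioms(1)[OF pd] by blast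
  have sub: "p \<subseteq> P" if "primeideal P R" for P unfolding p_def by (rule nilrad_subset_prime[OF that])
  have "P = p" if "P \<in> min_primes R" for P
    using that prime sub[of P] unfolding min_primes_def by blast
  moreover have "p \<in> min_primes R" using prime sub unfolding min_primes_def by blast
  ultimately have min: "min_primes R = {p}" by blast
  then have pd': "\<exists>p. min_primes R = {p} \<and> principal_domain (R Quot p)" using pd by blast
  have nilp: "nilpotent_ideal R p" unfolding p_def by (rule isoartinian_nilrad_nilpotent[OF isoart])
  have ass: "p \<in> ass_primes R" by (rule isoartinian_nilpotent_prime_associated[OF isoart prime nilp])
  show ?thesis
  proof (cases "maximalideal p R")
    case True
    interpret p: maximalideal p R by (rule True)
    have eq: "P = p" if "primeideal P R" for P
    proof -
      interpret P: primeideal P R by (rule that)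
      show ?thesis using p.I_maximal[OF P.is_ideal sub[OF that]] P.I_notcarr P.a_subset by auto
    qed
    have eqm: "M = p" if "maximalideal M R" for M using eq maximalideal_prime[OF that] by blast
    have loc: "local_ring R" unfolding local_ring_def using True eqm by blast
    show ?thesis
    proof (cases "noetherian_ring R")
      case True
      then have "artinian R"
        using noetherian_primes_maximal_artinian eq \<open>maximalideal p R\<close> by blast
      then show ?thesis using nzc loc by (simp add: listed_type_def type_i_def)
    next
      case False
      then have "type_ii R" using nzc isoart loc nilp eqm by (auto simp: type_ii_def)
      then show ?thesis by (simp add: listed_type_def)
    qed
  next
    case False
    show ?thesis
    proof (cases "p = {\<zero>\<^bsub>R\<^esub>}")
      case True
      then have "principal_domain R"
        using isoartinian_reduced_principal_domain[OF isoart _ nz conn] by (simp add: p_def)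
      moreover have "\<not> field R" using False True zeromaximalideal_eq_field by simp
      ultimately show ?thesis by (simp add: listed_type_def type_iii_def)
    next
      case nz: False
      show ?thesis
      proof (cases "noetherian_ring R")
        case True
        \<comment> \<open>\<open>p\<close> is proper and not maximal, so there is a proper ideal
          strictly above it; its elements outside \<open>p\<close> are nonunits modulo
          \<open>p\<close>.\<close>
        obtain J where J: "ideal J R" "p \<subseteq> J" "J \<noteq> p" "J \<noteq> carrier R"
          using False maximalidealI[OF pi primeideal.I_notcarr[OF prime]] by blast
        then have "\<exists>P\<in>ass_primes R. P \<noteq> p"
          using noetherian_isoartinian_second_associated[OF True isoart, of J] prime nz by (auto simp: p_def)
        then have "min_primes R \<subset> ass_primes R" using ass by (auto simp: min)
        then have "type_iv R" unfolding type_iv_def using True nzc isoart pd' by blast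
        then show ?thesis by (simp add: listed_type_def)
      next
        case nnoeth: False
        show ?thesis
        proof (cases "min_primes R = ass_primes R")
          case True
          moreover have "\<exists>p. min_primes R = {p} \<and> \<not> maximalideal p R \<and> principal_domain (R Quot p)"
            using min pd False by blast
          ultimately have "type_vi R" unfolding type_vi_def using nnoeth nzc isoart by blast
          then show ?thesis by (simp add: listed_type_def)
        next
          case neq: False
          then have "min_primes R \<subset> ass_primes R" using ass by (auto simp: min)
          then have "type_v R" unfolding type_v_def using nnoeth nzc isoart pd' by blast
          then show ?thesis by (simp add: listed_type_def)
        qed
      qed
    qed
  qed
qed

section \<open>Maximal ideals, minimal primes and connectedness\<close>

context cring
begin

lemma exists_maximalideal:
  assumes I: "ideal I R" "\<one> \<notin> I"
  obtains M where "maximalideal M R" "I \<subseteq> M"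
proof -
  define F where "F = {J. ideal J R \<and> I \<subseteq> J \<and> \<one> \<notin> J}"
  have "\<exists>M\<in>F. \<forall>J\<in>F. M \<subseteq> J \<longrightarrow> J = M"
  proof (rule subset_Zorn_nonempty)
    show "F \<noteq> {}" using I by (auto simp: F_def)
    fix C assume C: "C \<noteq> {}" "subset.chain F C"
    then have CF: "C \<subseteq> F" by (auto simp: pred_on.chain_def)
    have "subset.chain {I. ideal I R} C" using C(2) by (auto simp: pred_on.chain_def F_def)
    from chain_Union_is_ideal[OF this] have "ideal (\<Union>C) R" using C(1) by simp
    moreover have "I \<subseteq> \<Union>C" using C(1) CF unfolding F_def by blast
    moreover have "\<one> \<notin> \<Union>C" using CF unfolding F_def by blast
    ultimately show "\<Union>C \<in> F" unfolding F_def by blast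
  qed
  then obtain M where M: "M \<in> F" and max: "\<And>J. J \<in> F \<Longrightarrow> M \<subseteq> J \<Longrightarrow> J = M" by blast
  have "maximalideal M R"
  proof (rule maximalidealI)
    show "ideal M R" using M by (simp add: F_def)
    show "carrier R \<noteq> M" using M one_closed unfolding F_def by blast
    fix J assume J: "ideal J R" "M \<subseteq> J" "J \<subseteq> carrier R"
    show "J = M \<or> J = carrier R"
    proof (cases "\<one> \<in> J")
      case True then show ?thesis using ideal.one_imp_carrier[OF J(1)] by blast
    next
      case False
      then have "J \<in> F" using J M unfolding F_def by blast
      then show ?thesis using max J by blast
    qed
  qed
  then show thesis using that M by (auto simp: F_def)
qed

text \<open>Zorn's lemma is applied to complements: unions of complements correspond to
  intersections of primes, and the intersection of a chain of primes is prime.\<close>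

lemma exists_min_prime:
  assumes P: "primeideal P R"
  obtains Q where "Q \<in> min_primes R" "Q \<subseteq> P"
proof -
  define F where "F = {carrier R - Q | Q. primeideal Q R \<and> Q \<subseteq> P}"
  have "\<exists>A\<in>F. \<forall>B\<in>F. A \<subseteq> B \<longrightarrow> B = A"
  proof (rule subset_Zorn_nonempty)
    show "F \<noteq> {}" using P by (auto simp: F_def)
    fix C assume C: "C \<noteq> {}" "subset.chain F C"
    define D where "D = {Q. primeideal Q R \<and> Q \<subseteq> P \<and> carrier R - Q \<in> C}"
    have Qc: "Q \<subseteq> carrier R" if "Q \<in> D" for Q
      using that ideal.Icarr[OF primeideal.axioms(1)] by (auto simp: D_def)
    have CD: "\<exists>Q\<in>D. A = carrier R - Q" if "A \<in> C" for A
    proof -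
      have "A \<in> F" using C(2) that by (auto simp: pred_on.chain_def)
      then obtain Q where Q: "A = carrier R - Q" "primeideal Q R" "Q \<subseteq> P" unfolding F_def by blast
      then have "Q \<in> D" using that by (simp add: D_def)
      then show ?thesis using Q(1) by blast
    qed
    have D: "D \<noteq> {}" using C(1) CD by blast
    have total: "Q \<subseteq> Q' \<or> Q' \<subseteq> Q" if "Q \<in> D" "Q' \<in> D" for Q Q'
    proof -
      have "carrier R - Q \<in> C" "carrier R - Q' \<in> C" using that by (simp_all add: D_def)
      then have "carrier R - Q \<subseteq> carrier R - Q' \<or> carrier R - Q' \<subseteq> carrier R - Q"
        using C(2) by (simp add: subset_chain_def)
      then show ?thesis using Qc[OF that(1)] Qc[OF that(2)] by auto
    qed
    have "primeideal (\<Inter>D) R"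
    proof (rule primeidealI)
      show "ideal (\<Inter>D) R"
        by (rule i_Intersect[OF _ D]) (auto simp: D_def primeideal.axioms(1))
      show "cring R" by (rule is_cring)
      obtain Q where "Q \<in> D" using D by blast
      moreover have "\<one> \<notin> Q"
        using \<open>Q \<in> D\<close> primeideal.I_notcarr[of Q R] ideal.one_imp_carrier[OF primeideal.axioms(1)]
        by (auto simp: D_def)
      ultimately show "carrier R \<noteq> \<Inter>D" using one_closed by blast
      fix a b assume ab: "a \<in> carrier R" "b \<in> carrier R" "a \<otimes> b \<in> \<Inter>D"
      have pr: "a \<in> Q \<or> b \<in> Q" if "Q \<in> D" for Q
        using that ab primeideal.I_prime[of Q R a b] by (auto simp: D_def)
      show "a \<in> \<Inter>D \<or> b \<in> \<Inter>D"
      proof (rule ccontr)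
        assume "\<not> ?thesis"
        \<comment> \<open>The smaller of these two comparable primes would contain neither
          factor.\<close>
        then obtain Q Q' where "Q \<in> D" "a \<notin> Q" "Q' \<in> D" "b \<notin> Q'" by blast
        then show False using total[of Q Q'] pr[of Q] pr[of Q'] by blast
      qed
    qed
    moreover have "\<Inter>D \<subseteq> P" using D unfolding D_def by blast
    moreover have "\<Union>C = carrier R - \<Inter>D"
    proof
      show "\<Union>C \<subseteq> carrier R - \<Inter>D" using CD by blast
      show "carrier R - \<Inter>D \<subseteq> \<Union>C" unfolding D_def by blast
    qed
    ultimately show "\<Union>C \<in> F" unfolding F_def by blast
  qed
  then obtain A where A: "A \<in> F" and max: "\<And>B. B \<in> F \<Longrightarrow> A \<subseteq> B \<Longrightarrow> B = A" by blast
  obtain Q where AQ: "A = carrier R - Q" and Q: "primeideal Q R" "Q \<subseteq> P"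
    using A unfolding F_def by blast
  have "Q' = Q" if Q': "primeideal Q' R" "Q' \<subseteq> Q" for Q'
  proof -
    have "Q' \<subseteq> P" using Q'(2) Q(2) by blast
    then have "carrier R - Q' \<in> F" unfolding F_def using Q'(1) by blast
    moreover have "A \<subseteq> carrier R - Q'" unfolding AQ using Q'(2) by blast
    ultimately have "carrier R - Q' = carrier R - Q" using max unfolding AQ by blast
    moreover have "Q \<subseteq> carrier R"
      using ideal.Icarr[OF primeideal.axioms(1)[OF Q(1)]] by blast
    ultimately show ?thesis using Q'(2) by blast
  qed
  then have "Q \<in> min_primes R" using Q(1) by (simp add: min_primes_def)
  then show thesis using that Q(2) by blast
qed

text \<open>If \<open>f\<close> lies in every maximal ideal then 1 - f lies in none and is a unit,
  and it annihilates \<open>f\<close>.\<close>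

lemma idempotent_in_maximalideals:
  assumes f: "idempotent_elem R f" and all: "\<And>M. maximalideal M R \<Longrightarrow> f \<in> M"
  shows "f = \<zero>"
proof -
  have fc: "f \<in> carrier R" "f \<otimes> f = f" using f by (auto simp: idempotent_elem_def)
  have "\<one> \<in> PIdl (\<one> \<ominus> f)"
  proof (rule ccontr)
    assume "\<one> \<notin> PIdl (\<one> \<ominus> f)"
    then obtain M where M: "maximalideal M R" "PIdl (\<one> \<ominus> f) \<subseteq> M"
      using exists_maximalideal[of "PIdl (\<one> \<ominus> f)"] cgenideal_ideal[of "\<one> \<ominus> f"] fc by auto
    interpret M: maximalideal M R by (rule M(1))
    have "(\<one> \<ominus> f) \<oplus> f \<in> M" using M(2) cgenideal_self[of "\<one> \<ominus> f"] fc all[OF M(1)] by auto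
    moreover have "(\<one> \<ominus> f) \<oplus> f = \<one>" using fc(1) by algebra
    ultimately show False using M.one_imp_carrier M.I_notcarr by simp
  qed
  then obtain r where r: "r \<in> carrier R" "\<one> = r \<otimes> (\<one> \<ominus> f)" by (auto simp: cgenideal_def)
  have "f = \<one> \<otimes> f" using fc by simp
  also have "\<dots> = r \<otimes> (\<one> \<ominus> f) \<otimes> f" using r(2) by simp
  also have "\<dots> = r \<otimes> (f \<ominus> f \<otimes> f)" using r(1) fc(1) by algebra
  also have "\<dots> = \<zero>" using r(1) fc by (simp add: minus_eq r_neg)
  finally show ?thesis .
qed

text \<open>As e (1 - e) = 0 is in \<open>p\<close>, one of the two complementary idempotents lies
  in \<open>p\<close>, hence in every maximal ideal, and so vanishes.\<close>

lemma connected_if_prime_in_maximalideals: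
  assumes p: "primeideal p R" "\<And>M. maximalideal M R \<Longrightarrow> p \<subseteq> M" and e: "idempotent_elem R e"
  shows "e = \<zero> \<or> e = \<one>"
proof -
  interpret p: primeideal p R by (rule p(1))
  have ec: "e \<in> carrier R" "e \<otimes> e = e" using e by (auto simp: idempotent_elem_def)
  have "e \<otimes> (\<one> \<ominus> e) = e \<ominus> e \<otimes> e" using ec(1) by algebra
  then have "e \<otimes> (\<one> \<ominus> e) \<in> p" using ec by (simp add: minus_eq r_neg)
  then have "e \<in> p \<or> \<one> \<ominus> e \<in> p" using p.I_prime ec by simp
  then show ?thesis
  proof
    assume "e \<in> p"
    then show ?thesis using idempotent_in_maximalideals[OF e] p(2) by blast
  next
    assume *: "\<one> \<ominus> e \<in> p"
    have "(\<one> \<ominus> e) \<otimes> (\<one> \<ominus> e) = \<one> \<ominus> e \<ominus> (e \<ominus> e \<otimes> e)" using ec(1) by algebra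
    then have "idempotent_elem R (\<one> \<ominus> e)" using ec by (simp add: idempotent_elem_def minus_eq r_neg)
    then have "\<one> \<ominus> e = \<zero>" using idempotent_in_maximalideals * p(2) by blast
    then show ?thesis using ec by simp
  qed
qed

end

section \<open>Properties common to the six types\<close>

lemma artinian_imp_isoartinian: "artinian R \<Longrightarrow> isoartinian R"
  unfolding artinian_def isoartinian_def by (metis ideals_isomorphic_refl)

text \<open>Multiplication by a generator identifies the whole ring with any nonzero ideal. So a
  chain either reaches zero and stays there or consists of copies of the ring.\<close>

lemma principal_domain_imp_isoartinian:
  assumes "principal_domain R" shows "isoartinian R"
  unfolding isoartinian_def
proof (intro allI impI)
  interpret principal_domain R by fact
  fix I assume I: "descending_ideal_chain R I"
  have iso: "ideals_isomorphic R (carrier R) J" if J: "ideal J R" "J \<noteq> {\<zero>\<^bsub>R\<^esub>}" for J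
  proof -
    obtain a where a: "a \<in> carrier R" "J = PIdl\<^bsub>R\<^esub> a" using exists_gen[OF J(1)] by blast
    have a0: "a \<noteq> \<zero>\<^bsub>R\<^esub>" using a J(2) by (auto simp: cgenideal_def intro: exI[of _ "\<zero>\<^bsub>R\<^esub>"])
    show ?thesis
    proof (rule ideals_isomorphicI[of "\<lambda>x. x \<otimes>\<^bsub>R\<^esub> a"])
      show "bij_betw (\<lambda>x. x \<otimes>\<^bsub>R\<^esub> a) (carrier R) J"
        using a a0 m_rcancel by (auto simp: bij_betw_def inj_on_def cgenideal_def)
    qed (use a in \<open>simp_all add: l_distr m_assoc\<close>)
  qed
  have Ii: "ideal (I n) R" for n using I by (simp add: descending_ideal_chain_def)
  show "\<exists>n. \<forall>i\<ge>n. ideals_isomorphic R (I n) (I i)"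
  proof (cases "\<exists>n. I n = {\<zero>\<^bsub>R\<^esub>}")
    case True
    then obtain n where n: "I n = {\<zero>\<^bsub>R\<^esub>}" by blast
    have "ideals_isomorphic R (I n) (I i)" if "i \<ge> n" for i
    proof -
      have "I i \<subseteq> {\<zero>\<^bsub>R\<^esub>}" using descending_ideal_chain_le[OF I that] n by simp
      moreover have "\<zero>\<^bsub>R\<^esub> \<in> I i" by (rule additive_subgroup.zero_closed[OF ideal.axioms(1)[OF Ii]])
      ultimately have "I i = I n" unfolding n by blast
      then show ?thesis by (simp add: ideals_isomorphic_refl)
    qed
    then show ?thesis by blast
  next
    case False
    then have "ideals_isomorphic R (I 0) (I i)" for i
      by (intro ideals_isomorphic_trans[OF ideals_isomorphic_sym[OF iso oneideal] iso] Ii) (use False in auto)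
    then show ?thesis by blast
  qed
qed

lemma listed_type_cring: "listed_type A \<Longrightarrow> cring A"
  using domain.axioms(1) principal_domain.axioms(1)
  by (auto simp: listed_type_def type_i_def type_ii_def type_iii_def type_iv_def type_v_def type_vi_def nonzero_cring_def)

lemma listed_type_isoartinian: "listed_type A \<Longrightarrow> isoartinian A"
  using artinian_imp_isoartinian principal_domain_imp_isoartinian
  by (auto simp: listed_type_def type_i_def type_ii_def type_iii_def type_iv_def type_v_def type_vi_def)

lemma listed_type_nonzero: "listed_type A \<Longrightarrow> \<one>\<^bsub>A\<^esub> \<noteq> \<zero>\<^bsub>A\<^esub>"
  using domain.one_not_zero principal_domain.axioms(1)
  by (auto simp: listed_type_def type_i_def type_ii_def type_iii_def type_iv_def type_v_def type_vi_def nonzero_cring_def)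

text \<open>The prime below all maximal ideals is the maximal ideal itself in types (i) and (ii),
  zero in type (iii), and the unique minimal prime in types (iv) to (vi), since every maximal ideal
  contains a minimal prime.\<close>

lemma listed_type_connected:
  assumes A: "listed_type A" and e: "idempotent_elem A e"
  shows "e = \<zero>\<^bsub>A\<^esub> \<or> e = \<one>\<^bsub>A\<^esub>"
proof -
  interpret cring A by (rule listed_type_cring[OF A])
  have "\<exists>p. primeideal p A \<and> (\<forall>M. maximalideal M A \<longrightarrow> p \<subseteq> M)"
  proof -
    consider "local_ring A" | "domain A" | p where "min_primes A = {p}"
      using A principal_domain.axioms(1)
      by (auto simp: listed_type_def type_i_def type_ii_def type_iii_def type_iv_def type_v_def type_vi_def)
    then show ?thesis
    proof cases
      case 1
      then obtain M where "maximalideal M A" "\<And>M'. maximalideal M' A \<Longrightarrow> M' = M"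
        by (auto simp: local_ring_def)
      then show ?thesis using maximalideal_prime by blast
    next
      case 2
      then show ?thesis
        using domain.zeroprimeideal additive_subgroup.zero_closed ideal.axioms(1) maximalideal.axioms(1) by blast
    next
      case 3
      then have "primeideal p A" unfolding min_primes_def by blast
      moreover have "p \<subseteq> M" if M: "maximalideal M A" for M
      proof -
        obtain Q where "Q \<in> min_primes A" "Q \<subseteq> M"
          using exists_min_prime[OF maximalideal_prime[OF M]] by blast
        then show ?thesis using 3 by simp
      qed
      ultimately show ?thesis by blast
    qed
  qed
  then obtain p where "primeideal p A" "\<And>M. maximalideal M A \<Longrightarrow> p \<subseteq> M" by blast
  then show ?thesis using e by (rule connected_if_prime_in_maximalideals)
qed

section \<open>Corner rings and decompositions\<close>

text \<open>For idempotent \<open>e\<close> this is the ring eR, membership being expressed by e x =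
  x. Keeping the operations of \<open>R\<close> lets ideals of the corner be read as ideals of
  \<open>R\<close>, and keeps the factors of a decomposition in the type of
  \<open>R\<close>.\<close>

definition corner :: "('a, 'm) ring_scheme \<Rightarrow> 'a \<Rightarrow> 'a ring" where
  "corner R e = \<lparr>carrier = {x \<in> carrier R. e \<otimes>\<^bsub>R\<^esub> x = x}, monoid.mult = monoid.mult R, one = e,
     ring.zero = \<zero>\<^bsub>R\<^esub>, add = add R\<rparr>"

lemma corner_simps [simp]:
  "carrier (corner R e) = {x \<in> carrier R. e \<otimes>\<^bsub>R\<^esub> x = x}"
  "x \<otimes>\<^bsub>corner R e\<^esub> y = x \<otimes>\<^bsub>R\<^esub> y"
  "x \<oplus>\<^bsub>corner R e\<^esub> y = x \<oplus>\<^bsub>R\<^esub> y"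
  "\<one>\<^bsub>corner R e\<^esub> = e"
  "\<zero>\<^bsub>corner R e\<^esub> = \<zero>\<^bsub>R\<^esub>"
  by (simp_all add: corner_def)

lemma RDirProd_simps:
  "(a, b) \<otimes>\<^bsub>RDirProd A B\<^esub> (c, d) = (a \<otimes>\<^bsub>A\<^esub> c, b \<otimes>\<^bsub>B\<^esub> d)"
  "(a, b) \<oplus>\<^bsub>RDirProd A B\<^esub> (c, d) = (a \<oplus>\<^bsub>A\<^esub> c, b \<oplus>\<^bsub>B\<^esub> d)"
  "\<one>\<^bsub>RDirProd A B\<^esub> = (\<one>\<^bsub>A\<^esub>, \<one>\<^bsub>B\<^esub>)"
  "\<zero>\<^bsub>RDirProd A B\<^esub> = (\<zero>\<^bsub>A\<^esub>, \<zero>\<^bsub>B\<^esub>)"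
  by (simp_all add: RDirProd_def DirProd_def monoid.defs)

lemma corner_cring:
  assumes "cring R" and e: "idempotent_elem R e"
  shows "cring (corner R e)"
proof -
  interpret cring R by fact
  have ec: "e \<in> carrier R" "e \<otimes>\<^bsub>R\<^esub> e = e" using e by (auto simp: idempotent_elem_def)
  show ?thesis
  proof (rule cringI)
    show "abelian_group (corner R e)"
    proof (rule abelian_groupI)
      fix x assume "x \<in> carrier (corner R e)"
      then show "\<exists>y\<in>carrier (corner R e). y \<oplus>\<^bsub>corner R e\<^esub> x = \<zero>\<^bsub>corner R e\<^esub>"
        using ec by (intro bexI[of _ "\<ominus>\<^bsub>R\<^esub> x"]) (auto simp: r_minus l_neg)
    qed (use ec in \<open>auto simp: a_ac r_distr\<close>)
    have "e \<otimes>\<^bsub>R\<^esub> (x \<otimes>\<^bsub>R\<^esub> y) = x \<otimes>\<^bsub>R\<^esub> y" if "x \<in> carrier R" "y \<in> carrier R" "e \<otimes>\<^bsub>R\<^esub> x = x" for x y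
      using m_assoc[OF ec(1) that(1,2)] that(3) by simp
    then show "comm_monoid (corner R e)"
      using ec by (intro comm_monoidI) (simp_all add: m_assoc, simp add: m_comm)
  qed (auto simp: l_distr)
qed

text \<open>For \<open>x\<close> in \<open>I\<close>, r x = r (e x) = (e r) x with e r in the
  corner, so \<open>I\<close> absorbs all of \<open>R\<close>.\<close>

lemma corner_ideal:
  assumes "cring R" and e: "idempotent_elem R e" and I: "ideal I (corner R e)"
  shows "ideal I R"
proof -
  interpret cring R by fact
  interpret I: ideal I "corner R e" by fact
  have ec: "e \<in> carrier R" "e \<otimes>\<^bsub>R\<^esub> e = e" using e by (auto simp: idempotent_elem_def)
  have c: "x \<in> carrier R" "e \<otimes>\<^bsub>R\<^esub> x = x" if "x \<in> I" for x using I.Icarr[OF that] by simp_all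
  have mult: "r \<otimes>\<^bsub>R\<^esub> x \<in> I" if x: "x \<in> I" and r: "r \<in> carrier R" for x r
  proof -
    have "(e \<otimes>\<^bsub>R\<^esub> r) \<otimes>\<^bsub>R\<^esub> x \<in> I"
      using I.I_l_closed[OF x, of "e \<otimes>\<^bsub>R\<^esub> r"] ec r by (simp add: m_assoc[symmetric])
    moreover have "(e \<otimes>\<^bsub>R\<^esub> r) \<otimes>\<^bsub>R\<^esub> x = r \<otimes>\<^bsub>R\<^esub> (e \<otimes>\<^bsub>R\<^esub> x)" using ec(1) c(1)[OF x] r by (simp add: m_ac)
    ultimately show ?thesis using c(2)[OF x] by simp
  qed
  show ?thesis
  proof (rule idealI[OF ring_axioms])
    show "subgroup I (add_monoid R)"
    proof (rule add.subgroupI)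
      show "I \<noteq> {}" using additive_subgroup.zero_closed[OF ideal.axioms(1)[OF I]] by blast
      fix x assume x: "x \<in> I"
      have "\<ominus>\<^bsub>R\<^esub> x = (\<ominus>\<^bsub>R\<^esub> \<one>\<^bsub>R\<^esub>) \<otimes>\<^bsub>R\<^esub> x" using c(1)[OF x] by (simp add: l_minus)
      then show "\<ominus>\<^bsub>R\<^esub> x \<in> I" using mult[OF x, of "\<ominus>\<^bsub>R\<^esub> \<one>\<^bsub>R\<^esub>"] by simp
    qed (use c additive_subgroup.a_closed[OF ideal.axioms(1)[OF I]] in auto)
    show "x \<otimes>\<^bsub>R\<^esub> a \<in> I" "a \<otimes>\<^bsub>R\<^esub> x \<in> I" if "a \<in> I" "x \<in> carrier R" for a x
      using mult[OF that] m_comm[OF c(1)[OF that(1)] that(2)] by simp_all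
  qed
qed

text \<open>Chains in the corner are chains in \<open>R\<close>, and an isomorphism linear over
  \<open>R\<close> is in particular linear over the corner.\<close>

lemma corner_isoartinian:
  assumes "cring R" and e: "idempotent_elem R e" and isoart: "isoartinian R"
  shows "isoartinian (corner R e)"
  unfolding isoartinian_def
proof (intro allI impI)
  fix I assume "descending_ideal_chain (corner R e) I"
  then have "descending_ideal_chain R I"
    using corner_ideal[OF assms(1) e] by (simp add: descending_ideal_chain_def)
  then obtain n where n: "\<And>i. i \<ge> n \<Longrightarrow> ideals_isomorphic R (I n) (I i)"
    using isoart unfolding isoartinian_def by blast
  have "ideals_isomorphic (corner R e) (I n) (I i)" if "i \<ge> n" for i
    using n[OF that] unfolding ideals_isomorphic_iff by auto
  then show "\<exists>n. \<forall>i\<ge>n. ideals_isomorphic (corner R e) (I n) (I i)" by blast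
qed

lemma corner_idempotent_iff:
  "idempotent_elem (corner R e) f \<longleftrightarrow> idempotent_elem R f \<and> e \<otimes>\<^bsub>R\<^esub> f = f"
  by (auto simp: idempotent_elem_def)

text \<open>Idempotents of the corner are the idempotents of \<open>R\<close> below
  \<open>e\<close>, so primitivity of \<open>e\<close> is connectedness of its corner.\<close>

lemma corner_primitive_listed_type:
  assumes "cring R" and e: "primitive_idempotent R e" and isoart: "isoartinian R"
  shows "listed_type (corner R e)"
proof (rule isoartinian_connected_listed_type)
  interpret cring R by fact
  have ie: "idempotent_elem R e" using e by (simp add: primitive_idempotent_def)
  show "nonzero_cring (corner R e)"
    using corner_cring[OF assms(1) ie] e by (simp add: nonzero_cring_def primitive_idempotent_def)
  show "isoartinian (corner R e)" by (rule corner_isoartinian[OF assms(1) ie isoart])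
  fix f assume f: "idempotent_elem (corner R e) f"
  then have "idempotent_elem R f" "f \<otimes>\<^bsub>R\<^esub> e = f"
    using ie m_comm[of e f] by (auto simp: corner_idempotent_iff idempotent_elem_def)
  then show "f = \<zero>\<^bsub>corner R e\<^esub> \<or> f = \<one>\<^bsub>corner R e\<^esub>" using e by (simp add: primitive_idempotent_def)
qed

context cring
begin

lemma corner_one_iso: "R \<simeq> corner R \<one>"
  unfolding is_ring_iso_def
proof -
  have "(\<lambda>x. x) \<in> ring_iso R (corner R \<one>)"
    by (rule ring_iso_memI) (auto simp: bij_betw_def)
  then show "ring_iso R (corner R \<one>) \<noteq> {}" by blast
qed

text \<open>The Peirce decomposition: each \<open>x\<close> in the corner of f + g equals f x + g x,
  and by orthogonality addition is the inverse map.\<close>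

lemma corner_sum_iso:
  assumes f: "idempotent_elem R f" and g: "idempotent_elem R g" and fg: "f \<otimes> g = \<zero>"
  shows "(\<lambda>x. (f \<otimes> x, g \<otimes> x)) \<in> ring_iso (corner R (f \<oplus> g)) (RDirProd (corner R f) (corner R g))"
proof -
  have c: "f \<in> carrier R" "f \<otimes> f = f" "g \<in> carrier R" "g \<otimes> g = g"
    using f g by (auto simp: idempotent_elem_def)
  have gf: "g \<otimes> f = \<zero>" using fg c by (simp add: m_comm)
  have abs: "f \<otimes> (f \<otimes> x) = f \<otimes> x" "g \<otimes> (g \<otimes> x) = g \<otimes> x" "f \<otimes> (g \<otimes> x) = \<zero>" "g \<otimes> (f \<otimes> x) = \<zero>"
    if "x \<in> carrier R" for x
    using that c fg gf by (simp_all add: m_assoc[symmetric])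
  have cross: "f \<otimes> y = \<zero>" if "y \<in> carrier R" "g \<otimes> y = y" for y
    using abs(3)[of y] that by simp
  have cross': "g \<otimes> x = \<zero>" if "x \<in> carrier R" "f \<otimes> x = x" for x
    using abs(4)[of x] that by simp
  have prod: "h \<otimes> (x \<otimes> y) = (h \<otimes> x) \<otimes> (h \<otimes> y)"
    if "x \<in> carrier R" "y \<in> carrier R" "h \<in> carrier R" "h \<otimes> h = h" for h x y
  proof -
    have "(h \<otimes> x) \<otimes> (h \<otimes> y) = (h \<otimes> h) \<otimes> (x \<otimes> y)" using that(1-3) by (simp add: m_ac)
    then show ?thesis using that(4) by simp
  qed
  show ?thesis
  proof (rule ring_iso_memI)
    fix x y assume x: "x \<in> carrier (corner R (f \<oplus> g))" and y: "y \<in> carrier (corner R (f \<oplus> g))"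
    show "(f \<otimes> x, g \<otimes> x) \<in> carrier (RDirProd (corner R f) (corner R g))"
      using x c abs by (auto simp: RDirProd_carrier)
    show "(f \<otimes> (x \<otimes>\<^bsub>corner R (f \<oplus> g)\<^esub> y), g \<otimes> (x \<otimes>\<^bsub>corner R (f \<oplus> g)\<^esub> y)) =
        (f \<otimes> x, g \<otimes> x) \<otimes>\<^bsub>RDirProd (corner R f) (corner R g)\<^esub> (f \<otimes> y, g \<otimes> y)"
      using x y c by (simp add: RDirProd_simps prod[symmetric])
    show "(f \<otimes> (x \<oplus>\<^bsub>corner R (f \<oplus> g)\<^esub> y), g \<otimes> (x \<oplus>\<^bsub>corner R (f \<oplus> g)\<^esub> y)) =
        (f \<otimes> x, g \<otimes> x) \<oplus>\<^bsub>RDirProd (corner R f) (corner R g)\<^esub> (f \<otimes> y, g \<otimes> y)"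
      using x y c by (simp add: RDirProd_simps r_distr)
  next
    show "(f \<otimes> \<one>\<^bsub>corner R (f \<oplus> g)\<^esub>, g \<otimes> \<one>\<^bsub>corner R (f \<oplus> g)\<^esub>) = \<one>\<^bsub>RDirProd (corner R f) (corner R g)\<^esub>"
      using c fg gf by (simp add: RDirProd_simps r_distr)
    show "bij_betw (\<lambda>x. (f \<otimes> x, g \<otimes> x)) (carrier (corner R (f \<oplus> g)))
        (carrier (RDirProd (corner R f) (corner R g)))"
      by (rule bij_betw_byWitness[where f' = "\<lambda>(x, y). x \<oplus> y"])
        (use c in \<open>auto simp: RDirProd_carrier l_distr r_distr abs cross cross'\<close>)
  qed
qed

text \<open>Choose \<open>f\<close> as in \<open>isoartinian_minimal_annihilator\<close>. A nonzero
  idempotent \<open>g\<close> below \<open>f\<close> then has the same annihilator; since 1 - g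
  kills \<open>g\<close> it kills \<open>f\<close>, so f = g f = g.\<close>

lemma isoartinian_exists_primitive_idempotent:
  assumes isoart: "isoartinian R" and e: "idempotent_elem R e" "e \<noteq> \<zero>"
  obtains f where "primitive_idempotent R f" "f \<otimes> e = f"
proof -
  define Y where "Y = {f. idempotent_elem R f \<and> f \<noteq> \<zero> \<and> f \<otimes> e = f}"
  have "e \<in> Y" using e by (auto simp: Y_def idempotent_elem_def)
  moreover have "Y \<subseteq> carrier R" by (auto simp: Y_def idempotent_elem_def)
  ultimately obtain f where f: "f \<in> Y"
    and min: "\<And>t. t \<in> carrier R \<Longrightarrow> t \<otimes> f \<in> Y \<Longrightarrow> annihilator R (t \<otimes> f) = annihilator R f"
    using isoartinian_minimal_annihilator[OF isoart, of Y] by blast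
  have ec: "e \<in> carrier R" and fc: "f \<in> carrier R" "f \<otimes> f = f" "f \<otimes> e = f" "f \<noteq> \<zero>"
    using e f by (auto simp: Y_def idempotent_elem_def)
  have "g = f" if g: "idempotent_elem R g" "g \<otimes> f = g" "g \<noteq> \<zero>" for g
  proof -
    have gc: "g \<in> carrier R" "g \<otimes> g = g" using g by (auto simp: idempotent_elem_def)
    have "g \<otimes> e = (g \<otimes> f) \<otimes> e" by (simp add: g(2))
    also have "\<dots> = g" unfolding m_assoc[OF gc(1) fc(1) ec] fc(3) by (rule g(2))
    finally have "g \<in> Y" using g by (simp add: Y_def)
    then have "annihilator R g = annihilator R f" using min[OF gc(1)] g(2) by simp
    moreover have "\<one> \<ominus> g \<in> annihilator R g"
      using gc by (simp add: annihilator_def minus_eq l_distr l_minus r_neg)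
    ultimately have "(\<one> \<ominus> g) \<otimes> f = \<zero>" by (simp add: annihilator_def)
    moreover have "(\<one> \<ominus> g) \<otimes> f = f \<ominus> g \<otimes> f" using gc(1) fc(1) by algebra
    ultimately show "g = f" using gc(1) fc(1) g(2) by simp
  qed
  then have "primitive_idempotent R f"
    using fc f unfolding primitive_idempotent_def Y_def by blast
  then show thesis using that fc(3) by blast
qed

text \<open>A counterexample \<open>d\<close>, chosen by minimality of annihilators, is nonzero, so
  a primitive \<open>f\<close> splits off. The remainder (1 - f) d is killed by \<open>f\<close>
  while \<open>d\<close> is not, so it is no counterexample; prepending the corner of
  \<open>f\<close> to its list serves \<open>d\<close>.\<close>

lemma isoartinian_corner_decomposition:
  assumes isoart: "isoartinian R" and e: "idempotent_elem R e"
  shows "\<exists>As :: 'a ring list. (\<forall>A\<in>set As. \<exists>f. primitive_idempotent R f \<and> A = corner R f) \<and>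
    corner R e \<simeq> RDirProd_list As"
proof (rule ccontr)
  define good where "good e \<longleftrightarrow> (\<exists>As :: 'a ring list.
    (\<forall>A\<in>set As. \<exists>f. primitive_idempotent R f \<and> A = corner R f) \<and> corner R e \<simeq> RDirProd_list As)" for e
  assume "\<not> ?thesis"
  then have "\<not> good e" by (simp add: good_def)
  define Y where "Y = {e. idempotent_elem R e \<and> \<not> good e}"
  have "e \<in> Y" using e \<open>\<not> good e\<close> by (simp add: Y_def)
  moreover have "Y \<subseteq> carrier R" by (auto simp: Y_def idempotent_elem_def)
  ultimately obtain d where d: "d \<in> Y"
    and min: "\<And>t. t \<in> carrier R \<Longrightarrow> t \<otimes> d \<in> Y \<Longrightarrow> annihilator R (t \<otimes> d) = annihilator R d"
    using isoartinian_minimal_annihilator[OF isoart, of Y] by blast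
  have dc: "d \<in> carrier R" "d \<otimes> d = d" "idempotent_elem R d" "\<not> good d"
    using d by (auto simp: Y_def idempotent_elem_def)
  \<comment> \<open>The corner at zero is the zero ring, which is the empty product.\<close>
  have "(\<lambda>_. []) \<in> ring_iso (corner R \<zero>) (RDirProd_list ([] :: 'a ring list))"
    by (rule ring_iso_memI) (auto simp: bij_betw_def inj_on_def monoid.defs)
  then have "good \<zero>" unfolding good_def is_ring_iso_def by (intro exI[of _ "[]"]) auto
  then have "d \<noteq> \<zero>" using dc by auto
  then obtain f where f: "primitive_idempotent R f" "f \<otimes> d = f"
    using isoartinian_exists_primitive_idempotent[OF isoart dc(3)] by blast
  have fc: "f \<in> carrier R" "f \<otimes> f = f" "idempotent_elem R f" "f \<noteq> \<zero>"
    using f by (auto simp: primitive_idempotent_def idempotent_elem_def)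
  define g where "g = d \<ominus> f"
  have gc: "g \<in> carrier R" using dc fc by (simp add: g_def)
  have df: "d \<otimes> f = f" using f dc fc by (simp add: m_comm)
  have "g \<otimes> g = d \<otimes> d \<ominus> f \<otimes> d \<ominus> (d \<otimes> f \<ominus> f \<otimes> f)"
    unfolding g_def using dc(1) fc(1) by algebra
  also have "\<dots> = g" unfolding g_def using dc fc f(2) df by (simp add: minus_eq r_neg)
  finally have gi: "idempotent_elem R g" using gc by (simp add: idempotent_elem_def)
  have "f \<otimes> g = f \<otimes> d \<ominus> f \<otimes> f" unfolding g_def using dc(1) fc(1) by algebra
  also have "\<dots> = \<zero>" using f(2) fc by (simp add: minus_eq r_neg)
  finally have fg: "f \<otimes> g = \<zero>" .
  have sum: "f \<oplus> g = d" unfolding g_def using dc(1) fc(1) by algebra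
  have "good g"
  proof (rule ccontr)
    assume "\<not> good g"
    then have "g \<in> Y" using gi by (simp add: Y_def)
    moreover have g_eq: "g = (\<one> \<ominus> f) \<otimes> d"
    proof -
      have "(\<one> \<ominus> f) \<otimes> d = d \<ominus> f \<otimes> d" using dc(1) fc(1) by algebra
      then show ?thesis using f(2) by (simp add: g_def)
    qed
    ultimately have "annihilator R g = annihilator R d" using min[of "\<one> \<ominus> f"] fc(1) by simp
    moreover have "f \<in> annihilator R g" using fg fc by (simp add: annihilator_def)
    ultimately have "f \<otimes> d = \<zero>" by (simp add: annihilator_def)
    then show False using f(2) fc(4) by simp
  qed
  then obtain As :: "'a ring list" where As: "\<forall>A\<in>set As. \<exists>f. primitive_idempotent R f \<and> A = corner R f"
    and iso: "corner R g \<simeq> RDirProd_list As" unfolding good_def by blast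
  obtain h where h: "h \<in> ring_iso (corner R g) (RDirProd_list As)"
    using iso unfolding is_ring_iso_def by blast
  have "corner R d \<simeq> RDirProd_list (corner R f # As)"
    using ring_iso_set_trans[OF ring_iso_set_trans[OF corner_sum_iso[OF fc(3) gi fg] RDirProd_iso5[OF h]] RDirProd_list_iso1]
    unfolding is_ring_iso_def sum by blast
  moreover have "\<forall>A\<in>set (corner R f # As). \<exists>f. primitive_idempotent R f \<and> A = corner R f"
    using As f(1) by auto
  ultimately show False using dc(4) unfolding good_def by blast
qed

end

section \<open>Direct products\<close>

lemma RDirProd_cring:
  assumes "cring A" "cring B" shows "cring (RDirProd A B)"
proof -
  interpret A: cring A by fact
  interpret B: cring B by fact
  interpret ring "RDirProd A B" by (rule RDirProd_ring[OF A.ring_axioms B.ring_axioms])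
  show ?thesis
    by unfold_locales (auto simp: RDirProd_carrier RDirProd_simps A.m_comm B.m_comm)
qed

text \<open>Multiplying by (1, 0) and (0, 1) keeps each coordinate of an element of \<open>I\<close>
  inside \<open>I\<close>, and adding the coordinates back gives the product form.\<close>

lemma RDirProd_ideal:
  assumes A: "cring A" and B: "cring B" and I: "ideal I (RDirProd A B)"
  shows "ideal (fst ` I) A" and "ideal (snd ` I) B" and "I = fst ` I \<times> snd ` I"
proof -
  interpret A: cring A by fact
  interpret B: cring B by fact
  note zero = additive_subgroup.zero_closed[OF ideal.axioms(1)[OF I]]
    and add = additive_subgroup.a_closed[OF ideal.axioms(1)[OF I]]
    and lcl = ideal.I_l_closed[OF I] and carr = ideal.Icarr[OF I]
  have c: "a \<in> carrier A" "b \<in> carrier B" if "(a, b) \<in> I" for a b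
    using carr[OF that] by (auto simp: RDirProd_carrier)
  have l: "(r \<otimes>\<^bsub>A\<^esub> a, s \<otimes>\<^bsub>B\<^esub> b) \<in> I" if "(a, b) \<in> I" "r \<in> carrier A" "s \<in> carrier B" for a b r s
    using lcl[OF that(1), of "(r, s)"] that by (simp add: RDirProd_carrier RDirProd_simps)
  have a1: "(a, \<zero>\<^bsub>B\<^esub>) \<in> I" if "(a, b) \<in> I" for a b
    using l[OF that A.one_closed B.zero_closed] c[OF that] by simp
  have b1: "(\<zero>\<^bsub>A\<^esub>, b) \<in> I" if "(a, b) \<in> I" for a b
    using l[OF that A.zero_closed B.one_closed] c[OF that] by simp
  have I1: "a \<in> fst ` I \<longleftrightarrow> (a, \<zero>\<^bsub>B\<^esub>) \<in> I" for a using a1 by force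
  have I2: "b \<in> snd ` I \<longleftrightarrow> (\<zero>\<^bsub>A\<^esub>, b) \<in> I" for b using b1 by force
  have pair: "(a, b) \<in> I" if "(a, \<zero>\<^bsub>B\<^esub>) \<in> I" "(\<zero>\<^bsub>A\<^esub>, b) \<in> I" for a b
    using add[OF that] c[OF that(1)] c[OF that(2)] by (simp add: RDirProd_simps)
  have "(a, b) \<in> I \<longleftrightarrow> a \<in> fst ` I \<and> b \<in> snd ` I" for a b
    unfolding I1 I2 using a1[of a b] b1[of a b] pair[of a b] by blast
  then show "I = fst ` I \<times> snd ` I" by (metis mem_Times_iff prod.collapse subsetI subset_antisym)
  show "ideal (fst ` I) A"
  proof (rule idealI[OF A.ring_axioms])
    have mult: "r \<otimes>\<^bsub>A\<^esub> a \<in> fst ` I" if "a \<in> fst ` I" "r \<in> carrier A" for a r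
      using l[of a "\<zero>\<^bsub>B\<^esub>" r "\<zero>\<^bsub>B\<^esub>"] that unfolding I1 by simp
    then show "r \<otimes>\<^bsub>A\<^esub> a \<in> fst ` I" "a \<otimes>\<^bsub>A\<^esub> r \<in> fst ` I" if "a \<in> fst ` I" "r \<in> carrier A" for a r
      using that mult[OF that] A.m_comm[of a r] c[of a "\<zero>\<^bsub>B\<^esub>"] unfolding I1 by simp_all
    show "subgroup (fst ` I) (add_monoid A)"
    proof (rule A.add.subgroupI)
      show "fst ` I \<subseteq> carrier A" using c by auto
      show "fst ` I \<noteq> {}" using zero by blast
      fix a assume a: "a \<in> fst ` I"
      then have "a \<in> carrier A" using c by auto
      then have "\<ominus>\<^bsub>A\<^esub> a = (\<ominus>\<^bsub>A\<^esub> \<one>\<^bsub>A\<^esub>) \<otimes>\<^bsub>A\<^esub> a" by (simp add: A.l_minus)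
      then show "\<ominus>\<^bsub>A\<^esub> a \<in> fst ` I" using mult[OF a, of "\<ominus>\<^bsub>A\<^esub> \<one>\<^bsub>A\<^esub>"] by simp
    next
      fix a b assume "a \<in> fst ` I" "b \<in> fst ` I"
      then show "a \<oplus>\<^bsub>A\<^esub> b \<in> fst ` I"
        using add[of "(a, \<zero>\<^bsub>B\<^esub>)" "(b, \<zero>\<^bsub>B\<^esub>)"] unfolding I1 by (simp add: RDirProd_simps)
    qed
  qed
  show "ideal (snd ` I) B"
  proof (rule idealI[OF B.ring_axioms])
    have mult: "r \<otimes>\<^bsub>B\<^esub> a \<in> snd ` I" if "a \<in> snd ` I" "r \<in> carrier B" for a r
      using l[of "\<zero>\<^bsub>A\<^esub>" a "\<zero>\<^bsub>A\<^esub>" r] that unfolding I2 by simp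
    then show "r \<otimes>\<^bsub>B\<^esub> a \<in> snd ` I" "a \<otimes>\<^bsub>B\<^esub> r \<in> snd ` I" if "a \<in> snd ` I" "r \<in> carrier B" for a r
      using that mult[OF that] B.m_comm[of a r] c[of "\<zero>\<^bsub>A\<^esub>" a] unfolding I2 by simp_all
    show "subgroup (snd ` I) (add_monoid B)"
    proof (rule B.add.subgroupI)
      show "snd ` I \<subseteq> carrier B" using c by auto
      show "snd ` I \<noteq> {}" using zero by blast
      fix a assume a: "a \<in> snd ` I"
      then have "a \<in> carrier B" using c by auto
      then have "\<ominus>\<^bsub>B\<^esub> a = (\<ominus>\<^bsub>B\<^esub> \<one>\<^bsub>B\<^esub>) \<otimes>\<^bsub>B\<^esub> a" by (simp add: B.l_minus)
      then show "\<ominus>\<^bsub>B\<^esub> a \<in> snd ` I" using mult[OF a, of "\<ominus>\<^bsub>B\<^esub> \<one>\<^bsub>B\<^esub>"] by simp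
    next
      fix a b assume "a \<in> snd ` I" "b \<in> snd ` I"
      then show "a \<oplus>\<^bsub>B\<^esub> b \<in> snd ` I"
        using add[of "(\<zero>\<^bsub>A\<^esub>, a)" "(\<zero>\<^bsub>A\<^esub>, b)"] unfolding I2 by (simp add: RDirProd_simps)
    qed
  qed
qed

text \<open>The two projected chains stabilise separately; from the larger index on, the
  isomorphisms of the projections combine coordinatewise.\<close>

lemma isoartinian_RDirProd:
  assumes A: "cring A" "isoartinian A" and B: "cring B" "isoartinian B"
  shows "isoartinian (RDirProd A B)"
  unfolding isoartinian_def
proof (intro allI impI)
  fix I assume chain: "descending_ideal_chain (RDirProd A B) I"
  have I: "ideal (I n) (RDirProd A B)" for n using chain by (simp add: descending_ideal_chain_def)
  note id = RDirProd_ideal[OF A(1) B(1) I]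
  have sub: "I (Suc n) \<subseteq> I n" for n using chain by (simp add: descending_ideal_chain_def)
  have "descending_ideal_chain A (\<lambda>n. fst ` I n)" "descending_ideal_chain B (\<lambda>n. snd ` I n)"
    unfolding descending_ideal_chain_def by (intro conjI allI id(1,2) image_mono[OF sub])+
  then obtain n1 n2 where n1: "\<And>i. i \<ge> n1 \<Longrightarrow> ideals_isomorphic A (fst ` I n1) (fst ` I i)"
    and n2: "\<And>i. i \<ge> n2 \<Longrightarrow> ideals_isomorphic B (snd ` I n2) (snd ` I i)"
    using A(2) B(2) unfolding isoartinian_def by meson
  define n where "n = max n1 n2"
  have "ideals_isomorphic (RDirProd A B) (I n) (I i)" if ni: "i \<ge> n" for i
  proof -
    have "ideals_isomorphic A (fst ` I n) (fst ` I i)"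
      by (rule ideals_isomorphic_trans[OF ideals_isomorphic_sym[OF n1[of n] id(1)] n1[of i]])
        (use ni in \<open>auto simp: n_def\<close>)
    then obtain f where f: "bij_betw f (fst ` I n) (fst ` I i)"
      "\<And>x y. x \<in> fst ` I n \<Longrightarrow> y \<in> fst ` I n \<Longrightarrow> f (x \<oplus>\<^bsub>A\<^esub> y) = f x \<oplus>\<^bsub>A\<^esub> f y"
      "\<And>r x. r \<in> carrier A \<Longrightarrow> x \<in> fst ` I n \<Longrightarrow> f (r \<otimes>\<^bsub>A\<^esub> x) = r \<otimes>\<^bsub>A\<^esub> f x"
      by (metis ideals_isomorphicE)
    have "ideals_isomorphic B (snd ` I n) (snd ` I i)"
      by (rule ideals_isomorphic_trans[OF ideals_isomorphic_sym[OF n2[of n] id(2)] n2[of i]])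
        (use ni in \<open>auto simp: n_def\<close>)
    then obtain g where g: "bij_betw g (snd ` I n) (snd ` I i)"
      "\<And>x y. x \<in> snd ` I n \<Longrightarrow> y \<in> snd ` I n \<Longrightarrow> g (x \<oplus>\<^bsub>B\<^esub> y) = g x \<oplus>\<^bsub>B\<^esub> g y"
      "\<And>r x. r \<in> carrier B \<Longrightarrow> x \<in> snd ` I n \<Longrightarrow> g (r \<otimes>\<^bsub>B\<^esub> x) = r \<otimes>\<^bsub>B\<^esub> g x"
      by (metis ideals_isomorphicE)
    have mem: "x \<in> fst ` I n \<and> y \<in> snd ` I n" if "(x, y) \<in> I n" for x y using that by force
    show ?thesis
    proof (rule ideals_isomorphicI[of "map_prod f g"])
      show "bij_betw (map_prod f g) (I n) (I i)"
        using bij_betw_map_prod[OF f(1) g(1)] id(3) by metis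
      show "map_prod f g (x \<oplus>\<^bsub>RDirProd A B\<^esub> y) = map_prod f g x \<oplus>\<^bsub>RDirProd A B\<^esub> map_prod f g y"
        if "x \<in> I n" "y \<in> I n" for x y
        using that mem by (cases x, cases y) (simp add: RDirProd_simps f g)
      show "map_prod f g (r \<otimes>\<^bsub>RDirProd A B\<^esub> x) = r \<otimes>\<^bsub>RDirProd A B\<^esub> map_prod f g x"
        if "r \<in> carrier (RDirProd A B)" "x \<in> I n" for r x
        using that mem by (cases r, cases x) (simp add: RDirProd_simps RDirProd_carrier f g)
    qed
  qed
  then show "\<exists>n. \<forall>i\<ge>n. ideals_isomorphic (RDirProd A B) (I n) (I i)" by blast
qed

section \<open>Finite products represented by lists\<close>

lemma RDirProd_list_nth:
  assumes "xs \<in> carrier (RDirProd_list As)" "ys \<in> carrier (RDirProd_list As)" "i < length As"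
  shows "(xs \<otimes>\<^bsub>RDirProd_list As\<^esub> ys) ! i = xs ! i \<otimes>\<^bsub>As ! i\<^esub> ys ! i"
    and "(xs \<oplus>\<^bsub>RDirProd_list As\<^esub> ys) ! i = xs ! i \<oplus>\<^bsub>As ! i\<^esub> ys ! i"
proof -
  have "(xs \<otimes>\<^bsub>RDirProd_list As\<^esub> ys) ! i = xs ! i \<otimes>\<^bsub>As ! i\<^esub> ys ! i \<and>
      (xs \<oplus>\<^bsub>RDirProd_list As\<^esub> ys) ! i = xs ! i \<oplus>\<^bsub>As ! i\<^esub> ys ! i"
    using assms
  proof (induction As arbitrary: xs ys i)
    case (Cons A As)
    obtain x xs' where xs: "xs = x # xs'" "x \<in> carrier A" "xs' \<in> carrier (RDirProd_list As)"
      using Cons.prems(1) unfolding RDirProd_list_carrier by auto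
    obtain y ys' where ys: "ys = y # ys'" "y \<in> carrier A" "ys' \<in> carrier (RDirProd_list As)"
      using Cons.prems(2) unfolding RDirProd_list_carrier by auto
    have "(x, xs') \<in> carrier (RDirProd A (RDirProd_list As))" "(y, ys') \<in> carrier (RDirProd A (RDirProd_list As))"
      using xs ys by (auto simp: RDirProd_carrier)
    from ring_hom_mult[OF RDirProd_list_hom1 this] ring_hom_add[OF RDirProd_list_hom1 this]
    have "xs \<otimes>\<^bsub>RDirProd_list (A # As)\<^esub> ys = (x \<otimes>\<^bsub>A\<^esub> y) # (xs' \<otimes>\<^bsub>RDirProd_list As\<^esub> ys')"
      "xs \<oplus>\<^bsub>RDirProd_list (A # As)\<^esub> ys = (x \<oplus>\<^bsub>A\<^esub> y) # (xs' \<oplus>\<^bsub>RDirProd_list As\<^esub> ys')"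
      by (simp_all add: xs(1) ys(1) RDirProd_simps)
    then show ?case
      using Cons.IH[OF xs(3) ys(3)] Cons.prems(3) by (cases i) (simp_all add: xs(1) ys(1))
  qed simp
  then show "(xs \<otimes>\<^bsub>RDirProd_list As\<^esub> ys) ! i = xs ! i \<otimes>\<^bsub>As ! i\<^esub> ys ! i"
    and "(xs \<oplus>\<^bsub>RDirProd_list As\<^esub> ys) ! i = xs ! i \<oplus>\<^bsub>As ! i\<^esub> ys ! i" by auto
qed

lemma RDirProd_list_one_zero_nth:
  assumes "i < length As"
  shows "\<one>\<^bsub>RDirProd_list As\<^esub> ! i = \<one>\<^bsub>As ! i\<^esub>" and "\<zero>\<^bsub>RDirProd_list As\<^esub> ! i = \<zero>\<^bsub>As ! i\<^esub>"
proof -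
  have "\<one>\<^bsub>RDirProd_list As\<^esub> ! i = \<one>\<^bsub>As ! i\<^esub> \<and> \<zero>\<^bsub>RDirProd_list As\<^esub> ! i = \<zero>\<^bsub>As ! i\<^esub>"
    using assms unfolding RDirProd_list_one RDirProd_list_zero
  proof (induction As arbitrary: i)
    case (Cons A As) then show ?case by (cases i) simp_all
  qed simp
  then show "\<one>\<^bsub>RDirProd_list As\<^esub> ! i = \<one>\<^bsub>As ! i\<^esub>" and "\<zero>\<^bsub>RDirProd_list As\<^esub> ! i = \<zero>\<^bsub>As ! i\<^esub>" by auto
qed

lemma RDirProd_list_eqI:
  assumes "xs \<in> carrier (RDirProd_list As)" "ys \<in> carrier (RDirProd_list As)"
    and "\<And>i. i < length As \<Longrightarrow> xs ! i = ys ! i"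
  shows "xs = ys"
  using assms RDirProd_list_carrier_mem(1) by (metis nth_equalityI)

lemma RDirProd_list_cring:
  assumes "\<And>A. A \<in> set As \<Longrightarrow> cring A" shows "cring (RDirProd_list As)"
proof -
  have r: "ring (As ! i)" "cring (As ! i)" if "i < length As" for i
    using assms[of "As ! i"] that cring.axioms(1) by auto
  interpret ring "RDirProd_list As" by (rule RDirProd_list_is_ring[OF r(1)])
  show ?thesis
  proof unfold_locales
    fix x y assume xy: "x \<in> carrier (RDirProd_list As)" "y \<in> carrier (RDirProd_list As)"
    show "x \<otimes>\<^bsub>RDirProd_list As\<^esub> y = y \<otimes>\<^bsub>RDirProd_list As\<^esub> x"
    proof (rule RDirProd_list_eqI)
      fix i assume i: "i < length As"
      show "(x \<otimes>\<^bsub>RDirProd_list As\<^esub> y) ! i = (y \<otimes>\<^bsub>RDirProd_list As\<^esub> x) ! i"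
        unfolding RDirProd_list_nth(1)[OF xy i] RDirProd_list_nth(1)[OF xy(2,1) i]
        by (rule cring.cring_simprules(14)[OF r(2)[OF i]]) (use xy i RDirProd_list_carrier_mem(2) in blast)+
    qed (use xy in auto)
  qed
qed

lemma isoartinian_RDirProd_list:
  assumes "\<And>A. A \<in> set As \<Longrightarrow> cring A \<and> isoartinian A" shows "isoartinian (RDirProd_list As)"
  using assms
proof (induction As)
  case Nil
  have "I = {[]}" if "ideal I (RDirProd_list [])" for I :: "'a list set"
    using additive_subgroup.zero_closed[OF ideal.axioms(1)[OF that]] ideal.Icarr[OF that] by (auto simp: monoid.defs)
  then have "ideals_isomorphic (RDirProd_list []) I J"
    if "ideal I (RDirProd_list [])" "ideal J (RDirProd_list [])" for I J :: "'a list set"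
    using that ideals_isomorphic_refl by metis
  then show ?case unfolding isoartinian_def descending_ideal_chain_def by blast
next
  case (Cons A As)
  have As: "cring (RDirProd_list As)" and AAs: "cring (RDirProd_list (A # As))"
    using Cons.prems by (auto intro!: RDirProd_list_cring)
  have "isoartinian (RDirProd A (RDirProd_list As))"
    using Cons As by (intro isoartinian_RDirProd) auto
  then show ?case
    using isoartinian_ring_iso[OF RDirProd_list_iso1] RDirProd_cring[of A, OF _ As] Cons.prems cring.axioms(1)[OF AAs]
    by simp
qed

section \<open>Uniqueness\<close>

lemma ring_iso_idempotent:
  assumes h: "h \<in> ring_iso P Q" and e: "idempotent_elem P e"
  shows "idempotent_elem Q (h e)"
proof -
  have "e \<in> carrier P" "e \<otimes>\<^bsub>P\<^esub> e = e" using e by (auto simp: idempotent_elem_def)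
  then show ?thesis
    using ring_iso_memE(1,2)[OF h] by (metis idempotent_elem_def)
qed

lemma ring_iso_zero:
  assumes "ring P" "ring Q" "h \<in> ring_iso P Q"
  shows "h \<zero>\<^bsub>P\<^esub> = \<zero>\<^bsub>Q\<^esub>"
  using assms ring_hom_zero[of h P Q] by (simp add: ring_iso_def)

lemma ring_iso_primitive_idempotent:
  assumes P: "ring P" and Q: "ring Q" and h: "h \<in> ring_iso P Q" and e: "primitive_idempotent P e"
  shows "primitive_idempotent Q (h e)"
proof -
  let ?g = "inv_into (carrier P) h"
  have g: "?g \<in> ring_iso Q P" by (rule ring_iso_set_sym[OF P h])
  have bij: "bij_betw h (carrier P) (carrier Q)" using h by (simp add: ring_iso_def)
  have ei: "idempotent_elem P e" and ec: "e \<in> carrier P" and e0: "e \<noteq> \<zero>\<^bsub>P\<^esub>"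
    and prim: "\<And>f. idempotent_elem P f \<Longrightarrow> f \<otimes>\<^bsub>P\<^esub> e = f \<Longrightarrow> f = \<zero>\<^bsub>P\<^esub> \<or> f = e"
    using e by (auto simp: primitive_idempotent_def idempotent_elem_def)
  have gh: "?g (h x) = x" if "x \<in> carrier P" for x using bij that by (simp add: bij_betw_def)
  have hg: "h (?g y) = y" if "y \<in> carrier Q" for y using bij that by (simp add: bij_betw_inv_into_right)
  have "h e \<noteq> \<zero>\<^bsub>Q\<^esub>" using gh[OF ec] ring_iso_zero[OF Q P g] e0 by auto
  moreover have "f = \<zero>\<^bsub>Q\<^esub> \<or> f = h e" if f: "idempotent_elem Q f" "f \<otimes>\<^bsub>Q\<^esub> h e = f" for f
  proof -
    have fc: "f \<in> carrier Q" using f(1) by (simp add: idempotent_elem_def)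
    have "?g f = ?g f \<otimes>\<^bsub>P\<^esub> e"
      using ring_iso_memE(2)[OF g fc, of "h e"] ring_iso_memE(1)[OF h ec] gh[OF ec] f(2) by simp
    then have "?g f = \<zero>\<^bsub>P\<^esub> \<or> ?g f = e" using prim ring_iso_idempotent[OF g f(1)] by metis
    then show ?thesis using hg[OF fc] ring_iso_zero[OF P Q h] by metis
  qed
  ultimately show ?thesis
    using ring_iso_idempotent[OF h ei] unfolding primitive_idempotent_def by blast
qed

lemma ring_iso_primitive_idempotents_bij:
  assumes P: "ring P" and Q: "ring Q" and h: "h \<in> ring_iso P Q"
  shows "bij_betw h {e. primitive_idempotent P e} {e. primitive_idempotent Q e}"
proof (rule bij_betw_byWitness[where f' = "inv_into (carrier P) h"])
  let ?g = "inv_into (carrier P) h"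
  have g: "?g \<in> ring_iso Q P" by (rule ring_iso_set_sym[OF P h])
  have bij: "bij_betw h (carrier P) (carrier Q)" using h by (simp add: ring_iso_def)
  show "\<forall>e\<in>{e. primitive_idempotent P e}. ?g (h e) = e"
    using bij by (auto simp: bij_betw_def primitive_idempotent_def idempotent_elem_def)
  show "\<forall>e\<in>{e. primitive_idempotent Q e}. h (?g e) = e"
    using bij by (auto simp: bij_betw_inv_into_right primitive_idempotent_def idempotent_elem_def)
  show "h ` {e. primitive_idempotent P e} \<subseteq> {e. primitive_idempotent Q e}"
    using ring_iso_primitive_idempotent[OF P Q h] by blast
  show "?g ` {e. primitive_idempotent Q e} \<subseteq> {e. primitive_idempotent P e}"
    using ring_iso_primitive_idempotent[OF Q P g] by blast
qed

lemma ring_iso_corner: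
  assumes "ring P" and h: "h \<in> ring_iso P Q" and e: "idempotent_elem P e"
  shows "corner P e \<simeq> corner Q (h e)"
proof -
  interpret P: ring P by fact
  have ec: "e \<in> carrier P" "e \<otimes>\<^bsub>P\<^esub> e = e" using e by (auto simp: idempotent_elem_def)
  note hm = ring_iso_memE[OF h]
  have inj: "x = y" if "h x = h y" "x \<in> carrier P" "y \<in> carrier P" for x y
    using hm(5) that by (auto simp: bij_betw_def inj_on_def)
  have "h \<in> ring_iso (corner P e) (corner Q (h e))"
  proof (rule ring_iso_memI)
    show "h x \<in> carrier (corner Q (h e))" if "x \<in> carrier (corner P e)" for x
      using that hm(1) hm(2)[OF ec(1), of x] by simp
    show "bij_betw h (carrier (corner P e)) (carrier (corner Q (h e)))"
    proof (rule bij_betwI')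
      show "h x = h y \<longleftrightarrow> x = y" if "x \<in> carrier (corner P e)" "y \<in> carrier (corner P e)" for x y
        using inj that by auto
      show "h x \<in> carrier (corner Q (h e))" if "x \<in> carrier (corner P e)" for x
        using that hm(1) hm(2)[OF ec(1), of x] by simp
      fix y assume y: "y \<in> carrier (corner Q (h e))"
      then obtain x where x: "x \<in> carrier P" "y = h x" using hm(5) by (auto simp: bij_betw_def)
      then have "h (e \<otimes>\<^bsub>P\<^esub> x) = h x" using y hm(2)[OF ec(1) x(1)] by simp
      then have "e \<otimes>\<^bsub>P\<^esub> x = x" using inj x(1) ec(1) by simp
      then show "\<exists>x\<in>carrier (corner P e). y = h x" using x by auto
    qed
  qed (use hm(2,3) in auto)
  then show ?thesis unfolding is_ring_iso_def by blast
qed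

section \<open>Primitive idempotents of a product of connected rings\<close>

definition unit_vector :: "('a, 'm) ring_scheme list \<Rightarrow> nat \<Rightarrow> 'a list" where
  "unit_vector As i = map (\<lambda>j. if j = i then \<one>\<^bsub>As ! j\<^esub> else \<zero>\<^bsub>As ! j\<^esub>) [0..<length As]"

lemma unit_vector_nth:
  "j < length As \<Longrightarrow> unit_vector As i ! j = (if j = i then \<one>\<^bsub>As ! j\<^esub> else \<zero>\<^bsub>As ! j\<^esub>)"
  by (simp add: unit_vector_def)

context
  fixes As :: "('a, 'm) ring_scheme list"
  assumes cring: "\<And>A. A \<in> set As \<Longrightarrow> cring A"
    and nonzero: "\<And>A. A \<in> set As \<Longrightarrow> \<one>\<^bsub>A\<^esub> \<noteq> \<zero>\<^bsub>A\<^esub>"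
    and connected: "\<And>A e. A \<in> set As \<Longrightarrow> idempotent_elem A e \<Longrightarrow> e = \<zero>\<^bsub>A\<^esub> \<or> e = \<one>\<^bsub>A\<^esub>"
begin

private lemma nth_cring: "i < length As \<Longrightarrow> cring (As ! i)"
  using cring by simp

private lemma nth_carrier: "xs \<in> carrier (RDirProd_list As) \<Longrightarrow> i < length As \<Longrightarrow> xs ! i \<in> carrier (As ! i)"
  by (rule RDirProd_list_carrier_mem(2))

private lemma nth_ring_simps:
  assumes "i < length As" "x \<in> carrier (As ! i)"
  shows "\<one>\<^bsub>As ! i\<^esub> \<otimes>\<^bsub>As ! i\<^esub> x = x" "\<zero>\<^bsub>As ! i\<^esub> \<otimes>\<^bsub>As ! i\<^esub> x = \<zero>\<^bsub>As ! i\<^esub>"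
proof -
  interpret cring "As ! i" by (rule nth_cring[OF assms(1)])
  show "\<one>\<^bsub>As ! i\<^esub> \<otimes>\<^bsub>As ! i\<^esub> x = x" "\<zero>\<^bsub>As ! i\<^esub> \<otimes>\<^bsub>As ! i\<^esub> x = \<zero>\<^bsub>As ! i\<^esub>" using assms(2) by simp_all
qed

private lemma nth_one_zero_closed:
  assumes "i < length As" shows "\<one>\<^bsub>As ! i\<^esub> \<in> carrier (As ! i)" "\<zero>\<^bsub>As ! i\<^esub> \<in> carrier (As ! i)"
proof -
  interpret cring "As ! i" by (rule nth_cring[OF assms(1)])
  show "\<one>\<^bsub>As ! i\<^esub> \<in> carrier (As ! i)" "\<zero>\<^bsub>As ! i\<^esub> \<in> carrier (As ! i)" by simp_all
qed

private lemma prod_cring: "cring (RDirProd_list As)"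
  by (rule RDirProd_list_cring[OF cring])

private lemma mult_closed:
  "xs \<in> carrier (RDirProd_list As) \<Longrightarrow> ys \<in> carrier (RDirProd_list As) \<Longrightarrow>
    xs \<otimes>\<^bsub>RDirProd_list As\<^esub> ys \<in> carrier (RDirProd_list As)"
  using ring.ring_simprules(5)[OF cring.axioms(1)[OF prod_cring]] .

private lemma zero_closed: "\<zero>\<^bsub>RDirProd_list As\<^esub> \<in> carrier (RDirProd_list As)"
  using ring.ring_simprules(2)[OF cring.axioms(1)[OF prod_cring]] .

text \<open>No bound on \<open>i\<close> is imposed: beyond the length of the list the vector is the
  zero element.\<close>

private lemma unit_vector_closed: "unit_vector As i \<in> carrier (RDirProd_list As)"
  by (rule RDirProd_list_carrier_memI) (auto simp: unit_vector_def nth_one_zero_closed)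

private lemma unit_vector_mult_nth:
  assumes "xs \<in> carrier (RDirProd_list As)" "j < length As"
  shows "(unit_vector As i \<otimes>\<^bsub>RDirProd_list As\<^esub> xs) ! j = (if j = i then xs ! j else \<zero>\<^bsub>As ! j\<^esub>)"
  unfolding RDirProd_list_nth(1)[OF unit_vector_closed assms] unit_vector_nth[OF assms(2)]
  using nth_ring_simps[OF assms(2) nth_carrier[OF assms]] by (cases "j = i") simp_all

private lemma idempotent_nth:
  assumes e: "idempotent_elem (RDirProd_list As) e" and i: "i < length As"
  shows "e ! i = \<zero>\<^bsub>As ! i\<^esub> \<or> e ! i = \<one>\<^bsub>As ! i\<^esub>"
proof -
  have ec: "e \<in> carrier (RDirProd_list As)" "e \<otimes>\<^bsub>RDirProd_list As\<^esub> e = e"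
    using e by (auto simp: idempotent_elem_def)
  have "idempotent_elem (As ! i) (e ! i)"
    using RDirProd_list_nth(1)[OF ec(1) ec(1) i] ec nth_carrier[OF ec(1) i] by (simp add: idempotent_elem_def)
  then show ?thesis using connected i by simp
qed

private lemma unit_vector_idempotent: "idempotent_elem (RDirProd_list As) (unit_vector As i)"
  unfolding idempotent_elem_def
  by (intro conjI unit_vector_closed RDirProd_list_eqI[OF mult_closed unit_vector_closed])
    (auto simp: unit_vector_mult_nth unit_vector_closed unit_vector_nth)

text \<open>An idempotent below the i-th unit vector vanishes off position \<open>i\<close>, and at
  \<open>i\<close> connectedness leaves only 0 and 1.\<close>

private lemma unit_vector_primitive:
  assumes i: "i < length As"
  shows "primitive_idempotent (RDirProd_list As) (unit_vector As i)"
proof -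
  have "unit_vector As i ! i \<noteq> \<zero>\<^bsub>RDirProd_list As\<^esub> ! i"
    using i nonzero[of "As ! i"] by (simp add: unit_vector_nth RDirProd_list_one_zero_nth)
  then have "unit_vector As i \<noteq> \<zero>\<^bsub>RDirProd_list As\<^esub>" by metis
  moreover have "f = \<zero>\<^bsub>RDirProd_list As\<^esub> \<or> f = unit_vector As i"
    if f: "idempotent_elem (RDirProd_list As) f" "f \<otimes>\<^bsub>RDirProd_list As\<^esub> unit_vector As i = f" for f
  proof -
    have fc: "f \<in> carrier (RDirProd_list As)" using f(1) by (simp add: idempotent_elem_def)
    have "unit_vector As i \<otimes>\<^bsub>RDirProd_list As\<^esub> f = f"
      using f(2) cring.cring_simprules(14)[OF prod_cring fc unit_vector_closed] by simp
    then have off: "f ! j = \<zero>\<^bsub>As ! j\<^esub>" if "j < length As" "j \<noteq> i" for j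
      using unit_vector_mult_nth[OF fc that(1), of i] that(2) by simp
    from idempotent_nth[OF f(1) i] show ?thesis
    proof
      assume "f ! i = \<zero>\<^bsub>As ! i\<^esub>"
      then have "f = \<zero>\<^bsub>RDirProd_list As\<^esub>"
        using off by (intro RDirProd_list_eqI[OF fc zero_closed]) (metis RDirProd_list_one_zero_nth(2))
      then show ?thesis ..
    next
      assume "f ! i = \<one>\<^bsub>As ! i\<^esub>"
      then have "f = unit_vector As i"
        using off by (intro RDirProd_list_eqI[OF fc unit_vector_closed]) (simp add: unit_vector_nth)
      then show ?thesis ..
    qed
  qed
  ultimately show ?thesis using unit_vector_idempotent unfolding primitive_idempotent_def by blast
qed

text \<open>A nonzero idempotent has some nonzero component, which equals 1 by connectedness. The
  unit vector at that position then lies below it, and primitivity makes the two equal.\<close>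

private lemma primitive_imp_unit_vector:
  assumes e: "primitive_idempotent (RDirProd_list As) e"
  shows "\<exists>i<length As. e = unit_vector As i"
proof -
  have ei: "idempotent_elem (RDirProd_list As) e" and e0: "e \<noteq> \<zero>\<^bsub>RDirProd_list As\<^esub>"
    and ec: "e \<in> carrier (RDirProd_list As)"
    using e by (auto simp: primitive_idempotent_def idempotent_elem_def)
  obtain i where i: "i < length As" "e ! i \<noteq> \<zero>\<^bsub>As ! i\<^esub>"
    using RDirProd_list_eqI[OF ec zero_closed] e0 RDirProd_list_one_zero_nth(2) by metis
  then have e1: "e ! i = \<one>\<^bsub>As ! i\<^esub>" using idempotent_nth[OF ei] by blast
  have "unit_vector As i = unit_vector As i \<otimes>\<^bsub>RDirProd_list As\<^esub> e"
    by (rule RDirProd_list_eqI[OF unit_vector_closed mult_closed[OF unit_vector_closed ec]])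
      (simp add: unit_vector_mult_nth[OF ec] unit_vector_nth e1)
  then have "unit_vector As i = \<zero>\<^bsub>RDirProd_list As\<^esub> \<or> unit_vector As i = e"
    using e unit_vector_idempotent[of i] unfolding primitive_idempotent_def by metis
  then show ?thesis using unit_vector_primitive[OF i(1)] i(1) unfolding primitive_idempotent_def by metis
qed

lemma unit_vector_bij:
  "bij_betw (unit_vector As) {..<length As} {e. primitive_idempotent (RDirProd_list As) e}"
proof (rule bij_betwI')
  fix i j assume ij: "i \<in> {..<length As}" "j \<in> {..<length As}"
  show "unit_vector As i = unit_vector As j \<longleftrightarrow> i = j"
  proof
    assume "unit_vector As i = unit_vector As j"
    then have "unit_vector As i ! i = unit_vector As j ! i" by simp
    then show "i = j" using ij nonzero[of "As ! i"] by (auto simp: unit_vector_nth split: if_splits)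
  qed simp
qed (use unit_vector_primitive primitive_imp_unit_vector in auto)

text \<open>Elements of this corner vanish off position \<open>i\<close>, so evaluation at
  \<open>i\<close> is injective on it.\<close>

lemma corner_unit_vector:
  assumes i: "i < length As"
  shows "corner (RDirProd_list As) (unit_vector As i) \<simeq> As ! i"
proof -
  let ?P = "RDirProd_list As" and ?u = "unit_vector As i"
  have off: "xs ! j = \<zero>\<^bsub>As ! j\<^esub>"
    if "xs \<in> carrier (corner ?P ?u)" "j < length As" "j \<noteq> i" for xs j
    using that unit_vector_mult_nth[of xs j i] by auto
  have "(\<lambda>xs. xs ! i) \<in> ring_iso (corner ?P ?u) (As ! i)"
  proof (rule ring_iso_memI)
    show "bij_betw (\<lambda>xs. xs ! i) (carrier (corner ?P ?u)) (carrier (As ! i))"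
    proof (rule bij_betwI')
      fix xs ys assume xy: "xs \<in> carrier (corner ?P ?u)" "ys \<in> carrier (corner ?P ?u)"
      show "xs ! i = ys ! i \<longleftrightarrow> xs = ys"
      proof
        assume eq: "xs ! i = ys ! i"
        show "xs = ys"
        proof (rule RDirProd_list_eqI)
          fix j assume "j < length As"
          then show "xs ! j = ys ! j" using off[OF xy(1)] off[OF xy(2)] eq by (cases "j = i") auto
        qed (use xy in auto)
      qed simp
    next
      fix a assume a: "a \<in> carrier (As ! i)"
      define xs where "xs = map (\<lambda>j. if j = i then a else \<zero>\<^bsub>As ! j\<^esub>) [0..<length As]"
      have nth: "xs ! j = (if j = i then a else \<zero>\<^bsub>As ! j\<^esub>)" if "j < length As" for j
        using that by (simp add: xs_def)
      have c: "xs \<in> carrier ?P"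
        by (rule RDirProd_list_carrier_memI) (use a in \<open>auto simp: xs_def nth_one_zero_closed\<close>)
      have "?u \<otimes>\<^bsub>?P\<^esub> xs = xs"
        by (rule RDirProd_list_eqI[OF mult_closed[OF unit_vector_closed c] c])
          (simp add: unit_vector_mult_nth[OF c] nth)
      then show "\<exists>xs\<in>carrier (corner ?P ?u). a = xs ! i" using c nth[OF i] by (intro bexI[of _ xs]) auto
    qed (use nth_carrier i in auto)
  qed (use i nth_carrier in \<open>auto simp: RDirProd_list_nth unit_vector_nth\<close>)
  then show ?thesis unfolding is_ring_iso_def by blast
qed

end

section \<open>The characterisation and the uniqueness of the factors\<close>

lemma decomposition_cring:
  assumes "decomposition R As" and "A \<in> set As" shows "cring A"
  using assms listed_type_cring[of A] unfolding decomposition_iff by blast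

lemma decomposition_imp_isoartinian:
  assumes R: "ring R" and dec: "decomposition R As"
  shows "isoartinian R"
proof -
  have P: "cring (RDirProd_list As)" by (rule RDirProd_list_cring) (rule decomposition_cring[OF dec])
  have "isoartinian A" if "A \<in> set As" for A
    using dec that listed_type_isoartinian[of A] unfolding decomposition_iff by blast
  then have "isoartinian (RDirProd_list As)"
    using decomposition_cring[OF dec] by (intro isoartinian_RDirProd_list) blast
  moreover obtain h where "h \<in> ring_iso (RDirProd_list As) R"
    using ring_iso_sym[OF R] dec unfolding decomposition_iff is_ring_iso_def by blast
  ultimately show ?thesis using isoartinian_ring_iso P R by blast
qed

lemma isoartinian_imp_decomposition:
  fixes R :: "('a, 'm) ring_scheme"
  assumes R: "cring R" and isoart: "isoartinian R"
  shows "\<exists>As :: 'a ring list. decomposition R As"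
proof -
  interpret cring R by fact
  have "idempotent_elem R \<one>\<^bsub>R\<^esub>" by (simp add: idempotent_elem_def)
  then obtain As :: "'a ring list" where
    As: "\<forall>A\<in>set As. \<exists>f. primitive_idempotent R f \<and> A = corner R f" and
    iso: "corner R \<one>\<^bsub>R\<^esub> \<simeq> RDirProd_list As"
    using isoartinian_corner_decomposition[OF isoart] by blast
  have "listed_type A" if A: "A \<in> set As" for A
  proof -
    obtain f where f: "primitive_idempotent R f" "A = corner R f" using bspec[OF As A] by blast
    then show ?thesis using corner_primitive_listed_type[OF R f(1) isoart] by simp
  qed
  then have "decomposition R As"
    unfolding decomposition_iff using ring_iso_trans[OF corner_one_iso iso] by blast
  then show ?thesis ..
qed

text \<open>In both products the primitive idempotents are exactly the unit vectors, and
  \<open>h\<close> matches them up. Corners at matching idempotents are isomorphic, and each corner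
  is isomorphic to the corresponding factor.\<close>

lemma decomposition_unique:
  fixes As :: "('b, 'n) ring_scheme list" and Bs :: "('c, 'k) ring_scheme list"
  assumes R: "ring R" and A: "decomposition R As" and B: "decomposition R Bs"
  shows "length As = length Bs \<and>
    (\<exists>\<sigma>. \<sigma> permutes {..<length As} \<and> (\<forall>i<length As. As ! i \<simeq> Bs ! \<sigma> i))"
proof -
  let ?P = "RDirProd_list As" and ?Q = "RDirProd_list Bs"
  let ?u = "unit_vector As" and ?v = "unit_vector Bs"
  have listedA: "\<And>A. A \<in> set As \<Longrightarrow> listed_type A" and listedB: "\<And>A. A \<in> set Bs \<Longrightarrow> listed_type A"
    using A B unfolding decomposition_iff by blast+
  note facA = listed_type_cring[OF listedA] listed_type_nonzero[OF listedA] listed_type_connected[OF listedA]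
  note facB = listed_type_cring[OF listedB] listed_type_nonzero[OF listedB] listed_type_connected[OF listedB]
  have P: "cring ?P" and Q: "cring ?Q" by (rule RDirProd_list_cring, rule facA facB, assumption)+
  have rP: "ring ?P" and rQ: "ring ?Q" using P Q cring.axioms(1) by auto
  have "?P \<simeq> ?Q"
    using ring_iso_trans[OF ring_iso_sym[OF R]] A B unfolding decomposition_iff by blast
  then obtain h where h: "h \<in> ring_iso ?P ?Q" unfolding is_ring_iso_def by blast
  have u: "bij_betw ?u {..<length As} {e. primitive_idempotent ?P e}"
    by (rule unit_vector_bij) (use facA in auto)
  have v: "bij_betw ?v {..<length Bs} {e. primitive_idempotent ?Q e}"
    by (rule unit_vector_bij) (use facB in auto)
  let ?w = "inv_into {..<length Bs} ?v"
  \<comment> \<open>\<open>\<tau>\<close> sends \<open>i\<close> to the index whose unit vector is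
    the image under \<open>h\<close> of the i-th unit vector.\<close>
  define \<tau> where "\<tau> = ?w \<circ> (h \<circ> ?u)"
  have hu: "bij_betw (h \<circ> ?u) {..<length As} {e. primitive_idempotent ?Q e}"
    by (rule bij_betw_trans[OF u ring_iso_primitive_idempotents_bij[OF rP rQ h]])
  have \<tau>: "bij_betw \<tau> {..<length As} {..<length Bs}"
    unfolding \<tau>_def by (rule bij_betw_trans[OF hu bij_betw_inv_into[OF v]])
  then have len: "length As = length Bs" using bij_betw_same_card by fastforce
  \<comment> \<open>\<open>permutes\<close> demands the identity outside the index set, so
    \<open>\<tau>\<close> is extended by it.\<close>
  define \<sigma> where "\<sigma> i = (if i < length As then \<tau> i else i)" for i
  have "bij_betw \<sigma> {..<length As} {..<length As}"
    using \<tau> len by (subst bij_betw_cong[of _ _ \<tau>]) (auto simp: \<sigma>_def)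
  then have "\<sigma> permutes {..<length As}" by (rule bij_imp_permutes) (auto simp: \<sigma>_def)
  moreover have "As ! i \<simeq> Bs ! \<sigma> i" if i: "i < length As" for i
  proof -
    have prim: "primitive_idempotent ?P (?u i)" using u i by (auto simp: bij_betw_def)
    then have idem: "idempotent_elem ?P (?u i)" by (simp add: primitive_idempotent_def)
    have "primitive_idempotent ?Q (h (?u i))" by (rule ring_iso_primitive_idempotent[OF rP rQ h prim])
    then have "?v (\<tau> i) = h (?u i)"
      using bij_betw_inv_into_right[OF v] by (simp add: \<tau>_def)
    then have "corner ?P (?u i) \<simeq> corner ?Q (?v (\<tau> i))" using ring_iso_corner[OF rP h idem] by simp
    moreover have "corner ?P (?u i) \<simeq> As ! i"
      by (rule corner_unit_vector[OF _ _ _ i]) (use facA in auto)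
    then have "As ! i \<simeq> corner ?P (?u i)"
      using ring_iso_sym cring.axioms(1)[OF corner_cring[OF P idem]] by blast
    moreover have "\<tau> i < length Bs" using \<tau> i by (auto simp: bij_betw_def)
    then have "corner ?Q (?v (\<tau> i)) \<simeq> Bs ! \<tau> i"
      by (intro corner_unit_vector) (use facB in auto)
    ultimately have "As ! i \<simeq> Bs ! \<tau> i" by (meson ring_iso_trans)
    then show ?thesis using i by (simp add: \<sigma>_def)
  qed
  ultimately show ?thesis using len by blast
qed

text \<open>Existence is stated over the type of \<open>R\<close>, where the corners live. A
  quantifier cannot range over types, so the converse and the uniqueness are separate conjuncts with
  factors over arbitrary types.\<close>

theorem theorem1p1:
  fixes R :: "('a, 'm) ring_scheme"
  assumes "nonzero_cring R"
  shows "(isoartinian R \<longleftrightarrow> (\<exists>As :: 'a ring list. decomposition R As)) \<and>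
    (\<forall>As :: ('b, 'n) ring_scheme list. decomposition R As \<longrightarrow> isoartinian R) \<and>
    (\<forall>(As :: ('b, 'n) ring_scheme list) (Bs :: ('c, 'k) ring_scheme list).
       decomposition R As \<and> decomposition R Bs \<longrightarrow>
       length As = length Bs \<and>
       (\<exists>\<sigma>. \<sigma> permutes {..<length As} \<and> (\<forall>i<length As. As ! i \<simeq> Bs ! \<sigma> i)))"
proof -
  have R: "cring R" using assms by (simp add: nonzero_cring_def)
  note ring = cring.axioms(1)[OF R]
  have "isoartinian R \<longleftrightarrow> (\<exists>As :: 'a ring list. decomposition R As)"
    using isoartinian_imp_decomposition[OF R] decomposition_imp_isoartinian[OF ring] by metis
  moreover have "isoartinian R" if "decomposition R As" for As :: "('b, 'n) ring_scheme list"
    by (rule decomposition_imp_isoartinian[OF ring that])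
  moreover have "length As = length Bs \<and>
      (\<exists>\<sigma>. \<sigma> permutes {..<length As} \<and> (\<forall>i<length As. As ! i \<simeq> Bs ! \<sigma> i))"
    if "decomposition R As \<and> decomposition R Bs"
    for As :: "('b, 'n) ring_scheme list" and Bs :: "('c, 'k) ring_scheme list"
    using that by (intro decomposition_unique[OF ring]) auto
  ultimately show ?thesis by (intro conjI allI impI) simp_all
qed

end
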